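(* Let $G$ be a locally compact Lie group with Lie algebra $\mathfrak g$, let $\mathfrak h\subseteq\mathfrak g$ be a linear subspace which is a Hörmander system, equipped with an inner product with orthonormal basis $X_1,\dots,X_m$. Then for every strongly continuous unitary representation $\pi:G\to U(\mathcal K)$ on a Hilbert space $\mathcal K$ and every $g\in G$, $$\mathrm{Cost}_L\bigl(\mathrm{ad}_{\pi(g)}\bigr)\le d_{\mathfrak h}(g,e),\qquad \mathrm{ad}_{\pi(g)}(x):=\pi(g)^*x\,\pi(g),$$ where $\mathrm{Cost}_L$ is taken with respect to the semi-norm $$|||x|||_L=\Bigl\|\sum_{j=1}^m[d\pi(X_j),x]^*[d\pi(X_j),x]\Bigr\|_{op}^{1/2}$$ with domain $\mathcal A=\{x\in\mathcal B(\mathcal K): [d\pi(X_j),x]\in\mathcal B(\mathcal K)\ \text{for all } j\}$.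
   Context: $d\pi$ denotes the induced representation of $\mathfrak g$ by skew-adjoint (possibly unbounded) operators on $\mathcal K$, with $\pi(\exp X)=\exp(d\pi(X))$; $[d\pi(X_j),x]\in\mathcal B(\mathcal K)$ means the commutator is (extends to) a bounded operator. The cost of a channel $\Phi$ on $\mathcal B(\mathcal K)$ is $\mathrm{Cost}_L(\Phi)=\sup\{\|\Phi(x)-x\|_{op}: x=x^*\in\mathcal A,\ |||x|||_L\le1\}$. Hörmander system: the iterated Lie brackets of elements of $\mathfrak h$ span $\mathfrak g$. For $h=\sum_j\alpha_jX_j\in\mathfrak h$ put $\|h\|_{\mathfrak h}=(\sum_j|\alpha_j|^2)^{1/2}$. Let $L_g(h)=gh$ be left translation and $d(L_g):\mathfrak g\cong T_eG\to T_gG$ its differential at $e$. A piecewise smooth curve $\gamma:[0,1]\to G$ is horizontal if there is a measurable $X:[0,1]\to\mathfrak h$ with $\gamma'(t)=d(L_{\gamma(t)})(X(t))$ for almost every $t$. The Carnot–Carathéodory distance is $$d_{\mathfrak h}(g,h)=\inf\Bigl\{\int_0^1\|X(t)\|_{\mathfrak h}\,dt:\ \gamma \text{ horizontal},\ \gamma'(t)=d(L_{\gamma(t)})(X(t)),\ \gamma(0)=g,\ \gamma(1)=h\Bigr\}.$$ *)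

theory Defs
  imports "HOL-Analysis.Analysis"
begin

section \<open>Complex Hilbert spaces and bounded operators\<close>

text \<open>The inner product is conjugate-linear in the first argument.  Definiteness follows from
  \<open>cinner_self\<close>, and completeness is inherited from \<^class>\<open>banach\<close>.\<close>

class complex_hilbert_space = banach +
  fixes scaleC :: "complex \<Rightarrow> 'a \<Rightarrow> 'a" (infixr \<open>*\<^sub>C\<close> 75)
    and cinner :: "'a \<Rightarrow> 'a \<Rightarrow> complex"
  assumes scaleC_add_right: "a *\<^sub>C (x + y) = a *\<^sub>C x + a *\<^sub>C y"
    and scaleC_add_left: "(a + b) *\<^sub>C x = a *\<^sub>C x + b *\<^sub>C x"
    and scaleC_scaleC: "a *\<^sub>C b *\<^sub>C x = (a * b) *\<^sub>C x"
    and scaleC_one: "1 *\<^sub>C x = x"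
    and scaleR_scaleC: "r *\<^sub>R x = complex_of_real r *\<^sub>C x"
    and cinner_commute: "cinner x y = cnj (cinner y x)"
    and cinner_add_right: "cinner x (y + z) = cinner x y + cinner x z"
    and cinner_scaleC_right: "cinner x (a *\<^sub>C y) = a * cinner x y"
    and cinner_self: "cinner x x = complex_of_real ((norm x)\<^sup>2)"

text \<open>The library type \<open>'k \<Rightarrow>\<^sub>L 'k\<close> consists of the bounded real-linear operators with the operator
  norm; \<open>BK\<close> is its subset of complex-linear operators.\<close>

definition BK :: "('k::complex_hilbert_space \<Rightarrow>\<^sub>L 'k) set" where
  "BK = {A. \<forall>a \<xi>. blinfun_apply A (a *\<^sub>C \<xi>) = a *\<^sub>C blinfun_apply A \<xi>}"

definition cadj :: "('k::complex_hilbert_space \<Rightarrow>\<^sub>L 'k) \<Rightarrow> ('k \<Rightarrow>\<^sub>L 'k)" where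
  "cadj A = (THE B. \<forall>\<xi> \<eta>. cinner (blinfun_apply B \<xi>) \<eta> = cinner \<xi> (blinfun_apply A \<eta>))"

definition unitary_op :: "('k::complex_hilbert_space \<Rightarrow>\<^sub>L 'k) \<Rightarrow> bool" where
  "unitary_op U \<longleftrightarrow> U \<in> BK \<and> cadj U o\<^sub>L U = id_blinfun \<and> U o\<^sub>L cadj U = id_blinfun"


section \<open>Smooth maps and Lie groups\<close>

text \<open>On an open set in finite dimension this is the usual notion of a $C^k$ map.\<close>

fun Ck_on :: "nat \<Rightarrow> ('a::real_normed_vector \<Rightarrow> 'b::real_normed_vector) \<Rightarrow> 'a set \<Rightarrow> bool" where
  "Ck_on 0 f S \<longleftrightarrow> continuous_on S f"
| "Ck_on (Suc k) f S \<longleftrightarrow>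
     (\<forall>x\<in>S. f differentiable (at x)) \<and> (\<forall>v. Ck_on k (\<lambda>x. frechet_derivative f (at x) v) S)"

definition smooth_on :: "('a::real_normed_vector \<Rightarrow> 'b::real_normed_vector) \<Rightarrow> 'a set \<Rightarrow> bool" where
  "smooth_on f S \<longleftrightarrow> (\<forall>k. Ck_on k f S)"

text \<open>The model space \<open>'e\<close> is a finite-dimensional real Banach space rather than a
  \<^class>\<open>euclidean_space\<close>, because the latter class excludes dimension 0 (discrete groups).\<close>

definition finite_dim :: "'e::real_vector itself \<Rightarrow> bool" where
  "finite_dim _ \<longleftrightarrow> (\<exists>B::'e set. finite B \<and> span B = UNIV)"

text \<open>A chart is its domain together with its coordinate map; outside the domain the coordinate map
  is irrelevant.\<close>

type_synonym ('g, 'e) chart = "'g set \<times> ('g \<Rightarrow> 'e)"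

definition chart_inv :: "('g, 'e) chart \<Rightarrow> 'e \<Rightarrow> 'g" where
  "chart_inv c = inv_into (fst c) (snd c)"

definition is_chart :: "('g::topological_space, 'e::real_normed_vector) chart \<Rightarrow> bool" where
  "is_chart c \<longleftrightarrow> open (fst c) \<and> open (snd c ` fst c) \<and>
     homeomorphism (fst c) (snd c ` fst c) (snd c) (chart_inv c)"

definition smooth_atlas :: "('g::topological_space, 'e::real_normed_vector) chart set \<Rightarrow> bool" where
  "smooth_atlas \<A> \<longleftrightarrow>
     (\<forall>c\<in>\<A>. is_chart c) \<and> (\<Union>c\<in>\<A>. fst c) = UNIV \<and>
     (\<forall>c\<in>\<A>. \<forall>d\<in>\<A>. smooth_on (\<lambda>u. snd d (chart_inv c u)) (snd c ` (fst c \<inter> fst d)))"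

text \<open>The group law is written additively, as in the (not necessarily commutative) library class
  \<^class>\<open>topological_group_add\<close>: \<open>g + h\<close> is the product $gh$, \<open>- g\<close> is $g^{-1}$ and \<open>0\<close> is $e$.\<close>

definition lie_group :: "('g::{topological_group_add, t2_space}, 'e::banach) chart set \<Rightarrow> bool" where
  "lie_group \<A> \<longleftrightarrow>
     finite_dim TYPE('e) \<and> smooth_atlas \<A> \<and>
     (\<forall>c\<in>\<A>. \<forall>d\<in>\<A>. \<forall>f\<in>\<A>.
        smooth_on (\<lambda>(u, v). snd f (chart_inv c u + chart_inv d v))
          {(u, v). u \<in> snd c ` fst c \<and> v \<in> snd d ` fst d \<and> chart_inv c u + chart_inv d v \<in> fst f}) \<and>
     (\<forall>c\<in>\<A>. \<forall>d\<in>\<A>.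
        smooth_on (\<lambda>u. snd d (- chart_inv c u))
          {u. u \<in> snd c ` fst c \<and> - chart_inv c u \<in> fst d})"


section \<open>The Lie algebra\<close>

text \<open>Fix a chart \<open>c0\<close> around the identity.  It identifies the tangent space at the identity, and hence
  the Lie algebra, with the model space \<open>'e\<close>.  For a chart \<open>d\<close> around \<open>g\<close>, \<open>dL c0 g d X\<close> is the
  coordinate expression with respect to \<open>d\<close> of the tangent vector $d(L_g)(X) \in T_gG$.\<close>

definition dL ::
  "('g::topological_group_add, 'e::real_normed_vector) chart \<Rightarrow> 'g \<Rightarrow> ('g, 'e) chart \<Rightarrow> 'e \<Rightarrow> 'e" where
  "dL c0 g d X = frechet_derivative (\<lambda>u. snd d (g + chart_inv c0 u)) (at (snd c0 0)) X"

text \<open>The left-invariant vector field generated by \<open>X\<close>, in the coordinates \<open>c0\<close>.\<close>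

definition left_field ::
  "('g::topological_group_add, 'e::real_normed_vector) chart \<Rightarrow> 'e \<Rightarrow> 'e \<Rightarrow> 'e" where
  "left_field c0 X u = dL c0 (chart_inv c0 u) c0 X"

text \<open>The bracket of vector fields is $[V,W] = DW(V) - DV(W)$ in coordinates; the Lie algebra bracket is
  its value at the identity for left-invariant fields, where \<open>left_field c0 X (snd c0 0) = X\<close>.\<close>

definition lie_bracket ::
  "('g::topological_group_add, 'e::real_normed_vector) chart \<Rightarrow> 'e \<Rightarrow> 'e \<Rightarrow> 'e" where
  "lie_bracket c0 X Y =
     frechet_derivative (left_field c0 Y) (at (snd c0 0)) X -
     frechet_derivative (left_field c0 X) (at (snd c0 0)) Y"

inductive_set iterated_brackets ::
  "('g::topological_group_add, 'e::real_normed_vector) chart \<Rightarrow> 'e set \<Rightarrow> 'e set"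
  for c0 and \<hh> where
    "X \<in> \<hh> \<Longrightarrow> X \<in> iterated_brackets c0 \<hh>"
  | "X \<in> iterated_brackets c0 \<hh> \<Longrightarrow> Y \<in> iterated_brackets c0 \<hh> \<Longrightarrow>
       lie_bracket c0 X Y \<in> iterated_brackets c0 \<hh>"

definition hoermander_system ::
  "('g::topological_group_add, 'e::real_normed_vector) chart \<Rightarrow> 'e set \<Rightarrow> bool" where
  "hoermander_system c0 \<hh> \<longleftrightarrow> span (iterated_brackets c0 \<hh>) = UNIV"

text \<open>\<open>left_velocity \<A> c0 \<gamma> S t X\<close>: the curve \<open>\<gamma>\<close>, defined on \<open>S\<close>, is differentiable at \<open>t\<close> with
  $\gamma'(t) = d(L_{\gamma(t)})(X)$.\<close>

definition left_velocity ::
  "('g::topological_group_add, 'e::real_normed_vector) chart set \<Rightarrow> ('g, 'e) chart \<Rightarrow>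
   (real \<Rightarrow> 'g) \<Rightarrow> real set \<Rightarrow> real \<Rightarrow> 'e \<Rightarrow> bool" where
  "left_velocity \<A> c0 \<gamma> S t X \<longleftrightarrow>
     continuous (at t within S) \<gamma> \<and>
     (\<forall>d\<in>\<A>. \<gamma> t \<in> fst d \<longrightarrow>
        ((\<lambda>s. snd d (\<gamma> s)) has_vector_derivative dL c0 (\<gamma> t) d X) (at t within S))"

text \<open>The exponential map: the time-1 value of the integral curve through the identity of the
  left-invariant vector field generated by \<open>X\<close>.\<close>

definition lie_exp ::
  "('g::topological_group_add, 'e::real_normed_vector) chart set \<Rightarrow> ('g, 'e) chart \<Rightarrow> 'e \<Rightarrow> 'g" where
  "lie_exp \<A> c0 X = (THE \<gamma>. \<gamma> 0 = 0 \<and> (\<forall>t. left_velocity \<A> c0 \<gamma> UNIV t X)) 1"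


section \<open>The Carnot--Caratheodory distance\<close>

definition inner_product_on :: "'e::real_vector set \<Rightarrow> ('e \<Rightarrow> 'e \<Rightarrow> real) \<Rightarrow> bool" where
  "inner_product_on \<hh> ip \<longleftrightarrow>
     (\<forall>x\<in>\<hh>. \<forall>y\<in>\<hh>. ip x y = ip y x) \<and>
     (\<forall>x\<in>\<hh>. \<forall>y\<in>\<hh>. \<forall>z\<in>\<hh>. ip (x + y) z = ip x z + ip y z) \<and>
     (\<forall>r. \<forall>x\<in>\<hh>. \<forall>y\<in>\<hh>. ip (r *\<^sub>R x) y = r * ip x y) \<and>
     (\<forall>x\<in>\<hh>. x \<noteq> 0 \<longrightarrow> 0 < ip x x)"

definition orthonormal_basis ::
  "'e::real_vector set \<Rightarrow> ('e \<Rightarrow> 'e \<Rightarrow> real) \<Rightarrow> nat \<Rightarrow> (nat \<Rightarrow> 'e) \<Rightarrow> bool" where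
  "orthonormal_basis \<hh> ip m X \<longleftrightarrow>
     (\<forall>i\<in>{1..m}. X i \<in> \<hh>) \<and>
     (\<forall>i\<in>{1..m}. \<forall>j\<in>{1..m}. ip (X i) (X j) = (if i = j then 1 else 0)) \<and>
     span (X ` {1..m}) = \<hh>"

text \<open>For \<open>v\<close> in the span of the basis \<open>X 1, \<dots>, X m\<close>, \<open>representation (X ` {1..m}) v (X j)\<close> is the
  \<open>j\<close>-th coefficient of \<open>v\<close>.\<close>

definition hnorm :: "nat \<Rightarrow> (nat \<Rightarrow> 'e::real_vector) \<Rightarrow> 'e \<Rightarrow> real" where
  "hnorm m X v = sqrt (\<Sum>j = 1..m. \<bar>representation (X ` {1..m}) v (X j)\<bar>\<^sup>2)"

text \<open>Smoothness on a not necessarily open set of times (here: compact intervals, with one-sided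
  behaviour at the end points) means local existence of smooth extensions in charts.\<close>

definition smooth_curve_on ::
  "('g, 'e::real_normed_vector) chart set \<Rightarrow> (real \<Rightarrow> 'g) \<Rightarrow> real set \<Rightarrow> bool" where
  "smooth_curve_on \<A> \<gamma> S \<longleftrightarrow>
     (\<forall>t\<in>S. \<forall>d\<in>\<A>. \<gamma> t \<in> fst d \<longrightarrow>
        (\<exists>\<epsilon>>0. \<exists>f. smooth_on f {t - \<epsilon><..<t + \<epsilon>} \<and>
           (\<forall>s\<in>S \<inter> {t - \<epsilon><..<t + \<epsilon>}. \<gamma> s \<in> fst d \<and> snd d (\<gamma> s) = f s)))"

definition piecewise_smooth_curve ::
  "('g, 'e::real_normed_vector) chart set \<Rightarrow> (real \<Rightarrow> 'g) \<Rightarrow> bool" where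
  "piecewise_smooth_curve \<A> \<gamma> \<longleftrightarrow>
     (\<exists>n \<tau>. \<tau> 0 = 0 \<and> \<tau> n = 1 \<and>
        (\<forall>i<n. \<tau> i < \<tau> (Suc i) \<and> smooth_curve_on \<A> \<gamma> {\<tau> i..\<tau> (Suc i)}))"

definition horizontal ::
  "('g::topological_group_add, 'e::real_normed_vector) chart set \<Rightarrow> ('g, 'e) chart \<Rightarrow> 'e set \<Rightarrow>
   (real \<Rightarrow> 'g) \<Rightarrow> (real \<Rightarrow> 'e) \<Rightarrow> bool" where
  "horizontal \<A> c0 \<hh> \<gamma> Y \<longleftrightarrow>
     piecewise_smooth_curve \<A> \<gamma> \<and>
     Y \<in> borel_measurable (lebesgue_on {0..1}) \<and> (\<forall>t\<in>{0..1}. Y t \<in> \<hh>) \<and>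
     (AE t in lebesgue_on {0..1}. left_velocity \<A> c0 \<gamma> {0..1} t (Y t))"

text \<open>The value is \<open>\<infinity>\<close> if no horizontal curve joins the two points, which can happen if the group is
  not connected.\<close>

definition cc_dist ::
  "('g::topological_group_add, 'e::real_normed_vector) chart set \<Rightarrow> ('g, 'e) chart \<Rightarrow> 'e set \<Rightarrow>
   nat \<Rightarrow> (nat \<Rightarrow> 'e) \<Rightarrow> 'g \<Rightarrow> 'g \<Rightarrow> ennreal" where
  "cc_dist \<A> c0 \<hh> m X g h =
     Inf {\<integral>\<^sup>+ t. ennreal (hnorm m X (Y t)) \<partial>lebesgue_on {0..1} | \<gamma> Y.
            horizontal \<A> c0 \<hh> \<gamma> Y \<and> \<gamma> 0 = g \<and> \<gamma> 1 = h}"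


section \<open>Unitary representations and the cost\<close>

definition unitary_rep ::
  "('g::topological_group_add \<Rightarrow> ('k::complex_hilbert_space \<Rightarrow>\<^sub>L 'k)) \<Rightarrow> bool" where
  "unitary_rep \<pi> \<longleftrightarrow>
     (\<forall>g. unitary_op (\<pi> g)) \<and> \<pi> 0 = id_blinfun \<and> (\<forall>g h. \<pi> (g + h) = \<pi> g o\<^sub>L \<pi> h) \<and>
     (\<forall>\<xi>. continuous_on UNIV (\<lambda>g. blinfun_apply (\<pi> g) \<xi>))"

text \<open>$d\pi(X)$ is the skew-adjoint generator of the strongly continuous one-parameter unitary group
  $t \mapsto \pi(\exp tX)$, with its natural domain.\<close>

definition dpi_dom ::
  "('g::topological_group_add, 'e::real_normed_vector) chart set \<Rightarrow> ('g, 'e) chart \<Rightarrow>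
   ('g \<Rightarrow> ('k::complex_hilbert_space \<Rightarrow>\<^sub>L 'k)) \<Rightarrow> 'e \<Rightarrow> 'k set" where
  "dpi_dom \<A> c0 \<pi> X = {\<xi>. (\<lambda>t. blinfun_apply (\<pi> (lie_exp \<A> c0 (t *\<^sub>R X))) \<xi>) differentiable (at 0)}"

definition dpi ::
  "('g::topological_group_add, 'e::real_normed_vector) chart set \<Rightarrow> ('g, 'e) chart \<Rightarrow>
   ('g \<Rightarrow> ('k::complex_hilbert_space \<Rightarrow>\<^sub>L 'k)) \<Rightarrow> 'e \<Rightarrow> 'k \<Rightarrow> 'k" where
  "dpi \<A> c0 \<pi> X \<xi> = vector_derivative (\<lambda>t. blinfun_apply (\<pi> (lie_exp \<A> c0 (t *\<^sub>R X))) \<xi>) (at 0)"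

text \<open>\<open>C\<close> is the bounded extension of $[d\pi(X), x]$: the operator \<open>x\<close> preserves the domain of
  $d\pi(X)$, and \<open>C\<close> agrees with the commutator there.  It would not be enough to require this on
  those \<open>\<xi>\<close> in the domain for which \<open>x \<xi>\<close> happens to lie in the domain again: for translations of
  the circle, multiplication by a step function would then have commutator 0.
  As the domain is dense, \<open>C\<close> is unique.\<close>

definition is_bounded_commutator ::
  "('g::topological_group_add, 'e::real_normed_vector) chart set \<Rightarrow> ('g, 'e) chart \<Rightarrow>
   ('g \<Rightarrow> ('k::complex_hilbert_space \<Rightarrow>\<^sub>L 'k)) \<Rightarrow> 'e \<Rightarrow> ('k \<Rightarrow>\<^sub>L 'k) \<Rightarrow> ('k \<Rightarrow>\<^sub>L 'k) \<Rightarrow> bool" where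
  "is_bounded_commutator \<A> c0 \<pi> X x C \<longleftrightarrow>
     C \<in> BK \<and>
     (\<forall>\<xi>\<in>dpi_dom \<A> c0 \<pi> X.
        blinfun_apply x \<xi> \<in> dpi_dom \<A> c0 \<pi> X \<and>
        blinfun_apply C \<xi> = dpi \<A> c0 \<pi> X (blinfun_apply x \<xi>) - blinfun_apply x (dpi \<A> c0 \<pi> X \<xi>))"

definition commutator ::
  "('g::topological_group_add, 'e::real_normed_vector) chart set \<Rightarrow> ('g, 'e) chart \<Rightarrow>
   ('g \<Rightarrow> ('k::complex_hilbert_space \<Rightarrow>\<^sub>L 'k)) \<Rightarrow> 'e \<Rightarrow> ('k \<Rightarrow>\<^sub>L 'k) \<Rightarrow> ('k \<Rightarrow>\<^sub>L 'k)" where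
  "commutator \<A> c0 \<pi> X x = (THE C. is_bounded_commutator \<A> c0 \<pi> X x C)"

definition lip_domain ::
  "('g::topological_group_add, 'e::real_normed_vector) chart set \<Rightarrow> ('g, 'e) chart \<Rightarrow>
   ('g \<Rightarrow> ('k::complex_hilbert_space \<Rightarrow>\<^sub>L 'k)) \<Rightarrow> nat \<Rightarrow> (nat \<Rightarrow> 'e) \<Rightarrow> ('k \<Rightarrow>\<^sub>L 'k) set" where
  "lip_domain \<A> c0 \<pi> m X =
     {x \<in> BK. \<forall>j\<in>{1..m}. \<exists>C. is_bounded_commutator \<A> c0 \<pi> (X j) x C}"

definition lip_seminorm ::
  "('g::topological_group_add, 'e::real_normed_vector) chart set \<Rightarrow> ('g, 'e) chart \<Rightarrow>
   ('g \<Rightarrow> ('k::complex_hilbert_space \<Rightarrow>\<^sub>L 'k)) \<Rightarrow> nat \<Rightarrow> (nat \<Rightarrow> 'e) \<Rightarrow> ('k \<Rightarrow>\<^sub>L 'k) \<Rightarrow> real" where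
  "lip_seminorm \<A> c0 \<pi> m X x =
     sqrt (norm (\<Sum>j = 1..m. cadj (commutator \<A> c0 \<pi> (X j) x) o\<^sub>L commutator \<A> c0 \<pi> (X j) x))"

text \<open>The cost of a map \<open>\<Phi>\<close> with respect to a semi-norm \<open>L\<close> with domain \<open>D\<close>; it may be \<open>\<infinity>\<close>.\<close>

definition Cost ::
  "('k::complex_hilbert_space \<Rightarrow>\<^sub>L 'k) set \<Rightarrow> (('k \<Rightarrow>\<^sub>L 'k) \<Rightarrow> real) \<Rightarrow>
   (('k \<Rightarrow>\<^sub>L 'k) \<Rightarrow> ('k \<Rightarrow>\<^sub>L 'k)) \<Rightarrow> ennreal" where
  "Cost D L \<Phi> = (SUP x\<in>{x \<in> D. x = cadj x \<and> L x \<le> 1}. ennreal (norm (\<Phi> x - x)))"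

definition ad_channel ::
  "('k::complex_hilbert_space \<Rightarrow>\<^sub>L 'k) \<Rightarrow> ('k \<Rightarrow>\<^sub>L 'k) \<Rightarrow> ('k \<Rightarrow>\<^sub>L 'k)" where
  "ad_channel U x = cadj U o\<^sub>L x o\<^sub>L U"

end

theory Submission
  imports Defs
begin

text \<open>Fix a vector \<open>v\<close> and let $\Psi(g) = \pi(g)\, x\, \pi(g)^* v$; up to conjugation by $\pi(g)$ the
  quantity to bound is $\Psi(g) - \Psi(e)$.  Along a one-parameter subgroup, $\Psi(g \exp(sX_j))$ has
  derivative $c_j(g) = \pi(g) [d\pi(X_j), x] \pi(g)^* v$ at \<open>s = 0\<close>, for every \<open>v\<close> and not only for
  smooth vectors, because the commutator is bounded; moreover $c_j$ is continuous on \<open>G\<close>.  To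
  integrate this along a horizontal curve with controls $\alpha_j$, replace the curve over each cell of
  a fine partition by the product of the exponentials of $(\int \alpha_j) X_j$.  By a discrete Gronwall
  estimate in a chart these products converge to the curve, so continuity of $\Psi$ and $c_j$ gives
  $\Psi(\gamma(b)) - \Psi(\gamma(a)) \approx \sum_j (\int_a^b \alpha_j)\, c_j$ on short intervals.  The
  right-hand side has norm at most $|||x|||_L\, \|v\| \int_a^b \|\alpha\|$ by Cauchy--Schwarz.\<close>

text \<open>The obstacle is that \<Psi> cannot be differentiated along the curve by a chain rule:
  for a general v only its derivatives in the directions X_j are at hand, and these need not span
  the tangent space. Moving along exponentials only avoids this. The exponents come from comparing
  two Euler schemes: on a cell where the integral of the sum of the |\<alpha>_j| is at most A, both
  the curve and the product of exponentials move by the sum of (\<integral>\<alpha>_j) X_j, frozen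
  at the start of the cell, up to O(A^2). Hence the order of the factors affects only the quadratic
  error, and the controls need only be integrable. The vector v stays fixed throughout because the
  representation is only strongly continuous: the neighbourhoods depend on v, while the final bound
  does so only through its norm. Localising costs an error \<epsilon> times the integral of the sum
  of the |\<alpha>_j|; it is additive over subintervals, so local estimates can be glued before
  \<epsilon> tends to 0.\<close>

section \<open>Finite-dimensional normed spaces\<close>

text \<open>The model space carries an arbitrary norm, which is compared here with the coordinate
  norm. When \<open>v\<close> is added to \<open>T\<close>, the span of \<open>T\<close> is closed,
  so \<open>v\<close> has positive distance \<open>d\<close> from it; \<open>d\<close> controls the
  coefficient of \<open>v\<close>, and the induction hypothesis controls the others.\<close>

lemma coordinates_bounded:
  fixes S :: "'a::real_normed_vector set"
  assumes "finite S" and "independent S"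
  shows "\<exists>C. \<forall>a. (\<Sum>s\<in>S. \<bar>a s\<bar>) \<le> C * norm (\<Sum>s\<in>S. a s *\<^sub>R s)"
  using assms
proof (induction S rule: finite_induct)
  case empty
  then show ?case by auto
next
  case (insert v T)
  have indT: "independent T" and v: "v \<notin> span T"
    using insert.prems insert.hyps by (auto simp: independent_insert)
  obtain C where C: "\<And>a. (\<Sum>s\<in>T. \<bar>a s\<bar>) \<le> C * norm (\<Sum>s\<in>T. a s *\<^sub>R s)"
    using insert.IH indT by blast
  \<comment> \<open>By the induction hypothesis the coordinates of a convergent sequence in
    \<open>span T\<close> are Cauchy; their limits are coordinates of the limit.\<close>
  have "closed (span T)"
    unfolding closed_sequential_limits
  proof (intro allI impI, elim conjE)
    fix w l assume w: "\<forall>n::nat. w n \<in> span T" and l: "w \<longlonglongrightarrow> l"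
    have "\<exists>a. w n = (\<Sum>s\<in>T. a s *\<^sub>R s)" for n
      using w span_finite[OF insert.hyps(1)] by blast
    then obtain a where a: "\<And>n. w n = (\<Sum>s\<in>T. a n s *\<^sub>R s)" by metis
    have dif: "w n - w k = (\<Sum>s\<in>T. (a n s - a k s) *\<^sub>R s)" for n k
      by (simp add: a sum_subtractf scaleR_left_diff_distrib)
    have bnd: "\<bar>a n s - a k s\<bar> \<le> C * norm (w n - w k)" if "s \<in> T" for n k s
      unfolding dif by (rule order_trans[OF member_le_sum C]) (use that insert.hyps(1) in auto)
    have conv: "convergent (\<lambda>n. a n s)" if s: "s \<in> T" for s
    proof (rule Cauchy_convergent, rule metric_CauchyI)
      fix e :: real assume e: "e > 0"
      have "Cauchy w" using l by (simp add: LIMSEQ_imp_Cauchy)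
      then obtain M where M: "\<And>m n. m \<ge> M \<Longrightarrow> n \<ge> M \<Longrightarrow> norm (w m - w n) < e / (\<bar>C\<bar> + 1)"
        using e unfolding Cauchy_def dist_norm
        by (metis add_nonneg_pos abs_ge_zero divide_pos_pos zero_less_one)
      have "dist (a m s) (a n s) < e" if "m \<ge> M" "n \<ge> M" for m n
      proof -
        have "\<bar>a m s - a n s\<bar> \<le> (\<bar>C\<bar> + 1) * norm (w m - w n)"
          by (rule order_trans[OF bnd[OF s] mult_right_mono]) auto
        also have "\<dots> < e" using M[OF that] by (simp add: field_simps)
        finally show ?thesis by (simp add: dist_real_def)
      qed
      then show "\<exists>M. \<forall>m\<ge>M. \<forall>n\<ge>M. dist (a m s) (a n s) < e" by blast
    qed
    then obtain b where b: "\<And>s. s \<in> T \<Longrightarrow> (\<lambda>n. a n s) \<longlonglongrightarrow> b s"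
      unfolding convergent_def by metis
    have "w \<longlonglongrightarrow> (\<Sum>s\<in>T. b s *\<^sub>R s)"
      unfolding a by (intro tendsto_sum tendsto_scaleR b tendsto_const)
    then have "l = (\<Sum>s\<in>T. b s *\<^sub>R s)" using l LIMSEQ_unique by blast
    then show "l \<in> span T" by (simp add: span_sum span_scale span_base)
  qed
  then have "open (- span T)" "v \<in> - span T" using v by auto
  then obtain d where d0: "d > 0" "ball v d \<subseteq> - span T" using openE by blast
  then have d: "d > 0" "\<And>w. w \<in> span T \<Longrightarrow> d \<le> dist v w"
    by (auto simp: subset_iff not_less[symmetric])
  have dv: "\<bar>c\<bar> * d \<le> norm (c *\<^sub>R v + w)" if w: "w \<in> span T" for c w
  proof (cases "c = 0")
    case False
    have "d \<le> dist v (- (inverse c *\<^sub>R w))" by (intro d span_neg span_scale w)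
    then have "\<bar>c\<bar> * d \<le> \<bar>c\<bar> * norm (v + inverse c *\<^sub>R w)"
      by (simp add: dist_norm mult_left_mono)
    also have "\<dots> = norm (c *\<^sub>R (v + inverse c *\<^sub>R w))" by simp
    also have "\<dots> = norm (c *\<^sub>R v + w)" using False by (simp add: scaleR_add_right)
    finally show ?thesis .
  qed simp
  \<comment> \<open>The first summand pays for the coefficient of \<open>v\<close>. The second pays
    for the rest: removing the multiple of \<open>v\<close> costs at most a factor
    \<open>1 + norm v / d\<close>.\<close>
  let ?C = "1 / d + \<bar>C\<bar> * (1 + norm v / d)"
  have "(\<Sum>s\<in>insert v T. \<bar>a s\<bar>) \<le> ?C * norm (\<Sum>s\<in>insert v T. a s *\<^sub>R s)" for a
  proof -
    let ?w = "\<Sum>s\<in>T. a s *\<^sub>R s" and ?N = "norm (a v *\<^sub>R v + (\<Sum>s\<in>T. a s *\<^sub>R s))"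
    have "?w \<in> span T" by (simp add: span_sum span_scale span_base)
    then have av: "\<bar>a v\<bar> \<le> ?N / d" using dv[of ?w "a v"] d(1) by (simp add: field_simps)
    have "norm ?w \<le> ?N + \<bar>a v\<bar> * norm v"
      using norm_triangle_ineq4[of "a v *\<^sub>R v + ?w" "a v *\<^sub>R v"] by simp
    also have "\<dots> \<le> ?N + ?N / d * norm v" using av by (intro add_mono mult_right_mono) auto
    finally have "norm ?w \<le> (1 + norm v / d) * ?N" by (simp add: algebra_simps)
    then have "\<bar>C\<bar> * norm ?w \<le> \<bar>C\<bar> * ((1 + norm v / d) * ?N)" by (intro mult_left_mono) auto
    moreover have "(\<Sum>s\<in>T. \<bar>a s\<bar>) \<le> \<bar>C\<bar> * norm ?w"
      by (rule order_trans[OF C mult_right_mono]) auto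
    ultimately have "(\<Sum>s\<in>insert v T. \<bar>a s\<bar>) \<le> ?N / d + \<bar>C\<bar> * ((1 + norm v / d) * ?N)"
      using av insert.hyps by simp
    then show ?thesis using insert.hyps by (simp add: algebra_simps)
  qed
  then show ?case by blast
qed

text \<open>\<open>B\<close> and \<open>C\<close> do not depend on \<open>f\<close>. This matters
  because \<open>Ck_on\<close> makes a derivative continuous only in each fixed direction, so
  finitely many directions must control the operator norm uniformly in the base point.\<close>

lemma finite_dim_linear_bound:
  assumes "finite_dim TYPE('e::real_normed_vector)"
  obtains B :: "'e::real_normed_vector set" and C where "finite B" "0 \<le> C"
    "\<And>(f :: 'e \<Rightarrow> 'b::real_normed_vector) w. linear f \<Longrightarrow> norm (f w) \<le> C * (\<Sum>b\<in>B. norm (f b)) * norm w"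
proof -
  obtain B0 :: "'e set" where B0: "finite B0" "span B0 = UNIV"
    using assms unfolding finite_dim_def by blast
  obtain B where B: "B \<subseteq> B0" "independent B" "B0 \<subseteq> span B"
    using maximal_independent_subset[of B0] by blast
  have fB: "finite B" using B(1) B0(1) by (rule finite_subset)
  have sp: "span B = UNIV" using B(3) B0(2) by (metis span_mono span_span top.extremum_uniqueI)
  obtain C where C: "\<And>a. (\<Sum>s\<in>B. \<bar>a s\<bar>) \<le> C * norm (\<Sum>s\<in>B. a s *\<^sub>R s)"
    using coordinates_bounded[OF fB B(2)] by blast
  have "norm (f w) \<le> \<bar>C\<bar> * (\<Sum>b\<in>B. norm (f b)) * norm w"
    if f: "linear f" for f :: "'e \<Rightarrow> 'b" and w
  proof -
    have "w \<in> range (\<lambda>a. \<Sum>s\<in>B. a s *\<^sub>R s)" using span_finite[OF fB] sp by simp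
    then obtain a where a: "w = (\<Sum>s\<in>B. a s *\<^sub>R s)" by blast
    have le: "\<bar>a s\<bar> \<le> \<bar>C\<bar> * norm w" if "s \<in> B" for s
    proof -
      have "\<bar>a s\<bar> \<le> (\<Sum>s\<in>B. \<bar>a s\<bar>)" by (rule member_le_sum) (use that fB in auto)
      also have "\<dots> \<le> C * norm w" unfolding a by (rule C)
      also have "\<dots> \<le> \<bar>C\<bar> * norm w" by (intro mult_right_mono) auto
      finally show ?thesis .
    qed
    have "f w = (\<Sum>s\<in>B. a s *\<^sub>R f s)"
      unfolding a using f by (simp add: linear_sum linear_cmul)
    also have "norm \<dots> \<le> (\<Sum>s\<in>B. \<bar>C\<bar> * norm w * norm (f s))"
      by (rule order_trans[OF norm_sum sum_mono]) (auto intro!: mult_right_mono le)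
    also have "\<dots> = \<bar>C\<bar> * (\<Sum>b\<in>B. norm (f b)) * norm w"
      by (simp add: sum_distrib_left mult_ac)
    finally show ?thesis .
  qed
  then show ?thesis using that[of B "\<bar>C\<bar>"] fB by auto
qed

lemma finite_dim_bounded_linear:
  assumes "finite_dim TYPE('e::real_normed_vector)" and f: "linear (f :: 'e::real_normed_vector \<Rightarrow> 'b::real_normed_vector)"
  shows "bounded_linear f"
proof -
  obtain B :: "'e set" and C where
    "\<And>(f :: 'e \<Rightarrow> 'b) w. linear f \<Longrightarrow> norm (f w) \<le> C * (\<Sum>b\<in>B. norm (f b)) * norm w"
    using finite_dim_linear_bound[OF assms(1)] by metis
  from this[OF f] show ?thesis
    by (intro bounded_linear_intro[where K = "C * (\<Sum>b\<in>B. norm (f b))"])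
      (auto simp: linear_add[OF f] linear_cmul[OF f] mult.commute)
qed

text \<open>The sum of the norms of the directional derivatives over a basis is continuous at
  \<open>u0\<close>, hence near \<open>u0\<close> at most its value there plus 1. This bounds the
  operator norm of the derivative, and the mean value inequality applies on the convex ball.\<close>

lemma C1_imp_locally_Lipschitz:
  fixes f :: "'e::real_normed_vector \<Rightarrow> 'b::real_normed_vector"
  assumes fd: "finite_dim TYPE('e)" and S: "open S" "u0 \<in> S"
    and diff: "\<And>u. u \<in> S \<Longrightarrow> f differentiable (at u)"
    and cont: "\<And>w. continuous_on S (\<lambda>u. frechet_derivative f (at u) w)"
  obtains r \<Lambda> where "r > 0" "\<Lambda> \<ge> 0" "cball u0 r \<subseteq> S"
    "\<And>u v. u \<in> cball u0 r \<Longrightarrow> v \<in> cball u0 r \<Longrightarrow> norm (f u - f v) \<le> \<Lambda> * norm (u - v)"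
proof -
  let ?D = "\<lambda>u. frechet_derivative f (at u)"
  obtain B :: "'e set" and C where fB: "finite B" and C: "0 \<le> C"
    "\<And>(f :: 'e \<Rightarrow> 'b) w. linear f \<Longrightarrow> norm (f w) \<le> C * (\<Sum>b\<in>B. norm (f b)) * norm w"
    using finite_dim_linear_bound[OF fd] by metis
  have "isCont (\<lambda>u. \<Sum>b\<in>B. norm (?D u b)) u0"
    using cont S by (intro continuous_intros) (auto simp: continuous_on_eq_continuous_at)
  then obtain e where e: "e > 0" "\<And>u. dist u u0 < e \<Longrightarrow> dist (\<Sum>b\<in>B. norm (?D u b)) (\<Sum>b\<in>B. norm (?D u0 b)) < 1"
    unfolding continuous_at_eps_delta by (metis zero_less_one)
  have e: "e > 0" "\<And>u. dist u u0 < e \<Longrightarrow> (\<Sum>b\<in>B. norm (?D u b)) < (\<Sum>b\<in>B. norm (?D u0 b)) + 1"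
    using e by (auto simp: dist_real_def abs_less_iff algebra_simps)
  obtain e' where e': "e' > 0" "cball u0 e' \<subseteq> S" using S open_contains_cball by blast
  let ?r = "min (e / 2) e'" and ?L = "C * ((\<Sum>b\<in>B. norm (?D u0 b)) + 1)"
  have sub: "cball u0 ?r \<subseteq> S" using e'(2) by auto
  have L: "0 \<le> ?L" using C(1) by (simp add: sum_nonneg add_nonneg_nonneg)
  have der: "(f has_derivative ?D u) (at u)" if "u \<in> S" for u
    using diff[OF that] by (simp add: frechet_derivative_works)
  have onD: "onorm (?D u) \<le> ?L" if u: "u \<in> cball u0 ?r" for u
  proof (rule onorm_bound[OF L])
    fix w
    have "linear (?D u)" using der sub u has_derivative_linear by blast
    then have "norm (?D u w) \<le> C * (\<Sum>b\<in>B. norm (?D u b)) * norm w" by (rule C(2))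
    also have "\<dots> \<le> ?L * norm w"
    proof (intro mult_right_mono mult_left_mono C(1))
      have "dist u u0 < e" using u e(1) by (auto simp: dist_commute)
      then show "(\<Sum>b\<in>B. norm (?D u b)) \<le> (\<Sum>b\<in>B. norm (?D u0 b)) + 1" by (rule less_imp_le[OF e(2)])
    qed auto
    finally show "norm (?D u w) \<le> ?L * norm w" .
  qed
  have derc: "(f has_derivative ?D u) (at u within cball u0 ?r)" if "u \<in> cball u0 ?r" for u
    by (rule has_derivative_at_withinI[OF der[OF subsetD[OF sub that]]])
  have "norm (f u - f v) \<le> ?L * norm (u - v)"
    if "u \<in> cball u0 ?r" "v \<in> cball u0 ?r" for u v
    using derc onD that by (rule differentiable_bound[OF convex_cball])
  then show ?thesis using that[of ?r ?L] e(1) e'(1) sub L by auto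
qed


section \<open>Ordinary differential equations with Lipschitz right-hand side\<close>

text \<open>The integral operator is a contraction on the continuous functions with values in the
  closed ball. Clamping the time to \<open>{- a..a}\<close> places them in the complete space of
  bounded continuous functions on the whole line.\<close>

lemma picard_lindelof:
  fixes V :: "'e::banach \<Rightarrow> 'e"
  assumes r: "r > 0" and lip: "\<And>u v. u \<in> cball u0 r \<Longrightarrow> v \<in> cball u0 r \<Longrightarrow> norm (V u - V v) \<le> \<Lambda> * norm (u - v)"
  obtains \<epsilon> u where "\<epsilon> > 0" "u (0::real) = u0"
    "\<And>t. \<bar>t\<bar> < \<epsilon> \<Longrightarrow> u t \<in> cball u0 r \<and> (u has_vector_derivative V (u t)) (at t)"
proof -
  define L where "L = max \<Lambda> 1"
  have L: "L \<ge> 1" by (simp add: L_def)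
  have lip': "norm (V u - V v) \<le> L * norm (u - v)" if "u \<in> cball u0 r" "v \<in> cball u0 r" for u v
    using lip[OF that] mult_right_mono[of \<Lambda> L "norm (u - v)"] unfolding L_def by auto
  define M where "M = norm (V u0) + L * r"
  have M: "M \<ge> 0" "norm (V u) \<le> M" if "u \<in> cball u0 r" for u
  proof -
    show "M \<ge> 0" using L r by (simp add: M_def)
    have "norm (V u) \<le> norm (V u0) + norm (V u - V u0)" by (metis add.commute norm_triangle_sub)
    also have "\<dots> \<le> norm (V u0) + L * norm (u - u0)" using lip'[of u u0] that r by auto
    also have "L * norm (u - u0) \<le> L * r"
      using that L by (intro mult_left_mono) (auto simp: dist_norm norm_minus_commute)
    finally show "norm (V u) \<le> M" by (simp add: M_def)
  qed
  have M0: "M \<ge> 0" using M(1)[of u0] r by simp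
  \<comment> \<open>\<open>a * M \<le> r\<close> keeps the values of the integral operator in the
    ball, and \<open>a * L \<le> 1 / 2\<close> makes it a contraction.\<close>
  define a where "a = min (r / (M + 1)) (1 / (2 * L))"
  have a: "a > 0" "a * M \<le> r" "a * L \<le> 1 / 2"
  proof -
    show "a > 0" using r M0 L by (simp add: a_def)
    have "a * M \<le> r / (M + 1) * M" using M0 by (intro mult_right_mono) (auto simp: a_def)
    also have "\<dots> \<le> r" using r M0 by (simp add: field_simps)
    finally show "a * M \<le> r" .
    have "a * L \<le> 1 / (2 * L) * L" using L by (intro mult_right_mono) (auto simp: a_def)
    then show "a * L \<le> 1 / 2" using L by simp
  qed
  have Vc: "continuous_on (cball u0 r) V"
    using L by (intro lipschitz_on_continuous_on[of L] lipschitz_onI) (auto simp: dist_norm intro!: lip')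
  define cl where "cl t = max (- a) (min a t)" for t :: real
  have cl: "cl t \<in> {- a..a}" for t using a(1) by (auto simp: cl_def)
  have cl0: "cl 0 = 0" using a(1) by (auto simp: cl_def)
  \<comment> \<open>Integration starts at \<open>- a\<close>, so that differences
    \<open>F f t - F f 0\<close> cover both signs of \<open>t\<close>.\<close>
  define F where "F f t = integral {- a..t} (\<lambda>s. V (f s))" for f :: "real \<Rightarrow> 'e" and t
  define S where "S = PiC UNIV (\<lambda>_::real. cball u0 r)"
  have S: "apply_bcontfun f t \<in> cball u0 r" if "f \<in> S" for f t
    using that by (auto simp: S_def mem_PiC_iff Pi_def)
  have Vfc: "continuous_on {- a..a} (\<lambda>s. V (apply_bcontfun f s))" if "f \<in> S" for f
    using S[OF that] by (intro continuous_on_compose2[OF Vc]) auto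
  have Fder: "(F (apply_bcontfun f) has_vector_derivative V (apply_bcontfun f t)) (at t within {- a..a})"
    if "f \<in> S" "t \<in> {- a..a}" for f t
    unfolding F_def using integral_has_vector_derivative[OF Vfc] that by blast
  define T where "T f t = u0 + (F (apply_bcontfun f) (cl t) - F (apply_bcontfun f) 0)" for f t
  \<comment> \<open>This mean value bound serves twice, for the invariance of the ball and for the
    contraction estimate.\<close>
  have near: "norm (G t - G 0) \<le> K * \<bar>t\<bar>"
    if "\<And>t. t \<in> {- a..a} \<Longrightarrow> (G has_vector_derivative g t) (at t within {- a..a})"
      "\<And>t. t \<in> {- a..a} \<Longrightarrow> norm (g t) \<le> K" "t \<in> {- a..a}" for G g :: "real \<Rightarrow> 'e" and K t
  proof -
    have "norm (G t - G 0) \<le> K * norm (t - 0)"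
    proof (rule differentiable_bound[where S = "{- a..a}" and f' = "\<lambda>t x. x *\<^sub>R g t"])
      show "onorm (\<lambda>x. x *\<^sub>R g t) \<le> K" if "t \<in> {- a..a}" for t
        using \<open>\<And>t. t \<in> {- a..a} \<Longrightarrow> norm (g t) \<le> K\<close>[OF that]
        by (intro onorm_le) (simp add: mult.commute[of K] mult_left_mono)
    qed (use that a(1) in \<open>auto simp: has_vector_derivative_def\<close>)
    then show ?thesis by simp
  qed
  have Tin: "T f t \<in> cball u0 r" if f: "f \<in> S" for f t
  proof -
    have "norm (F (apply_bcontfun f) (cl t) - F (apply_bcontfun f) 0) \<le> M * \<bar>cl t\<bar>"
      by (rule near[OF Fder[OF f]]) (use M(2) S f cl in auto)
    also have "\<dots> \<le> M * a" using cl[of t] M0 by (intro mult_left_mono) auto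
    finally show ?thesis using a(2) by (simp add: T_def dist_norm norm_minus_commute mult.commute)
  qed
  have Tcont: "continuous_on UNIV (T f)" if f: "f \<in> S" for f
  proof -
    have "continuous_on {- a..a} (F (apply_bcontfun f))"
      using Fder[OF f] by (rule continuous_on_vector_derivative)
    moreover have "continuous_on UNIV cl" unfolding cl_def by (intro continuous_intros)
    ultimately have "continuous_on UNIV (\<lambda>t. F (apply_bcontfun f) (cl t))"
      by (rule continuous_on_compose2) (use cl in blast)
    then have "continuous_on UNIV (\<lambda>t. T f t)"
      unfolding T_def by (intro continuous_on_add continuous_on_diff continuous_on_const)
    then show ?thesis by simp
  qed
  have Tb: "apply_bcontfun (Bcontfun (T f)) = T f" if "f \<in> S" for f
  proof (rule Bcontfun_inverse, rule bcontfun_normI[OF Tcont[OF that]])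
    show "norm (T f t) \<le> norm u0 + r" for t
      using Tin[OF that, of t] norm_triangle_ineq2[of "T f t" u0]
      by (simp add: dist_norm norm_minus_commute)
  qed
  have "\<exists>!f\<in>S. Bcontfun (T f) = f"
  proof (rule Banach_fix[where c = "1 / 2"])
    show "complete S" unfolding S_def by (intro closed_PiC complete_eq_closed[THEN iffD2]) auto
    have "const_bcontfun u0 \<in> S" using r by (auto simp: S_def mem_PiC_iff const_bcontfun.rep_eq)
    then show "S \<noteq> {}" by blast
    show "(\<lambda>f. Bcontfun (T f)) ` S \<subseteq> S"
      using Tb Tin by (auto simp: S_def mem_PiC_iff Pi_def)
    show "dist (Bcontfun (T f)) (Bcontfun (T g)) \<le> 1 / 2 * dist f g"
      if f: "f \<in> S" and g: "g \<in> S" for f g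
    proof (rule dist_bound)
      fix t
      have "norm ((F f (cl t) - F g (cl t)) - (F f 0 - F g 0)) \<le> (L * dist f g) * \<bar>cl t\<bar>"
      proof (rule near[where G = "\<lambda>t. F f t - F g t" and g = "\<lambda>t. V (f t) - V (g t)"])
        show "((\<lambda>t. F f t - F g t) has_vector_derivative V (f t) - V (g t)) (at t within {- a..a})"
          if "t \<in> {- a..a}" for t
          using Fder f g that by (intro has_vector_derivative_diff) auto
        show "norm (V (f t) - V (g t)) \<le> L * dist f g" for t
        proof -
          have "norm (V (f t) - V (g t)) \<le> L * norm (f t - g t)" using lip' S f g by blast
          also have "\<dots> \<le> L * dist f g"
            using L dist_bounded[of f t g] by (intro mult_left_mono) (auto simp: dist_norm)
          finally show ?thesis .
        qed
      qed (rule cl)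
      also have "\<dots> \<le> (L * dist f g) * a" using cl[of t] L by (intro mult_left_mono) auto
      also have "\<dots> \<le> 1 / 2 * dist f g"
        using mult_right_mono[OF a(3), of "dist f g"] by (simp add: mult_ac)
      finally show "dist (Bcontfun (T f) t) (Bcontfun (T g) t) \<le> 1 / 2 * dist f g"
        by (simp add: Tb f g T_def dist_norm algebra_simps)
    qed
  qed auto
  then obtain f where f: "f \<in> S" "Bcontfun (T f) = f" by blast
  have fT: "apply_bcontfun f t = T f t" for t using Tb[OF f(1)] f(2) by simp
  have "(f has_vector_derivative V (f t)) (at t)" if t: "\<bar>t\<bar> < a" for t
  proof -
    have "(F f has_vector_derivative V (f t)) (at t within {- a<..<a})"
      using t by (intro has_vector_derivative_within_subset[OF Fder[OF f(1)]]) auto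
    then have "(F f has_vector_derivative V (f t)) (at t)"
      using t by (subst (asm) at_within_open) auto
    then have "((\<lambda>t. u0 + (F f t - F f 0)) has_vector_derivative V (f t)) (at t)"
      by (auto intro!: derivative_eq_intros)
    then show ?thesis
      by (rule has_vector_derivative_transform_within_open[where S = "{- a<..<a}"])
        (use t in \<open>auto simp: fT T_def cl_def\<close>)
  qed
  moreover have "f 0 = u0" using fT[of 0] by (simp add: T_def cl0)
  ultimately show ?thesis using that[of a "apply_bcontfun f"] a(1) S[OF f(1)] by blast
qed

text \<open>On a short interval the difference \<open>w\<close> of the solutions attains its largest
  norm at some \<open>s\<close>. The Lipschitz bound and the mean value inequality from
  \<open>t0\<close> give \<open>norm (w s) \<le> 1 / 2 * norm (w s)\<close>, so \<open>w\<close>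
  vanishes.\<close>

lemma ode_locally_unique:
  fixes V :: "'e::real_normed_vector \<Rightarrow> 'e" and u1 u2 :: "real \<Rightarrow> 'e"
  assumes r: "r > 0"
    and lip: "\<And>u v. u \<in> cball u0 r \<Longrightarrow> v \<in> cball u0 r \<Longrightarrow> norm (V u - V v) \<le> \<Lambda> * norm (u - v)"
    and \<delta>: "\<delta> > 0" and eq: "u1 t0 = u0" "u2 t0 = u0"
    and d1: "\<And>t. \<bar>t - t0\<bar> < \<delta> \<Longrightarrow> (u1 has_vector_derivative V (u1 t)) (at t)"
    and d2: "\<And>t. \<bar>t - t0\<bar> < \<delta> \<Longrightarrow> (u2 has_vector_derivative V (u2 t)) (at t)"
  obtains \<epsilon> where "\<epsilon> > 0" "\<And>t. \<bar>t - t0\<bar> < \<epsilon> \<Longrightarrow> u1 t = u2 t"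
proof -
  define L where "L = max \<Lambda> 1"
  have L: "L \<ge> 1" by (simp add: L_def)
  have lip': "norm (V u - V v) \<le> L * norm (u - v)" if "u \<in> cball u0 r" "v \<in> cball u0 r" for u v
    using lip[OF that] mult_right_mono[of \<Lambda> L "norm (u - v)"] unfolding L_def by auto
  have "\<exists>\<epsilon>>0. \<forall>t. \<bar>t - t0\<bar> < \<epsilon> \<longrightarrow> u t \<in> cball u0 r"
    if "(u has_vector_derivative V (u t0)) (at t0)" "u t0 = u0" for u :: "real \<Rightarrow> 'e"
  proof -
    have "isCont u t0" using that(1) has_vector_derivative_continuous by blast
    then show ?thesis using r that(2) unfolding continuous_at_eps_delta mem_cball
      by (metis dist_commute dist_real_def less_imp_le)
  qed
  from this[OF d1] this[OF d2] obtain e1 e2 where e1: "e1 > 0" "\<And>t. \<bar>t - t0\<bar> < e1 \<Longrightarrow> u1 t \<in> cball u0 r"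
    and e2: "e2 > 0" "\<And>t. \<bar>t - t0\<bar> < e2 \<Longrightarrow> u2 t \<in> cball u0 r"
    using eq \<delta> by auto
  define a where "a = min (min (e1 / 2) (e2 / 2)) (min (\<delta> / 2) (1 / (2 * L)))"
  have a: "a > 0" "a < e1" "a < e2" "a < \<delta>" "a * L \<le> 1 / 2"
  proof -
    show "a > 0" "a < e1" "a < e2" "a < \<delta>"
      using e1(1) e2(1) \<delta> L unfolding a_def by (auto simp: min_less_iff_disj)
    have "a * L \<le> 1 / (2 * L) * L" using L by (intro mult_right_mono) (auto simp: a_def)
    then show "a * L \<le> 1 / 2" using L by simp
  qed
  define w where "w t = u1 t - u2 t" for t
  have wd: "(w has_vector_derivative V (u1 t) - V (u2 t)) (at t within {t0 - a..t0 + a})"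
    if "t \<in> {t0 - a..t0 + a}" for t
    unfolding w_def using that a
    by (intro has_vector_derivative_diff has_vector_derivative_at_within[OF d1]
        has_vector_derivative_at_within[OF d2]) auto
  have "continuous_on {t0 - a..t0 + a} w"
    using wd by (rule continuous_on_vector_derivative)
  then have "continuous_on {t0 - a..t0 + a} (\<lambda>t. norm (w t))" by (intro continuous_intros)
  then obtain s where s: "s \<in> {t0 - a..t0 + a}" "\<And>t. t \<in> {t0 - a..t0 + a} \<Longrightarrow> norm (w t) \<le> norm (w s)"
    using continuous_attains_sup[of "{t0 - a..t0 + a}" "\<lambda>t. norm (w t)"] a(1) by auto
  have "norm (w s - w t0) \<le> (L * norm (w s)) * norm (s - t0)"
  proof (rule differentiable_bound[where S = "{t0 - a..t0 + a}" and f' = "\<lambda>t x. x *\<^sub>R (V (u1 t) - V (u2 t))"])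
    show "onorm (\<lambda>x. x *\<^sub>R (V (u1 t) - V (u2 t))) \<le> L * norm (w s)" if t: "t \<in> {t0 - a..t0 + a}" for t
    proof (rule onorm_le)
      fix x :: real
      have "norm (V (u1 t) - V (u2 t)) \<le> L * norm (w t)"
        unfolding w_def using t a by (intro lip' e1 e2) auto
      also have "\<dots> \<le> L * norm (w s)" using s(2)[OF t] L by (intro mult_left_mono) auto
      finally show "norm (x *\<^sub>R (V (u1 t) - V (u2 t))) \<le> L * norm (w s) * norm x"
        by (simp add: mult.commute mult_left_mono)
    qed
  qed (use wd s a in \<open>auto simp: has_vector_derivative_def\<close>)
  also have "\<dots> \<le> (L * norm (w s)) * a" using s(1) L by (intro mult_left_mono) auto
  also have "\<dots> \<le> 1 / 2 * norm (w s)" using mult_right_mono[OF a(5), of "norm (w s)"] by (simp add: mult_ac)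
  finally have "norm (w s) = 0" using eq by (simp add: w_def)
  then have "u1 t = u2 t" if "\<bar>t - t0\<bar> < a" for t
    using s(2)[of t] that by (auto simp: w_def abs_less_iff)
  then show ?thesis using that[of a] a(1) by blast
qed

section \<open>Left-invariant vector fields and one-parameter subgroups\<close>

lemma left_velocity_cong:
  assumes "left_velocity \<A> c0 \<gamma> UNIV t X" and "open T" "t \<in> T" and eq: "\<And>s. s \<in> T \<Longrightarrow> \<gamma> s = \<gamma>' s"
  shows "left_velocity \<A> c0 \<gamma>' UNIV t X"
proof -
  have "\<forall>\<^sub>F s in nhds t. \<gamma> s = \<gamma>' s"
    using eventually_nhds_in_open[OF assms(2,3)] by eventually_elim (rule eq)
  then have "isCont \<gamma>' t"
    using assms(1) isCont_cong unfolding left_velocity_def by blast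
  moreover have "((\<lambda>s. snd d (\<gamma>' s)) has_vector_derivative v) (at t)"
    if "((\<lambda>s. snd d (\<gamma> s)) has_vector_derivative v) (at t)" for d v
    by (rule has_vector_derivative_transform_within_open[OF that assms(2,3)]) (simp add: eq)
  ultimately show ?thesis using assms(1) unfolding left_velocity_def eq[OF assms(3)] by blast
qed

section \<open>Charts of the group and derivatives of left translations\<close>

locale lie_group_chart =
  fixes \<A> :: "('g::{topological_group_add, t2_space}, 'e::banach) chart set"
    and c0 :: "('g, 'e) chart"
  assumes lie: "lie_group \<A>" and c0: "c0 \<in> \<A>" and e_c0: "0 \<in> fst c0"
begin

abbreviation im :: "('g, 'e) chart \<Rightarrow> 'e set" where "im d \<equiv> snd d ` fst d"

lemma finite_dim_model: "finite_dim TYPE('e)"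
  using lie by (simp add: lie_group_def)

lemma chart_cover: obtains d where "d \<in> \<A>" "g \<in> fst d"
  using lie unfolding lie_group_def smooth_atlas_def by blast

context
  fixes d assumes d: "d \<in> \<A>"
begin

lemma is_chart: "is_chart d"
  using d lie by (auto simp: lie_group_def smooth_atlas_def)

lemma chart_open: "open (fst d)" "open (im d)"
  using is_chart by (auto simp: is_chart_def)

lemma chart_inv_snd: "h \<in> fst d \<Longrightarrow> chart_inv d (snd d h) = h"
  using is_chart by (auto simp: is_chart_def homeomorphism_def)

lemma snd_chart_inv: "u \<in> im d \<Longrightarrow> snd d (chart_inv d u) = u"
  using is_chart by (auto simp: is_chart_def homeomorphism_def)

lemma chart_inv_in: "u \<in> im d \<Longrightarrow> chart_inv d u \<in> fst d"
  using chart_inv_snd by auto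

lemma chart_continuous: "continuous_on (fst d) (snd d)" "continuous_on (im d) (chart_inv d)"
  using is_chart by (auto simp: is_chart_def homeomorphism_def)

lemma chart_isCont: "h \<in> fst d \<Longrightarrow> isCont (snd d) h"
  using chart_continuous chart_open by (simp add: continuous_on_eq_continuous_at)

lemma chart_inv_isCont: "u \<in> im d \<Longrightarrow> isCont (chart_inv d) u"
  using chart_continuous(2) continuous_on_eq_continuous_at[OF chart_open(2)] by blast

end

lemma mult_smooth:
  assumes "c \<in> \<A>" "d \<in> \<A>" "f \<in> \<A>"
  defines "D \<equiv> {(u, v). u \<in> im c \<and> v \<in> im d \<and> chart_inv c u + chart_inv d v \<in> fst f}"
  shows "open D" "smooth_on (\<lambda>(u, v). snd f (chart_inv c u + chart_inv d v)) D"
proof -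
  have "continuous_on (im c \<times> im d) (\<lambda>p. chart_inv c (fst p) + chart_inv d (snd p))"
    by (intro continuous_on_add continuous_on_compose2[OF chart_continuous(2)[OF assms(1)] continuous_on_fst]
      continuous_on_compose2[OF chart_continuous(2)[OF assms(2)] continuous_on_snd]) auto
  then have "open ((im c \<times> im d) \<inter> (\<lambda>p. chart_inv c (fst p) + chart_inv d (snd p)) -` fst f)"
    by (intro continuous_open_preimage open_Times chart_open assms)
  moreover have "(im c \<times> im d) \<inter> (\<lambda>p. chart_inv c (fst p) + chart_inv d (snd p)) -` fst f = D"
    by (auto simp: D_def)
  ultimately show "open D" by simp
  show "smooth_on (\<lambda>(u, v). snd f (chart_inv c u + chart_inv d v)) D"
    using lie assms by (simp add: lie_group_def D_def)
qed

text \<open>Left translation by \<open>g\<close> is the multiplication with its first argument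
  frozen, read in some chart \<open>e\<close> around \<open>g\<close>.\<close>

lemma translation_differentiable:
  assumes "c \<in> \<A>" "d \<in> \<A>" "h \<in> fst c" "g + h \<in> fst d"
  shows "(\<lambda>u. snd d (g + chart_inv c u)) differentiable (at (snd c h))"
proof -
  obtain e where e: "e \<in> \<A>" "g \<in> fst e" by (rule chart_cover)
  let ?\<mu> = "\<lambda>(u, v). snd d (chart_inv e u + chart_inv c v)"
  have "Ck_on (Suc 0) ?\<mu> {(u, v). u \<in> im e \<and> v \<in> im c \<and> chart_inv e u + chart_inv c v \<in> fst d}"
    using mult_smooth(2)[OF e(1) assms(1,2)] unfolding smooth_on_def by blast
  then have "?\<mu> differentiable (at (snd e g, snd c h))"
    using assms e by (auto simp: chart_inv_snd)
  moreover have "(\<lambda>v. (snd e g, v)) differentiable (at (snd c h))"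
    by (intro derivative_intros)
  ultimately have "?\<mu> \<circ> (\<lambda>v. (snd e g, v)) differentiable (at (snd c h))"
    by (intro differentiable_chain_at)
  then show ?thesis using e by (simp add: o_def chart_inv_snd)
qed

lemma translation_has_derivative:
  assumes "c \<in> \<A>" "d \<in> \<A>" "h \<in> fst c" "g + h \<in> fst d"
  shows "((\<lambda>u. snd d (g + chart_inv c u)) has_derivative
    frechet_derivative (\<lambda>u. snd d (g + chart_inv c u)) (at (snd c h))) (at (snd c h))"
  using translation_differentiable[OF assms] by (simp add: frechet_derivative_works)

lemma dL_has_derivative:
  assumes "d \<in> \<A>" "g \<in> fst d"
  shows "((\<lambda>u. snd d (g + chart_inv c0 u)) has_derivative dL c0 g d) (at (snd c0 0))"
  using translation_has_derivative[OF c0 assms(1) e_c0, of g] assms(2) by (simp add: dL_def[abs_def])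

lemma dL_linear: "d \<in> \<A> \<Longrightarrow> g \<in> fst d \<Longrightarrow> bounded_linear (dL c0 g d)"
  using dL_has_derivative has_derivative_bounded_linear by blast

text \<open>Chain rule for the composition of the translations by \<open>g\<close> and by
  \<open>h\<close>. The intermediate chart \<open>c\<close> covers only a neighbourhood of
  \<open>h\<close>, so the coordinate expressions agree only near the base point, which is enough
  for derivatives.\<close>

lemma dL_translate:
  assumes "c \<in> \<A>" "d \<in> \<A>" "h \<in> fst c" "g + h \<in> fst d"
  shows "dL c0 (g + h) d X = frechet_derivative (\<lambda>u. snd d (g + chart_inv c u)) (at (snd c h)) (dL c0 h c X)"
proof -
  let ?D = "frechet_derivative (\<lambda>u. snd d (g + chart_inv c u)) (at (snd c h))"
  let ?f = "\<lambda>v. snd c (h + chart_inv c0 v)" and ?o = "snd c0 0"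
  have fo: "?f ?o = snd c h" by (simp add: chart_inv_snd[OF c0 e_c0])
  have "(?f has_derivative dL c0 h c) (at ?o)" by (rule dL_has_derivative[OF assms(1,3)])
  moreover have "((\<lambda>u. snd d (g + chart_inv c u)) has_derivative ?D) (at (?f ?o))"
    unfolding fo by (rule translation_has_derivative[OF assms])
  ultimately have "((\<lambda>v. snd d (g + chart_inv c (?f v))) has_derivative (\<lambda>X. ?D (dL c0 h c X))) (at ?o)"
    by (rule has_derivative_compose)
  moreover have "\<forall>\<^sub>F v in at ?o. snd d (g + chart_inv c (?f v)) = snd d (g + h + chart_inv c0 v)"
  proof -
    have "isCont (\<lambda>v. h + chart_inv c0 v) ?o"
      using chart_inv_isCont[OF c0] e_c0 by (intro continuous_intros) auto
    then have "\<forall>\<^sub>F v in at ?o. h + chart_inv c0 v \<in> fst c"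
      using chart_open(1)[OF assms(1)] assms(3)
      by (intro topological_tendstoD[OF isContD]) (auto simp: chart_inv_snd[OF c0 e_c0])
    then show ?thesis
      by eventually_elim (simp add: chart_inv_snd[OF assms(1)] add.assoc)
  qed
  ultimately have "((\<lambda>v. snd d (g + h + chart_inv c0 v)) has_derivative (\<lambda>X. ?D (dL c0 h c X))) (at ?o)"
    by (rule has_derivative_transform_eventually)
      (auto simp: chart_inv_snd[OF c0 e_c0] chart_inv_snd[OF assms(1,3)])
  then have "dL c0 (g + h) d = (\<lambda>X. ?D (dL c0 h c X))"
    using dL_has_derivative[OF assms(2,4)] has_derivative_unique by blast
  then show ?thesis by simp
qed

text \<open>With \<open>g = 0\<close> this says that the velocity may be tested in a single chart.\<close>

lemma left_velocity_translateI:
  assumes c: "c \<in> \<A>" "\<gamma> t \<in> fst c" and t: "t \<in> S" and cont: "continuous (at t within S) \<gamma>"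
    and der: "((\<lambda>s. snd c (\<gamma> s)) has_vector_derivative dL c0 (\<gamma> t) c X) (at t within S)"
  shows "left_velocity \<A> c0 (\<lambda>s. g + \<gamma> s) S t X"
  unfolding left_velocity_def
proof (intro conjI ballI impI)
  show "continuous (at t within S) (\<lambda>s. g + \<gamma> s)"
    using cont unfolding continuous_within by (intro tendsto_intros)
  fix d assume d: "d \<in> \<A>" "g + \<gamma> t \<in> fst d"
  let ?D = "frechet_derivative (\<lambda>u. snd d (g + chart_inv c u)) (at (snd c (\<gamma> t)))"
  have D: "((\<lambda>u. snd d (g + chart_inv c u)) has_derivative ?D) (at (snd c (\<gamma> t)))"
    by (rule translation_has_derivative) (use c d in auto)
  have "((\<lambda>s. snd d (g + chart_inv c (snd c (\<gamma> s)))) has_derivative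
      (\<lambda>x. ?D (x *\<^sub>R dL c0 (\<gamma> t) c X))) (at t within S)"
    using der D unfolding has_vector_derivative_def by (rule has_derivative_compose)
  moreover have "\<forall>\<^sub>F s in at t within S. snd d (g + chart_inv c (snd c (\<gamma> s))) = snd d (g + \<gamma> s)"
  proof -
    have "\<forall>\<^sub>F s in at t within S. \<gamma> s \<in> fst c"
      using cont chart_open(1)[OF c(1)] c(2) unfolding continuous_within by (rule topological_tendstoD)
    then show ?thesis by eventually_elim (simp add: chart_inv_snd[OF c(1)])
  qed
  ultimately have "((\<lambda>s. snd d (g + \<gamma> s)) has_derivative (\<lambda>x. ?D (x *\<^sub>R dL c0 (\<gamma> t) c X))) (at t within S)"
    by (rule has_derivative_transform_eventually) (use t c in \<open>auto simp: chart_inv_snd\<close>)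
  \<comment> \<open>Left invariance: \<open>dL_translate\<close> identifies the transported velocity
    with the field at the translated point.\<close>
  moreover have "?D (x *\<^sub>R dL c0 (\<gamma> t) c X) = x *\<^sub>R dL c0 (g + \<gamma> t) d X" for x
    using dL_translate[OF c(1) d(1) c(2) d(2)] has_derivative_bounded_linear[OF D]
    by (simp add: linear_simps)
  ultimately show "((\<lambda>s. snd d (g + \<gamma> s)) has_vector_derivative dL c0 (g + \<gamma> t) d X) (at t within S)"
    by (simp add: has_vector_derivative_def)
qed

lemma left_velocity_translate:
  assumes "left_velocity \<A> c0 \<gamma> S t X" "t \<in> S"
  shows "left_velocity \<A> c0 (\<lambda>s. g + \<gamma> s) S t X"
proof -
  obtain c where "c \<in> \<A>" "\<gamma> t \<in> fst c" by (rule chart_cover)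
  then show ?thesis
    using assms by (intro left_velocity_translateI) (auto simp: left_velocity_def)
qed

text \<open>Used with \<open>r = 1\<close> for time shifts of integral curves, and with
  \<open>b = 0\<close> to compare the flows of \<open>X\<close> and of its multiples.\<close>

lemma left_velocity_affine:
  assumes "left_velocity \<A> c0 \<gamma> UNIV (r * t + b) X"
  shows "left_velocity \<A> c0 (\<lambda>s. \<gamma> (r * s + b)) UNIV t (r *\<^sub>R X)"
  unfolding left_velocity_def
proof (intro conjI ballI impI)
  show "isCont (\<lambda>s. \<gamma> (r * s + b)) t"
    using assms unfolding left_velocity_def
    by (intro isCont_o2[where f = "\<lambda>s. r * s + b" and g = \<gamma>] continuous_intros) auto
  fix d assume d: "d \<in> \<A>" "\<gamma> (r * t + b) \<in> fst d"
  have "((\<lambda>s. snd d (\<gamma> s)) has_vector_derivative dL c0 (\<gamma> (r * t + b)) d X) (at (r * t + b))"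
    using assms d unfolding left_velocity_def by auto
  moreover have "((\<lambda>s. r * s + b) has_vector_derivative r) (at t)"
    by (auto intro!: derivative_eq_intros)
  ultimately have "((\<lambda>s. snd d (\<gamma> s)) \<circ> (\<lambda>s. r * s + b) has_vector_derivative
      r *\<^sub>R dL c0 (\<gamma> (r * t + b)) d X) (at t)"
    by (rule vector_diff_chain_at[rotated])
  then show "((\<lambda>s. snd d (\<gamma> (r * s + b))) has_vector_derivative dL c0 (\<gamma> (r * t + b)) d (r *\<^sub>R X)) (at t)"
    using dL_linear[OF d] by (simp add: o_def linear_simps)
qed

text \<open>The counterpart of \<open>left_field\<close> in an arbitrary chart \<open>d\<close>: the
  right-hand side of the differential equation that integral curves satisfy in the coordinates
  \<open>d\<close>.\<close>

definition vf :: "('g, 'e) chart \<Rightarrow> 'e \<Rightarrow> 'e \<Rightarrow> 'e" where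
  "vf d X u = dL c0 (chart_inv d u) d X"

text \<open>The field is the partial derivative of the multiplication in its second variable, at the
  identity and in direction \<open>X\<close>. Two orders of smoothness of the multiplication
  therefore make the field continuously differentiable.\<close>

lemma vf_locally_Lipschitz:
  assumes d: "d \<in> \<A>" and u0: "u0 \<in> im d"
  obtains r \<Lambda> where "r > 0" "\<Lambda> \<ge> 0" "cball u0 r \<subseteq> im d"
    "\<And>u v. u \<in> cball u0 r \<Longrightarrow> v \<in> cball u0 r \<Longrightarrow> norm (vf d X u - vf d X v) \<le> \<Lambda> * norm (u - v)"
proof -
  let ?o = "snd c0 0"
  define \<mu> where "\<mu> = (\<lambda>(u, v). snd d (chart_inv d u + chart_inv c0 v))"
  define D where "D = {(u, v). u \<in> im d \<and> v \<in> im c0 \<and> chart_inv d u + chart_inv c0 v \<in> fst d}"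
  have "Ck_on (Suc (Suc 0)) \<mu> D"
    using mult_smooth(2)[OF d c0 d] unfolding smooth_on_def \<mu>_def D_def by blast
  define W where "W p = frechet_derivative \<mu> (at p) (0, X)" for p
  have W1: "Ck_on (Suc 0) W D"
    using \<open>Ck_on (Suc (Suc 0)) \<mu> D\<close> Ck_on.simps(2)[of "Suc 0" \<mu> D] unfolding W_def[abs_def] by blast
  have \<mu>: "(\<mu> has_derivative frechet_derivative \<mu> (at p)) (at p)" if "p \<in> D" for p
    using \<open>Ck_on (Suc (Suc 0)) \<mu> D\<close> that by (simp add: frechet_derivative_works)
  have W: "(W has_derivative frechet_derivative W (at p)) (at p)" if "p \<in> D" for p
    using W1 that by (simp add: frechet_derivative_works)
  have Wc: "continuous_on D (\<lambda>p. frechet_derivative W (at p) q)" for q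
    using W1 by (simp only: Ck_on.simps)
  have D: "(u, ?o) \<in> D" if "u \<in> im d" for u
    using that e_c0 by (auto simp: D_def chart_inv_snd[OF c0 e_c0] chart_inv_snd[OF d])
  have vf: "vf d X u = W (u, ?o)" if u: "u \<in> im d" for u
  proof -
    have "((\<lambda>v. (u, v)) has_derivative (\<lambda>w. (0, w))) (at ?o)"
      by (auto intro!: derivative_eq_intros)
    from has_derivative_compose[OF this \<mu>[OF D[OF u]]]
    have "((\<lambda>v. snd d (chart_inv d u + chart_inv c0 v)) has_derivative
        (\<lambda>w. frechet_derivative \<mu> (at (u, ?o)) (0, w))) (at ?o)"
      by (simp add: \<mu>_def)
    then have "dL c0 (chart_inv d u) d = (\<lambda>w. frechet_derivative \<mu> (at (u, ?o)) (0, w))"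
      using dL_has_derivative[OF d chart_inv_in[OF d u]] has_derivative_unique by blast
    then show ?thesis by (simp add: vf_def W_def)
  qed
  have der: "(vf d X has_derivative (\<lambda>w. frechet_derivative W (at (u, ?o)) (w, 0))) (at u)"
    if u: "u \<in> im d" for u
  proof -
    have "((\<lambda>u. (u, ?o)) has_derivative (\<lambda>w. (w, 0))) (at u)"
      by (auto intro!: derivative_eq_intros)
    from has_derivative_compose[OF this W[OF D[OF u]]]
    show ?thesis
      by (rule has_derivative_transform_within_open[OF _ chart_open(2)[OF d] u]) (simp add: vf)
  qed
  have fd: "frechet_derivative (vf d X) (at u) = (\<lambda>w. frechet_derivative W (at (u, ?o)) (w, 0))"
    if "u \<in> im d" for u
    using frechet_derivative_at[OF der[OF that]] by simp
  show ?thesis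
  proof (rule C1_imp_locally_Lipschitz[OF finite_dim_model chart_open(2)[OF d] u0, where f = "vf d X"])
    show "vf d X differentiable (at u)" if "u \<in> im d" for u
      using der[OF that] unfolding differentiable_def by blast
    fix w
    have "continuous_on (im d) (\<lambda>u. frechet_derivative W (at (u, ?o)) (w, 0))"
      by (rule continuous_on_compose2[OF Wc]) (auto intro!: continuous_intros D)
    then show "continuous_on (im d) (\<lambda>u. frechet_derivative (vf d X) (at u) w)"
      by (rule continuous_on_eq) (simp add: fd)
  qed (rule that)
qed

lemma vf_add_scale:
  assumes "d \<in> \<A>" "u \<in> im d" "finite J"
  shows "vf d (\<Sum>j\<in>J. a j *\<^sub>R X j) u = (\<Sum>j\<in>J. a j *\<^sub>R vf d (X j) u)"
  using dL_linear[OF assms(1) chart_inv_in[OF assms(1,2)]] assms(3)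
  unfolding vf_def by (simp add: linear_sum bounded_linear.linear linear_cmul)

lemma left_velocity_chart:
  assumes "left_velocity \<A> c0 \<gamma> S t X" "d \<in> \<A>" "\<gamma> t \<in> fst d"
  shows "((\<lambda>s. snd d (\<gamma> s)) has_vector_derivative vf d X (snd d (\<gamma> t))) (at t within S)"
  using assms unfolding left_velocity_def vf_def by (simp add: chart_inv_snd)

text \<open>Connectedness of the interval: the times of disagreement form an open set because the
  group is Hausdorff, and the times of agreement do so by local uniqueness in a chart around the
  common point.\<close>

lemma left_velocity_unique:
  assumes v1: "\<And>t. t \<in> {a<..<b} \<Longrightarrow> left_velocity \<A> c0 \<gamma>1 UNIV t X"
    and v2: "\<And>t. t \<in> {a<..<b} \<Longrightarrow> left_velocity \<A> c0 \<gamma>2 UNIV t X"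
    and t0: "t0 \<in> {a<..<b}" "\<gamma>1 t0 = \<gamma>2 t0" and t: "t \<in> {a<..<b}"
  shows "\<gamma>1 t = \<gamma>2 t"
proof (rule ccontr)
  assume ne: "\<gamma>1 t \<noteq> \<gamma>2 t"
  let ?E = "{t \<in> {a<..<b}. \<gamma>1 t = \<gamma>2 t}" and ?N = "{t \<in> {a<..<b}. \<gamma>1 t \<noteq> \<gamma>2 t}"
  have c1: "(\<gamma>1 \<longlongrightarrow> \<gamma>1 t) (nhds t)" and c2: "(\<gamma>2 \<longlongrightarrow> \<gamma>2 t) (nhds t)" if "t \<in> {a<..<b}" for t
    using v1[OF that] v2[OF that] unfolding left_velocity_def
    by (auto simp: isCont_def tendsto_at_iff_tendsto_nhds)
  have I: "\<forall>\<^sub>F s in nhds t. s \<in> {a<..<b}" if "t \<in> {a<..<b}" for t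
    by (rule eventually_nhds_in_open) (use that in auto)
  have "open ?N"
  proof (subst open_subopen, intro ballI)
    fix t assume t: "t \<in> ?N"
    then obtain U V where UV: "open U" "open V" "\<gamma>1 t \<in> U" "\<gamma>2 t \<in> V" "U \<inter> V = {}"
      using hausdorff[of "\<gamma>1 t" "\<gamma>2 t"] by blast
    have tI: "t \<in> {a<..<b}" using t by simp
    have "\<forall>\<^sub>F s in nhds t. s \<in> ?N"
      using topological_tendstoD[OF c1[OF tI] UV(1,3)] topological_tendstoD[OF c2[OF tI] UV(2,4)] I[OF tI]
      by eventually_elim (use UV(5) in auto)
    then show "\<exists>T. open T \<and> t \<in> T \<and> T \<subseteq> ?N" unfolding eventually_nhds by blast
  qed
  moreover have "open ?E"
  proof (subst open_subopen, intro ballI)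
    fix t assume t: "t \<in> ?E"
    obtain d where d: "d \<in> \<A>" "\<gamma>1 t \<in> fst d" by (rule chart_cover)
    obtain r \<Lambda> where r: "r > 0" and L: "\<And>u v. u \<in> cball (snd d (\<gamma>1 t)) r \<Longrightarrow> v \<in> cball (snd d (\<gamma>1 t)) r \<Longrightarrow>
        norm (vf d X u - vf d X v) \<le> \<Lambda> * norm (u - v)"
      using vf_locally_Lipschitz[OF d(1) imageI[OF d(2)], of X] by metis
    have tI: "t \<in> {a<..<b}" and "\<gamma>2 t \<in> fst d" using t d(2) by auto
    then have "\<forall>\<^sub>F s in nhds t. \<gamma>1 s \<in> fst d \<and> \<gamma>2 s \<in> fst d \<and> s \<in> {a<..<b}"
      using topological_tendstoD[OF c1 chart_open(1)[OF d(1)]] topological_tendstoD[OF c2 chart_open(1)[OF d(1)]]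
        I[OF tI] d(2) by (simp only: eventually_conj_iff)
    then obtain \<delta> where \<delta>: "\<delta> > 0"
      "\<And>s. \<bar>s - t\<bar> < \<delta> \<Longrightarrow> \<gamma>1 s \<in> fst d \<and> \<gamma>2 s \<in> fst d \<and> s \<in> {a<..<b}"
      unfolding eventually_nhds_metric dist_real_def by blast
    obtain \<epsilon> where \<epsilon>: "\<epsilon> > 0" "\<And>s. \<bar>s - t\<bar> < \<epsilon> \<Longrightarrow> snd d (\<gamma>1 s) = snd d (\<gamma>2 s)"
    proof (rule ode_locally_unique[OF r L \<delta>(1), where ?u1.0 = "\<lambda>s. snd d (\<gamma>1 s)" and ?u2.0 = "\<lambda>s. snd d (\<gamma>2 s)" and ?t0.0 = t])
      show "((\<lambda>s. snd d (\<gamma>1 s)) has_vector_derivative vf d X (snd d (\<gamma>1 s))) (at s)" if "\<bar>s - t\<bar> < \<delta>" for s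
        using \<delta>(2)[OF that] by (intro left_velocity_chart v1 d) auto
      show "((\<lambda>s. snd d (\<gamma>2 s)) has_vector_derivative vf d X (snd d (\<gamma>2 s))) (at s)" if "\<bar>s - t\<bar> < \<delta>" for s
        using \<delta>(2)[OF that] by (intro left_velocity_chart v2 d) auto
    qed (use t in auto)
    have "s \<in> ?E" if "\<bar>s - t\<bar> < min \<epsilon> \<delta>" for s
      using \<epsilon>(2)[of s] \<delta>(2)[of s] that chart_inv_snd[OF d(1)] by (metis (mono_tags, lifting) mem_Collect_eq min_less_iff_conj)
    then have "ball t (min \<epsilon> \<delta>) \<subseteq> ?E" by (auto simp: dist_real_def abs_minus_commute)
    then show "\<exists>T. open T \<and> t \<in> T \<and> T \<subseteq> ?E"
      using \<epsilon>(1) \<delta>(1) by (intro exI[of _ "ball t (min \<epsilon> \<delta>)"]) auto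
  qed
  ultimately have "?E \<inter> {a<..<b} = {} \<or> ?N \<inter> {a<..<b} = {}"
    by (intro connectedD[OF connected_Ioo]) auto
  then show False using t0 t ne by blast
qed

section \<open>Completeness of left-invariant fields and one-parameter subgroups\<close>

lemma integral_curve_near_0:
  obtains \<epsilon> \<gamma> where "\<epsilon> > 0" "\<gamma> 0 = 0" "\<And>t. \<bar>t\<bar> < \<epsilon> \<Longrightarrow> left_velocity \<A> c0 \<gamma> UNIV t X"
proof -
  let ?o = "snd c0 0"
  obtain r \<Lambda> where r: "r > 0" "cball ?o r \<subseteq> im c0"
    and L: "\<And>u v. u \<in> cball ?o r \<Longrightarrow> v \<in> cball ?o r \<Longrightarrow> norm (vf c0 X u - vf c0 X v) \<le> \<Lambda> * norm (u - v)"
    using vf_locally_Lipschitz[OF c0 imageI[OF e_c0], of X] by metis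
  obtain \<epsilon> u where u: "\<epsilon> > 0" "u 0 = ?o"
    "\<And>t. \<bar>t\<bar> < \<epsilon> \<Longrightarrow> u t \<in> cball ?o r \<and> (u has_vector_derivative vf c0 X (u t)) (at t)"
    using picard_lindelof[OF r(1) L] by metis
  have "left_velocity \<A> c0 (\<lambda>t. chart_inv c0 (u t)) UNIV t X" if t: "\<bar>t\<bar> < \<epsilon>" for t
  proof -
    have ut: "u t \<in> im c0" if "\<bar>t\<bar> < \<epsilon>" for t using u(3)[OF that] r(2) by blast
    \<comment> \<open>The neutral summand gives the claim the form of
      \<open>left_velocity_translateI\<close>, by which testing in \<open>c0\<close> is
      enough.\<close>
    have "left_velocity \<A> c0 (\<lambda>t. 0 + chart_inv c0 (u t)) UNIV t X"
    proof (rule left_velocity_translateI[OF c0])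
      show "chart_inv c0 (u t) \<in> fst c0" by (rule chart_inv_in[OF c0 ut[OF t]])
      show "isCont (\<lambda>t. chart_inv c0 (u t)) t"
        using has_vector_derivative_continuous[OF conjunct2[OF u(3)[OF t]]] chart_inv_isCont[OF c0 ut[OF t]]
        by (rule isCont_o2)
      have "(u has_vector_derivative dL c0 (chart_inv c0 (u t)) c0 X) (at t)"
        using u(3)[OF t] by (simp add: vf_def)
      then show "((\<lambda>t. snd c0 (chart_inv c0 (u t))) has_vector_derivative dL c0 (chart_inv c0 (u t)) c0 X) (at t)"
        by (rule has_vector_derivative_transform_within_open[where S = "{- \<epsilon><..<\<epsilon>}"])
          (use t in \<open>auto simp: snd_chart_inv[OF c0 ut]\<close>)
    qed simp
    then show ?thesis by simp
  qed
  then show ?thesis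
    using that[of \<epsilon> "\<lambda>t. chart_inv c0 (u t)"] u(1,2) by (simp add: chart_inv_snd[OF c0 e_c0])
qed

text \<open>A local integral curve through the identity extends to all times by left translation: if
  \<open>h\<close> is its value at time \<open>a\<close>, the curve near \<open>k * a\<close> is the
  local one translated by the \<open>k\<close>-th power of \<open>h\<close>.\<close>

lemma integral_curve_exists:
  "\<exists>\<gamma>. \<gamma> 0 = 0 \<and> (\<forall>t. left_velocity \<A> c0 \<gamma> UNIV t X)"
proof -
  obtain \<epsilon> \<gamma>0 where \<epsilon>: "\<epsilon> > 0" and \<gamma>0: "\<gamma>0 0 = 0" "\<And>t. \<bar>t\<bar> < \<epsilon> \<Longrightarrow> left_velocity \<A> c0 \<gamma>0 UNIV t X"
    using integral_curve_near_0[of X] by blast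
  \<comment> \<open>With half the lifetime, \<open>\<gamma>0 (s + a)\<close> and
    \<open>h + \<gamma>0 s\<close> are both integral curves for |s| < a, so adjacent translates can
    be compared there.\<close>
  define a where "a = \<epsilon> / 2"
  have a: "a > 0" using \<epsilon> by (simp add: a_def)
  define h where "h = \<gamma>0 a"
  have shift: "left_velocity \<A> c0 (\<lambda>t. \<gamma>0 (t + b)) UNIV s X" if "\<bar>s + b\<bar> < \<epsilon>" for s b
    using left_velocity_affine[of \<gamma>0 1 s b X] \<gamma>0(2)[OF that] by simp
  have hom: "\<gamma>0 (s + a) = h + \<gamma>0 s" if s: "\<bar>s\<bar> < a" for s
  proof (rule left_velocity_unique[where a = "- a" and b = a and ?t0.0 = 0 and X = X])
    show "left_velocity \<A> c0 (\<lambda>s. \<gamma>0 (s + a)) UNIV t X" if "t \<in> {- a<..<a}" for t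
      using that by (intro shift) (auto simp: a_def)
    show "left_velocity \<A> c0 (\<lambda>s. h + \<gamma>0 s) UNIV t X" if "t \<in> {- a<..<a}" for t
      using that a by (intro left_velocity_translate \<gamma>0) (auto simp: a_def)
  qed (use a s \<gamma>0(1) in \<open>auto simp: h_def\<close>)
  \<comment> \<open>\<open>Q n\<close> is the \<open>n\<close>-th power of \<open>h\<close>, and
    \<open>P\<close> extends this to integer exponents. The group need not commute; \<open>Q\<close>
    and \<open>Q'\<close> record that a further \<open>h\<close> may be added on either
    side.\<close>
  define Q where "Q n = ((\<lambda>x. x + h) ^^ n) 0" for n
  have Q: "Q (Suc n) = Q n + h" for n by (simp add: Q_def)
  have Q': "Q (Suc n) = h + Q n" for n
    by (induction n) (simp_all add: Q add.assoc, simp_all add: Q_def)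
  define P where "P k = (if k \<ge> 0 then Q (nat k) else - Q (nat (- k)))" for k :: int
  have P: "P (k + 1) = P k + h" for k
  proof (cases "k \<ge> 0")
    case True
    then have "nat (k + 1) = Suc (nat k)" by simp
    then show ?thesis using True by (simp add: P_def Q)
  next
    case False
    then have "nat (- k) = Suc (nat (- (k + 1)))" by simp
    then have "P k + h = - Q (nat (- (k + 1)))" using False by (simp add: P_def Q' minus_add add.assoc del: minus_add_distrib)
    moreover have "P (k + 1) = - Q (nat (- (k + 1)))"
      using False by (cases "k = - 1") (auto simp: P_def Q_def)
    ultimately show ?thesis by simp
  qed
  define \<gamma> where "\<gamma> t = P \<lfloor>t / a\<rfloor> + \<gamma>0 (t - of_int \<lfloor>t / a\<rfloor> * a)" for t
  \<comment> \<open>The formula holds on both sides of each grid point, so the grid points are not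
    exceptional for differentiability.\<close>
  have \<gamma>: "\<gamma> t = P k + \<gamma>0 (t - of_int k * a)" if t: "\<bar>t - of_int k * a\<bar> < a" for t k
  proof -
    have "of_int k - 1 < t / a" "t / a < of_int k + 1"
      using t a by (auto simp: field_simps abs_less_iff)
    then have "\<lfloor>t / a\<rfloor> = k \<or> \<lfloor>t / a\<rfloor> = k - 1" by linarith
    then show ?thesis
    proof
      assume fl: "\<lfloor>t / a\<rfloor> = k - 1"
      have "\<gamma> t = P (k - 1) + \<gamma>0 ((t - of_int k * a) + a)"
        by (simp add: \<gamma>_def fl algebra_simps)
      also have "\<dots> = P (k - 1) + h + \<gamma>0 (t - of_int k * a)" by (simp add: hom[OF t] add.assoc)
      also have "P (k - 1) + h = P k" using P[of "k - 1"] by simp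
      finally show ?thesis .
    qed (simp add: \<gamma>_def)
  qed
  have "left_velocity \<A> c0 \<gamma> UNIV t X" for t
  proof -
    define k where "k = \<lfloor>t / a\<rfloor>"
    have "of_int k \<le> t / a" "t / a < of_int k + 1" unfolding k_def by linarith+
    then have t: "\<bar>t - of_int k * a\<bar> < a" using a by (auto simp: field_simps abs_less_iff)
    have "left_velocity \<A> c0 (\<lambda>t. P k + \<gamma>0 (t + (- of_int k * a))) UNIV t X"
      using t a by (intro left_velocity_translate shift) (auto simp: a_def)
    then show ?thesis
    proof (rule left_velocity_cong)
      show "open {of_int k * a - a <..< of_int k * a + a}" by simp
      show "P k + \<gamma>0 (s + (- of_int k * a)) = \<gamma> s" if "s \<in> {of_int k * a - a <..< of_int k * a + a}" for s
        using \<gamma>[of s k] that by (simp add: abs_less_iff)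
    qed (use t in \<open>auto simp: abs_less_iff\<close>)
  qed
  moreover have "\<gamma> 0 = 0" using \<gamma>[of 0 0] a by (simp add: \<gamma>0 P_def Q_def)
  ultimately show ?thesis by blast
qed

text \<open>The curve inside the definition of \<open>lie_exp\<close>, kept at all times; by
  \<open>lie_exp_scaleR\<close> its value at \<open>t\<close> is exp(tX).\<close>

definition flow :: "'e \<Rightarrow> real \<Rightarrow> 'g" where
  "flow X = (THE \<gamma>. \<gamma> 0 = 0 \<and> (\<forall>t. left_velocity \<A> c0 \<gamma> UNIV t X))"

lemma left_velocity_unique_UNIV:
  assumes "\<And>t. left_velocity \<A> c0 \<gamma>1 UNIV t X" "\<And>t. left_velocity \<A> c0 \<gamma>2 UNIV t X" "\<gamma>1 0 = \<gamma>2 0"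
  shows "\<gamma>1 = \<gamma>2"
proof
  fix t
  show "\<gamma>1 t = \<gamma>2 t"
    by (rule left_velocity_unique[of "- \<bar>t\<bar> - 1" "\<bar>t\<bar> + 1" _ X _ 0]) (use assms in auto)
qed

lemma flow_unique:
  assumes "\<gamma> 0 = 0" "\<And>t. left_velocity \<A> c0 \<gamma> UNIV t X"
  shows "flow X = \<gamma>"
  unfolding flow_def
  by (rule the_equality) (use assms in \<open>auto intro: left_velocity_unique_UNIV\<close>)

lemma flow: "flow X 0 = 0" "left_velocity \<A> c0 (flow X) UNIV t X"
  using integral_curve_exists[of X] flow_unique by metis+

text \<open>As functions of \<open>t\<close>, both sides are integral curves that start at
  \<open>flow X s\<close>.\<close>

lemma flow_add: "flow X (s + t) = flow X s + flow X t"
proof -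
  have "(\<lambda>t. flow X (t + s)) = (\<lambda>t. flow X s + flow X t)"
    by (rule left_velocity_unique_UNIV[where X = X])
      (use left_velocity_affine[of "flow X" 1 _ s X] in \<open>auto intro: left_velocity_translate flow simp: flow\<close>)
  from fun_cong[OF this, of t] show ?thesis by (simp add: add.commute)
qed

lemma flow_continuous: "isCont (flow X) t"
  using flow(2) by (simp add: left_velocity_def)

lemma lie_exp_scaleR: "lie_exp \<A> c0 (t *\<^sub>R X) = flow X t"
proof -
  have "flow (t *\<^sub>R X) = (\<lambda>s. flow X (t * s))"
  proof (rule flow_unique)
    show "left_velocity \<A> c0 (\<lambda>s. flow X (t * s)) UNIV s (t *\<^sub>R X)" for s
      using left_velocity_affine[of "flow X" t s 0 X, OF flow(2)] by simp
  qed (simp add: flow(1))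
  then show ?thesis by (simp add: lie_exp_def flow_def[symmetric])
qed

end

section \<open>Hilbert spaces: the Riesz representation theorem and adjoints\<close>

lemma cinner_add_left: "cinner (x + y) z = cinner x z + cinner y z"
  by (metis cinner_add_right cinner_commute complex_cnj_add)

lemma cinner_scaleC_left: "cinner (a *\<^sub>C x) y = cnj a * cinner x y"
  by (metis cinner_commute cinner_scaleC_right complex_cnj_mult)

lemma cinner_scaleR_right: "cinner x (r *\<^sub>R y) = complex_of_real r * cinner x y"
  by (simp add: scaleR_scaleC cinner_scaleC_right)

lemma cinner_scaleR_left: "cinner (r *\<^sub>R x) y = complex_of_real r * cinner x y"
  by (simp add: scaleR_scaleC cinner_scaleC_left)

lemma cinner_zero_right: "cinner x 0 = 0"
  using cinner_scaleR_right[of x 0 0] by simp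

lemma cinner_minus_right: "cinner x (- y) = - cinner x y"
  using cinner_scaleR_right[of x "- 1" y] by simp

lemma cinner_diff_right: "cinner x (y - z) = cinner x y - cinner x z"
  using cinner_add_right[of x y "- z"] by (simp add: cinner_minus_right)

lemma cinner_diff_left: "cinner (x - y) z = cinner x z - cinner y z"
  by (metis cinner_diff_right cinner_commute complex_cnj_diff)

lemma Re_cinner_commute: "Re (cinner x y) = Re (cinner y x)"
  by (metis cinner_commute complex_cnj(1) complex.sel(1) cnj.sel(1))

lemma Re_cinner_self: "Re (cinner x x) = (norm x)\<^sup>2"
  by (simp only: cinner_self Re_complex_of_real)

lemma norm_add_squared: "(norm (x + y))\<^sup>2 = (norm x)\<^sup>2 + 2 * Re (cinner x y) + (norm y)\<^sup>2"
proof -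
  have "(norm (x + y))\<^sup>2 = Re (cinner (x + y) (x + y))" by (simp only: Re_cinner_self)
  also have "\<dots> = (norm x)\<^sup>2 + Re (cinner x y) + Re (cinner y x) + (norm y)\<^sup>2"
    by (simp add: cinner_add_left cinner_add_right Re_cinner_self)
  finally show ?thesis by (simp add: Re_cinner_commute[of y x])
qed

lemma norm_diff_squared: "(norm (x - y))\<^sup>2 = (norm x)\<^sup>2 - 2 * Re (cinner x y) + (norm y)\<^sup>2"
  using norm_add_squared[of x "- y"] by (simp add: cinner_minus_right)

lemma norm_scaleC: "norm (a *\<^sub>C x) = cmod a * norm x"
proof -
  have "complex_of_real ((norm (a *\<^sub>C x))\<^sup>2) = a * cnj a * cinner x x"
    by (simp only: cinner_self[symmetric]) (simp add: cinner_scaleC_left cinner_scaleC_right)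
  also have "\<dots> = complex_of_real ((cmod a * norm x)\<^sup>2)"
    by (simp add: complex_norm_square[symmetric] cinner_self power_mult_distrib)
  finally have "(norm (a *\<^sub>C x))\<^sup>2 = (cmod a * norm x)\<^sup>2" using of_real_eq_iff by blast
  then show ?thesis by (simp add: power2_eq_iff_nonneg)
qed

lemma Re_cinner_le: "Re (cinner x y) \<le> norm x * norm y"
proof (cases "norm x = 0 \<or> norm y = 0")
  case True
  then have "x = 0 \<or> y = 0" by simp
  then show ?thesis
    using cinner_zero_right[of x] Re_cinner_commute[of x y] cinner_zero_right[of y] by auto
next
  case False
  let ?a = "norm x" and ?b = "norm y"
  \<comment> \<open>Expanding this square gives the inequality up to the factor
    \<open>2 * (?a * ?b)\<close>; vanishing norms were split off to make it positive.\<close>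
  have "0 \<le> (norm (?b *\<^sub>R x - ?a *\<^sub>R y))\<^sup>2" by simp
  also have "\<dots> = 2 * (?a * ?b) * (?a * ?b - Re (cinner x y))"
    unfolding norm_diff_squared
    by (simp add: cinner_scaleR_left cinner_scaleR_right power2_eq_square algebra_simps)
  finally have "2 * (?a * ?b) * 0 \<le> 2 * (?a * ?b) * (?a * ?b - Re (cinner x y))" by simp
  moreover have "0 < 2 * (?a * ?b)" using False by simp
  ultimately have "0 \<le> ?a * ?b - Re (cinner x y)" by (rule mult_left_le_imp_le)
  then show ?thesis by simp
qed

lemma cmod_cinner_le: "cmod (cinner x y) \<le> norm x * norm y"
proof (cases "cinner x y = 0")
  case False
  \<comment> \<open>A phase that rotates the inner product onto its modulus and so reduces the claim
    to real parts.\<close>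
  define a where "a = cnj (cinner x y) / complex_of_real (cmod (cinner x y))"
  have a: "cmod a = 1" using False by (simp add: a_def norm_divide)
  have "a * cinner x y = (complex_of_real (cmod (cinner x y)))\<^sup>2 / complex_of_real (cmod (cinner x y))"
    using complex_norm_square[of "cinner x y"] by (simp add: a_def mult.commute)
  also have "\<dots> = complex_of_real (cmod (cinner x y))" using False by (simp add: power2_eq_square)
  finally have "a * cinner x y = complex_of_real (cmod (cinner x y))" .
  then have "cmod (cinner x y) = Re (cinner x (a *\<^sub>C y))" by (simp add: cinner_scaleC_right)
  also have "\<dots> \<le> norm x * norm (a *\<^sub>C y)" by (rule Re_cinner_le)
  finally show ?thesis by (simp add: norm_scaleC a)
qed simp

lemma cinner_eqI: "(\<And>y. cinner x y = cinner z y) \<Longrightarrow> x = z"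
proof -
  assume "\<And>y. cinner x y = cinner z y"
  then have "cinner (x - z) (x - z) = 0" by (simp add: cinner_diff_left)
  then show "x = z" by (simp add: cinner_self)
qed

text \<open>The representing vector minimises \<open>\<parallel>x\<parallel>\<^sup>2 - 2 Re f(x)\<close>; minimising sequences are Cauchy by the
  parallelogram law.\<close>

theorem riesz_representation:
  fixes f :: "'k::complex_hilbert_space \<Rightarrow> complex"
  assumes add: "\<And>x y. f (x + y) = f x + f y" and scale: "\<And>a x. f (a *\<^sub>C x) = a * f x"
    and bound: "\<And>x. cmod (f x) \<le> K * norm x"
  shows "\<exists>z. \<forall>x. f x = cinner z x"
proof -
  have fR: "f (r *\<^sub>R x) = complex_of_real r * f x" for r x by (simp add: scaleR_scaleC scale)
  define J where "J x = (norm x)\<^sup>2 - 2 * Re (f x)" for x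
  \<comment> \<open>Completing the square in \<open>norm x\<close> bounds \<open>J\<close> from
    below.\<close>
  have Jlow: "- (K\<^sup>2) \<le> J x" for x
  proof -
    have "Re (f x) \<le> K * norm x" using bound[of x] complex_Re_le_cmod[of "f x"] by linarith
    moreover have "0 \<le> (norm x - K)\<^sup>2" by simp
    ultimately show ?thesis by (simp add: J_def power2_eq_square algebra_simps)
  qed
  have bdd: "bdd_below (range J)" using Jlow by (intro bdd_belowI2)
  define I where "I = (INF x. J x)"
  have IJ: "I \<le> J x" for x unfolding I_def by (rule cINF_lower[OF bdd]) simp
  have "\<exists>x. J x < I + 1 / real (Suc n)" for n
    using cInf_lessD[of "range J" "I + 1 / real (Suc n)"] unfolding I_def by auto
  then obtain x where x: "\<And>n. J (x n) < I + 1 / real (Suc n)" by metis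
  \<comment> \<open>Parallelogram law, with \<open>J \<ge> I\<close> at the midpoint of
    \<open>y\<close> and \<open>z\<close>.\<close>
  have par: "(norm (y - z))\<^sup>2 \<le> 2 * (J y - I) + 2 * (J z - I)" for y z
  proof -
    have "2 * J y + 2 * J z - 4 * J ((1/2) *\<^sub>R (y + z)) = (norm (y - z))\<^sup>2"
      unfolding J_def norm_diff_squared norm_scaleR power_mult_distrib norm_add_squared
      by (simp add: fR add power2_eq_square algebra_simps)
    with IJ[of "(1/2) *\<^sub>R (y + z)"] show ?thesis by (simp add: algebra_simps)
  qed
  have arith: "p < d" if "p \<le> 2 * (a - i) + 2 * (b - i)" "a < i + d / 4" "b < i + d / 4" for p a b i d :: real
    using that by simp
  have "Cauchy x"
  proof (rule metric_CauchyI)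
    fix e :: real assume e: "e > 0"
    obtain M where M: "4 / e\<^sup>2 < real M" using reals_Archimedean2 by blast
    have "dist (x m) (x n) < e" if mn: "m \<ge> M" "n \<ge> M" for m n
    proof -
      have "J (x k) < I + e\<^sup>2 / 4" if "k \<ge> M" for k
      proof -
        have "4 / e\<^sup>2 < real (Suc k)" using M that by linarith
        then have "1 / real (Suc k) < e\<^sup>2 / 4" using e by (simp add: field_simps)
        with x[of k] show ?thesis by linarith
      qed
      from this[OF mn(1)] this[OF mn(2)]
      have "(norm (x m - x n))\<^sup>2 < e\<^sup>2"
        using par[of "x m" "x n"] arith[of _ "J (x m)" I "J (x n)" "e\<^sup>2"] by blast
      then show ?thesis using e by (simp add: dist_norm power_less_imp_less_base)
    qed
    then show "\<exists>M. \<forall>m\<ge>M. \<forall>n\<ge>M. dist (x m) (x n) < e" by blast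
  qed
  then obtain z where z: "x \<longlonglongrightarrow> z" using Cauchy_convergent convergent_def by blast
  have bl: "bounded_linear f"
    by (rule bounded_linear_intro[where K = K])
      (use bound add fR in \<open>auto simp: scaleR_conv_of_real mult.commute\<close>)
  have "(\<lambda>n. J (x n)) \<longlonglongrightarrow> J z"
    unfolding J_def by (intro tendsto_intros z bounded_linear.tendsto[OF bl])
  moreover have "(\<lambda>n. I + 1 / real (Suc n)) \<longlonglongrightarrow> I + 0"
    by (intro tendsto_add tendsto_const) (rule LIMSEQ_Suc[OF lim_1_over_n])
  ultimately have "J z \<le> I + 0" using x by (intro LIMSEQ_le) (auto intro: less_imp_le)
  then have min: "J z \<le> J y" for y using IJ[of y] by simp
  have Re: "Re (f y) = Re (cinner z y)" for y
  proof (rule ccontr)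
    define c where "c = Re (cinner z y) - Re (f y)"
    assume "Re (f y) \<noteq> Re (cinner z y)"
    then have c: "c \<noteq> 0" by (simp add: c_def)
    \<comment> \<open>First variation at the minimiser \<open>z\<close> in direction
      \<open>y\<close>. The value of \<open>t\<close> inserted next has denominator
      \<open>1 + (norm y)\<^sup>2\<close>, so that \<open>y = 0\<close> needs no separate
      case.\<close>
    have "0 \<le> t * (2 * c + t * (norm y)\<^sup>2)" for t
      using min[of "z + t *\<^sub>R y"] unfolding J_def norm_add_squared
      by (simp add: add fR cinner_scaleR_right c_def power_mult_distrib power2_eq_square algebra_simps)
    from this[of "- c / (1 + (norm y)\<^sup>2)"]
    have "0 \<le> - (c / (1 + (norm y)\<^sup>2)) * (2 * c - c * ((norm y)\<^sup>2 / (1 + (norm y)\<^sup>2)))" by simp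
    also have "\<dots> = - (c\<^sup>2 / (1 + (norm y)\<^sup>2)) * (2 - (norm y)\<^sup>2 / (1 + (norm y)\<^sup>2))"
      by (simp add: power2_eq_square algebra_simps)
    also have "\<dots> < 0"
    proof (rule mult_neg_pos)
      have p: "0 < 1 + (norm y)\<^sup>2" by (simp add: add_pos_nonneg)
      show "- (c\<^sup>2 / (1 + (norm y)\<^sup>2)) < 0" using c p by simp
      show "0 < 2 - (norm y)\<^sup>2 / (1 + (norm y)\<^sup>2)" using p by (simp add: field_simps)
    qed
    finally show False by simp
  qed
  \<comment> \<open>Real parts at the multiple of \<open>y\<close> by the imaginary unit are
    imaginary parts at \<open>y\<close>, up to sign.\<close>
  have "Im (f y) = Im (cinner z y)" for y
    using Re[of "\<i> *\<^sub>C y"] by (simp add: scale cinner_scaleC_right)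
  then have "f y = cinner z y" for y using Re by (simp add: complex_eq_iff)
  then show ?thesis by blast
qed

text \<open>Riesz representation of the functional \<eta> \<mapsto>
  \<open>cinner \<xi> (A \<eta>)\<close> for each \<xi>. The bound on \<open>B\<close> follows from
  \<open>(norm (B x))\<^sup>2 = Re (cinner x (A (B x)))\<close> by cancelling one factor. Existence
  is half of what the definite description in \<open>cadj\<close> requires.\<close>

lemma cadj_ex:
  fixes A :: "'k::complex_hilbert_space \<Rightarrow>\<^sub>L 'k"
  assumes "A \<in> BK"
  shows "\<exists>B. \<forall>\<xi> \<eta>. cinner (blinfun_apply B \<xi>) \<eta> = cinner \<xi> (blinfun_apply A \<eta>)"
proof -
  have "\<exists>z. \<forall>\<eta>. cinner \<xi> (A \<eta>) = cinner z \<eta>" for \<xi>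
  proof (rule riesz_representation)
    show "cmod (cinner \<xi> (A \<eta>)) \<le> (norm \<xi> * norm A) * norm \<eta>" for \<eta>
      using order_trans[OF cmod_cinner_le mult_left_mono[OF norm_blinfun norm_ge_zero]]
      by (simp add: mult.assoc)
  qed (use assms in \<open>auto simp: BK_def blinfun.add_right cinner_add_right cinner_scaleC_right\<close>)
  then obtain B where B: "\<And>\<xi> \<eta>. cinner (B \<xi>) \<eta> = cinner \<xi> (A \<eta>)" by metis
  have "bounded_linear B"
  proof (rule bounded_linear_intro[where K = "norm A"])
    show "B (x + y) = B x + B y" for x y
      by (rule cinner_eqI) (simp add: cinner_add_left B)
    show "B (r *\<^sub>R x) = r *\<^sub>R B x" for r x
      by (rule cinner_eqI) (simp add: cinner_scaleR_left B)
    fix x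
    have "(norm (B x))\<^sup>2 = Re (cinner x (A (B x)))"
      by (simp add: B[symmetric] cinner_self)
    also have "\<dots> \<le> norm x * norm (A (B x))" by (rule Re_cinner_le)
    also have "\<dots> \<le> norm x * (norm A * norm (B x))" by (intro mult_left_mono norm_blinfun) auto
    finally have "norm (B x) * norm (B x) \<le> (norm x * norm A) * norm (B x)"
      by (simp add: power2_eq_square mult.assoc)
    then show "norm (B x) \<le> norm x * norm A"
      by (cases "norm (B x) = 0") (auto dest: mult_right_le_imp_le)
  qed
  then show ?thesis using B by (intro exI[of _ "Blinfun B"]) (simp add: bounded_linear_Blinfun_apply)
qed

lemma cinner_cadj:
  assumes "A \<in> BK"
  shows "cinner (blinfun_apply (cadj A) \<xi>) \<eta> = cinner \<xi> (blinfun_apply A \<eta>)"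
proof -
  have "\<exists>!B. \<forall>\<xi> \<eta>. cinner (blinfun_apply B \<xi>) \<eta> = cinner \<xi> (blinfun_apply A \<eta>)"
    using cadj_ex[OF assms] by (metis blinfun_eqI cinner_eqI)
  from theI'[OF this] show ?thesis unfolding cadj_def by blast
qed

lemma unitary_op_norm:
  assumes "unitary_op U"
  shows "norm (blinfun_apply U \<xi>) = norm \<xi>"
proof -
  have "cinner (U \<xi>) (U \<xi>) = cinner (cadj U (U \<xi>)) \<xi>"
    using assms by (simp add: cinner_cadj unitary_op_def)
  also have "cadj U (U \<xi>) = (cadj U o\<^sub>L U) \<xi>" by simp
  also have "cadj U o\<^sub>L U = id_blinfun" using assms by (simp add: unitary_op_def)
  finally have "cinner (U \<xi>) (U \<xi>) = cinner \<xi> \<xi>" by simp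
  then have "(norm (U \<xi>))\<^sup>2 = (norm \<xi>)\<^sup>2"
    unfolding cinner_self of_real_eq_iff .
  then show ?thesis by (simp add: power2_eq_iff_nonneg)
qed

text \<open>Here the semi-norm enters: the sum of the squared norms of the \<open>C j y\<close> is
  the quadratic form of the operator under the norm, evaluated at \<open>y\<close>, and
  Cauchy-Schwarz in the index \<open>j\<close> separates the coefficients from it.\<close>

lemma norm_combination_le:
  fixes C :: "nat \<Rightarrow> ('k::complex_hilbert_space \<Rightarrow>\<^sub>L 'k)"
  assumes "\<And>j. j \<in> J \<Longrightarrow> C j \<in> BK"
  shows "norm (\<Sum>j\<in>J. a j *\<^sub>R blinfun_apply (C j) y)
    \<le> L2_set a J * (sqrt (norm (\<Sum>j\<in>J. cadj (C j) o\<^sub>L C j)) * norm y)"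
proof -
  let ?S = "\<Sum>j\<in>J. cadj (C j) o\<^sub>L C j"
  have "(\<Sum>j\<in>J. (norm (C j y))\<^sup>2) = (\<Sum>j\<in>J. Re (cinner (cadj (C j) (C j y)) y))"
    using assms by (intro sum.cong) (auto simp: cinner_cadj cinner_self)
  also have "\<dots> = Re (cinner (?S y) y)"
  proof (induction J rule: infinite_finite_induct)
    case (insert j J)
    then show ?case by (simp add: blinfun.add_left cinner_add_left)
  qed (use cinner_zero_right[of y] Re_cinner_commute[of y 0] in auto)
  also have "\<dots> \<le> norm (?S y) * norm y" by (rule Re_cinner_le)
  also have "\<dots> \<le> norm ?S * norm y * norm y" by (intro mult_right_mono norm_blinfun) auto
  finally have "L2_set (\<lambda>j. norm (C j y)) J \<le> sqrt (norm ?S * (norm y)\<^sup>2)"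
    unfolding L2_set_def by (intro real_sqrt_le_mono) (simp add: power2_eq_square mult.assoc)
  then have *: "L2_set (\<lambda>j. norm (C j y)) J \<le> sqrt (norm ?S) * norm y" by (simp add: real_sqrt_mult)
  have "norm (\<Sum>j\<in>J. a j *\<^sub>R C j y) \<le> (\<Sum>j\<in>J. \<bar>a j\<bar> * \<bar>norm (C j y)\<bar>)"
    by (rule order_trans[OF norm_sum]) simp
  also have "\<dots> \<le> L2_set a J * L2_set (\<lambda>j. norm (C j y)) J" by (rule L2_set_mult_ineq)
  also have "\<dots> \<le> L2_set a J * (sqrt (norm ?S) * norm y)"
    by (intro mult_left_mono * L2_set_nonneg)
  finally show ?thesis .
qed


section \<open>One-parameter groups of contractions\<close>

text \<open>Mean value inequality for \<open>f\<close> minus a linear function. The closed segment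
  admits both signs of \<open>s\<close>.\<close>

lemma norm_diff_linear_le:
  fixes f :: "real \<Rightarrow> 'a::real_normed_vector"
  assumes d: "\<And>r. r \<in> closed_segment 0 s \<Longrightarrow> (f has_vector_derivative f' r) (at r)"
    and b: "\<And>r. r \<in> closed_segment 0 s \<Longrightarrow> norm (f' r - c) \<le> \<epsilon>"
  shows "norm (f s - f 0 - s *\<^sub>R c) \<le> \<epsilon> * \<bar>s\<bar>"
proof -
  have "norm ((f s - s *\<^sub>R c) - (f 0 - 0 *\<^sub>R c)) \<le> \<epsilon> * norm (s - 0)"
  proof (rule differentiable_bound[where S = "closed_segment 0 s" and f' = "\<lambda>r x. x *\<^sub>R (f' r - c)"])
    fix r assume r: "r \<in> closed_segment 0 s"
    have "((\<lambda>s. f s - s *\<^sub>R c) has_vector_derivative f' r - c) (at r)"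
      by (intro has_vector_derivative_diff d r) (auto intro!: derivative_eq_intros)
    then show "((\<lambda>s. f s - s *\<^sub>R c) has_derivative (\<lambda>x. x *\<^sub>R (f' r - c))) (at r within closed_segment 0 s)"
      by (simp add: has_vector_derivative_def has_derivative_at_withinI)
    show "onorm (\<lambda>x. x *\<^sub>R (f' r - c)) \<le> \<epsilon>"
      using b[OF r] by (intro onorm_le) (simp add: mult.commute[of \<epsilon>] mult_left_mono)
  qed auto
  then show ?thesis by (simp add: algebra_simps)
qed

section \<open>Strongly continuous one-parameter groups, their generators and bounded
  commutators\<close>

locale contraction_group =
  fixes T :: "real \<Rightarrow> ('k::banach \<Rightarrow>\<^sub>L 'k)"
  assumes T_0: "T 0 = id_blinfun" and T_add: "T (s + t) = T s o\<^sub>L T t"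
    and T_norm: "norm (blinfun_apply (T t) v) \<le> norm v"
    and T_cont: "continuous_on UNIV (\<lambda>t. blinfun_apply (T t) v)"
begin

definition dom :: "'k set" where
  "dom = {v. (\<lambda>t. blinfun_apply (T t) v) differentiable (at 0)}"

definition gen :: "'k \<Rightarrow> 'k" where
  "gen v = vector_derivative (\<lambda>t. blinfun_apply (T t) v) (at 0)"

lemma T_add_apply: "T (s + t) v = T s (T t v)"
  by (simp add: T_add)

lemma gen: "v \<in> dom \<Longrightarrow> ((\<lambda>t. T t v) has_vector_derivative gen v) (at 0)"
  by (simp add: dom_def gen_def vector_derivative_works)

lemma T_dom:
  assumes "v \<in> dom"
  shows "T t v \<in> dom" "gen (T t v) = T t (gen v)"
proof -
  have "((\<lambda>s. T t (T s v)) has_vector_derivative T t (gen v)) (at 0)"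
    by (rule bounded_linear.has_vector_derivative[OF blinfun.bounded_linear_right gen[OF assms]])
  moreover have "T t (T s v) = T s (T t v)" for s
    using T_add_apply[of s t v] T_add_apply[of t s v] by (simp add: add.commute)
  ultimately have *: "((\<lambda>s. T s (T t v)) has_vector_derivative T t (gen v)) (at 0)" by simp
  then show "T t v \<in> dom" by (auto simp: dom_def differentiableI_vector)
  show "gen (T t v) = T t (gen v)" using * by (simp add: gen_def vector_derivative_at)
qed

text \<open>The averages of \<open>T s v\<close> over \<open>{0..h}\<close> lie in the domain,
  because applying \<open>T t\<close> only shifts the window of integration, and they tend to
  \<open>v\<close> as \<open>h\<close> tends to 0.\<close>

lemma dom_dense:
  assumes "e > 0"
  shows "\<exists>w\<in>dom. norm (w - v) < e"
proof -
  \<comment> \<open>The base point \<open>- 1\<close> leaves room for negative times: membership in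
    the domain asks for a two-sided derivative at 0.\<close>
  define F where "F t = integral {- 1..t} (\<lambda>s. T s v)" for t
  have c: "continuous_on S (\<lambda>s. T s v)" for S using T_cont continuous_on_subset by blast
  have F: "(F has_vector_derivative T t v) (at t)" if "t \<in> {-1<..<2}" for t
  proof -
    have "(F has_vector_derivative T t v) (at t within {-1..2})"
      unfolding F_def by (rule integral_has_vector_derivative) (use that c in auto)
    then have "(F has_vector_derivative T t v) (at t within {-1<..<2})"
      by (rule has_vector_derivative_within_subset) auto
    then show ?thesis using that by (subst (asm) at_within_open) auto
  qed
  have TF: "T t (F h - F 0) = F (t + h) - F t" if h: "0 < h" "h < 1" "\<bar>t\<bar> < 1" for t h
  proof -
    have int: "(\<lambda>s. T s v) integrable_on {a..b}" for a b
      by (intro integrable_continuous_real c)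
    have dif: "F b - F a = integral {a..b} (\<lambda>s. T s v)" if "-1 \<le> a" "a \<le> b" for a b
      using Henstock_Kurzweil_Integration.integral_combine[OF that int] by (simp add: F_def algebra_simps)
    have "T t (F h - F 0) = integral {0..h} (\<lambda>s. T t (T s v))"
      using h integral_linear[OF int blinfun.bounded_linear_right, of 0 h "T t"] by (simp add: dif o_def)
    also have "\<dots> = integral {0..h} ((\<lambda>s. T s v) \<circ> (+) t)"
      by (simp add: o_def T_add_apply)
    also have "\<dots> = integral {0 + t..h + t} (\<lambda>s. T s v)" by (rule integral_shift_Icc_real)
    also have "\<dots> = F (t + h) - F t" using h by (simp add: dif add.commute)
    finally show ?thesis .
  qed
  have in_dom: "inverse h *\<^sub>R (F h - F 0) \<in> dom" if h: "0 < h" "h < 1" for h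
  proof -
    have "((\<lambda>t. F (t + h)) has_vector_derivative T h v) (at 0)"
    proof -
      have "(F \<circ> (\<lambda>t. t + h) has_vector_derivative 1 *\<^sub>R T (0 + h) v) (at 0)"
        by (rule vector_diff_chain_at) (use h in \<open>auto intro!: derivative_eq_intros F\<close>)
      then show ?thesis by (simp add: o_def)
    qed
    then have "((\<lambda>t. inverse h *\<^sub>R (F (t + h) - F t)) has_vector_derivative inverse h *\<^sub>R (T h v - T 0 v)) (at 0)"
      by (intro bounded_linear.has_vector_derivative[OF bounded_linear_scaleR_right] has_vector_derivative_diff F) auto
    then have "((\<lambda>t. T t (inverse h *\<^sub>R (F h - F 0))) has_vector_derivative inverse h *\<^sub>R (T h v - T 0 v)) (at 0)"
      by (rule has_vector_derivative_transform_within_open[where S = "{-1<..<1}"])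
        (use h in \<open>auto simp: blinfun.scaleR_right TF\<close>)
    then show ?thesis by (auto simp: dom_def differentiableI_vector)
  qed
  have "(F has_derivative (\<lambda>x. x *\<^sub>R T 0 v)) (at 0)"
    using F[of 0] by (simp add: has_vector_derivative_def)
  then obtain d where d: "d > 0"
    "\<And>h. 0 < norm (h - 0) \<Longrightarrow> norm (h - 0) < d \<Longrightarrow> norm (F h - F 0 - (h - 0) *\<^sub>R T 0 v) / norm (h - 0) < e"
    using assms unfolding has_derivative_at' by metis
  define h where "h = min d 1 / 2"
  have h: "0 < h" "h < 1" "h < d" using d(1) by (auto simp: h_def)
  have "inverse h *\<^sub>R (F h - F 0) - v = inverse h *\<^sub>R (F h - F 0 - h *\<^sub>R T 0 v)"
    using h by (simp add: scaleR_diff_right T_0)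
  then have "norm (inverse h *\<^sub>R (F h - F 0) - v) = norm (F h - F 0 - (h - 0) *\<^sub>R T 0 v) / norm (h - 0)"
    using h by (simp add: divide_inverse mult.commute)
  also have "\<dots> < e" using h by (intro d(2)) auto
  finally show ?thesis using in_dom[OF h(1,2)] by blast
qed

lemma has_vector_derivative_T_apply:
  assumes "(D has_vector_derivative d) (at 0)" and "D 0 = 0"
  shows "((\<lambda>h. T h (D h)) has_vector_derivative d) (at 0)"
  unfolding has_vector_derivative_def has_derivative_at
proof (intro conjI bounded_linear_scaleR_left)
  have D: "(\<lambda>h. norm (D (0 + h) - D 0 - h *\<^sub>R d) / norm h) \<midarrow>0\<rightarrow> 0"
    using assms(1) unfolding has_vector_derivative_def has_derivative_at by blast
  have "(\<lambda>h. T h d) \<midarrow>0\<rightarrow> T 0 d"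
    using T_cont[of d] by (simp add: continuous_on_eq_continuous_at isCont_def)
  then have "(\<lambda>h. norm (T h d - d)) \<midarrow>0\<rightarrow> 0"
    by (simp add: T_0 tendsto_norm_zero LIM_zero)
  from tendsto_add[OF D this]
  have lim: "(\<lambda>h. norm (D (0 + h) - D 0 - h *\<^sub>R d) / norm h + norm (T h d - d)) \<midarrow>0\<rightarrow> 0" by simp
  show "(\<lambda>h. norm (T (0 + h) (D (0 + h)) - T 0 (D 0) - h *\<^sub>R d) / norm h) \<midarrow>0\<rightarrow> 0"
  proof (rule Lim_null_comparison[OF _ lim])
    show "\<forall>\<^sub>F h in at 0. norm (norm (T (0 + h) (D (0 + h)) - T 0 (D 0) - h *\<^sub>R d) / norm h)
      \<le> norm (D (0 + h) - D 0 - h *\<^sub>R d) / norm h + norm (T h d - d)"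
    proof (rule always_eventually, rule allI)
      fix h
      have "T h (D h) - h *\<^sub>R d = T h (D h - h *\<^sub>R d) + h *\<^sub>R (T h d - d)"
        by (simp add: blinfun.diff_right blinfun.scaleR_right scaleR_diff_right)
      then have "norm (T h (D h) - h *\<^sub>R d) \<le> norm (D h - h *\<^sub>R d) + \<bar>h\<bar> * norm (T h d - d)"
        using T_norm[of h "D h - h *\<^sub>R d"] norm_triangle_ineq[of "T h (D h - h *\<^sub>R d)" "h *\<^sub>R (T h d - d)"]
        by simp
      then show "norm (norm (T (0 + h) (D (0 + h)) - T 0 (D 0) - h *\<^sub>R d) / norm h)
          \<le> norm (D (0 + h) - D 0 - h *\<^sub>R d) / norm h + norm (T h d - d)"
        using assms(2) by (cases "h = 0") (simp_all add: field_simps)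
    qed
  qed
qed

context
  fixes x C :: "'k \<Rightarrow>\<^sub>L 'k"
  assumes comm: "\<And>\<xi>. \<xi> \<in> dom \<Longrightarrow> x \<xi> \<in> dom \<and> C \<xi> = gen (x \<xi>) - x (gen \<xi>)"
begin

text \<open>By the group law it suffices to differentiate at time 0, with
  \<open>w = T (- s) v\<close>. Split \<open>T (- h) w\<close> into \<open>w\<close> and a
  difference that vanishes at \<open>h = 0\<close>. The first part contributes
  \<open>gen (x w)\<close>, which exists because \<open>x\<close> preserves the domain; the second,
  by \<open>has_vector_derivative_T_apply\<close>, contributes \<open>- x (gen w)\<close>.\<close>

lemma conjugation_derivative:
  assumes v: "v \<in> dom"
  shows "((\<lambda>s. T s (x (T (- s) v))) has_vector_derivative T s (C (T (- s) v))) (at s)"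
proof -
  define w where "w = T (- s) v"
  have w: "w \<in> dom" unfolding w_def by (rule T_dom[OF v])
  have "(((\<lambda>h. T h w) \<circ> (\<lambda>h. - h)) has_vector_derivative (- 1) *\<^sub>R gen w) (at 0)"
    by (rule vector_diff_chain_at) (use gen[OF w] in \<open>auto intro!: derivative_eq_intros\<close>)
  then have "((\<lambda>h. T (- h) w) has_vector_derivative - gen w) (at 0)" by (simp add: o_def)
  then have "((\<lambda>h. T (- h) w - w) has_vector_derivative - gen w) (at 0)"
    by (auto intro!: derivative_eq_intros)
  then have "((\<lambda>h. x (T (- h) w - w)) has_vector_derivative x (- gen w)) (at 0)"
    by (rule bounded_linear.has_vector_derivative[OF blinfun.bounded_linear_right])
  then have "((\<lambda>h. T h (x (T (- h) w - w))) has_vector_derivative x (- gen w)) (at 0)"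
    by (rule has_vector_derivative_T_apply) (simp add: T_0)
  from has_vector_derivative_add[OF gen[OF conjunct1[OF comm[OF w]]] this]
  have "((\<lambda>h. T h (x (T (- h) w))) has_vector_derivative C w) (at 0)"
    using comm[OF w] by (simp add: blinfun.diff_right blinfun.minus_right)
  then have "((\<lambda>h. T s (T h (x (T (- h) w)))) has_vector_derivative T s (C w)) (at (s - s))"
    by (simp add: bounded_linear.has_vector_derivative[OF blinfun.bounded_linear_right])
  moreover have "((\<lambda>r. r - s) has_vector_derivative 1) (at s)" by (auto intro!: derivative_eq_intros)
  ultimately have "((\<lambda>h. T s (T h (x (T (- h) w)))) \<circ> (\<lambda>r. r - s) has_vector_derivative 1 *\<^sub>R T s (C w)) (at s)"
    by (rule vector_diff_chain_at[rotated])
  moreover have "T s (T (r - s) (x (T (- (r - s)) w))) = T r (x (T (- r) v))" for r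
    by (simp add: w_def flip: T_add_apply)
  ultimately show ?thesis by (simp add: o_def w_def)
qed

text \<open>The derivative is available on the domain only, but its integrated form extends to every
  \<open>v\<close>: replacing \<open>v\<close> by \<open>w\<close> in the dense domain adds at most
  \<open>norm C * norm (w - v)\<close> to the bound, uniformly in time, and this vanishes in the
  limit.\<close>

lemma conjugation_increment:
  assumes "\<And>r. r \<in> closed_segment 0 s \<Longrightarrow> norm (T r (C (T (- r) v)) - c) \<le> \<epsilon>"
  shows "norm (T s (x (T (- s) v)) - x v - s *\<^sub>R c) \<le> \<epsilon> * \<bar>s\<bar>"
proof -
  have approx: "norm (T s (x (T (- s) w)) - x w - s *\<^sub>R c) \<le> (\<epsilon> + norm C * norm (w - v)) * \<bar>s\<bar>"
    if w: "w \<in> dom" for w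
  proof -
    have "norm (T s (x (T (- s) w)) - T 0 (x (T (- 0) w)) - s *\<^sub>R c) \<le> (\<epsilon> + norm C * norm (w - v)) * \<bar>s\<bar>"
    proof (rule norm_diff_linear_le[OF conjugation_derivative[OF w]])
      fix r assume r: "r \<in> closed_segment 0 s"
      have "T r (C (T (- r) w)) - c = (T r (C (T (- r) v)) - c) + T r (C (T (- r) (w - v)))"
        by (simp add: blinfun.diff_right)
      moreover have "norm (T r (C (T (- r) (w - v)))) \<le> norm C * norm (w - v)"
        by (rule order_trans[OF T_norm order_trans[OF norm_blinfun mult_left_mono[OF T_norm]]]) simp
      ultimately show "norm (T r (C (T (- r) w)) - c) \<le> \<epsilon> + norm C * norm (w - v)"
        using assms[OF r] norm_triangle_le by (metis add_mono)
    qed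
    then show ?thesis by (simp add: T_0)
  qed
  have "\<exists>w\<in>dom. norm (w - v) < 1 / real (Suc n)" for n by (rule dom_dense) simp
  then obtain w where w: "\<And>n. w n \<in> dom" "\<And>n. norm (w n - v) < 1 / real (Suc n)" by metis
  have "(\<lambda>n. w n - v) \<longlonglongrightarrow> 0"
    by (rule LIMSEQ_norm_0) (use w(2) in auto)
  then have wv: "w \<longlonglongrightarrow> v" by (simp add: LIM_zero_iff)
  have "(\<lambda>n. norm (T s (x (T (- s) (w n))) - x (w n) - s *\<^sub>R c)) \<longlonglongrightarrow> norm (T s (x (T (- s) v)) - x v - s *\<^sub>R c)"
    by (intro tendsto_intros wv blinfun.tendsto)
  moreover have "(\<lambda>n. (\<epsilon> + norm C * norm (w n - v)) * \<bar>s\<bar>) \<longlonglongrightarrow> (\<epsilon> + norm C * norm (v - v)) * \<bar>s\<bar>"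
    by (intro tendsto_intros wv)
  ultimately have "norm (T s (x (T (- s) v)) - x v - s *\<^sub>R c) \<le> (\<epsilon> + norm C * norm (v - v)) * \<bar>s\<bar>"
    using approx[OF w(1)] by (intro LIMSEQ_le) auto
  then show ?thesis by simp
qed

end

end

section \<open>Increments of conjugated operators along exponentials\<close>

lemma finite_uniform_radius:
  assumes "finite J" and "\<And>j. j \<in> J \<Longrightarrow> \<exists>r>0. Q j r"
    and "\<And>j r r'. Q j r \<Longrightarrow> 0 < r' \<Longrightarrow> r' \<le> r \<Longrightarrow> Q j r'"
  shows "\<exists>r>0. \<forall>j\<in>J. Q j (r::real)"
  using assms(1,2)
proof (induction J rule: finite_induct)
  case empty
  show ?case by (intro exI[of _ 1]) auto
next
  case (insert j J)
  obtain r where "r > 0" "\<forall>j\<in>J. Q j r" using insert.IH insert.prems by auto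
  moreover obtain r' where "r' > 0" "Q j r'" using insert.prems by blast
  ultimately show ?case using assms(3) by (intro exI[of _ "min r r'"]) auto
qed

section \<open>Orbits of conjugated operators under the representation\<close>

locale lie_group_rep = lie_group_chart \<A> c0
  for \<A> :: "('g::{topological_group_add, t2_space}, 'e::banach) chart set" and c0 +
  fixes \<pi> :: "'g \<Rightarrow> ('k::complex_hilbert_space \<Rightarrow>\<^sub>L 'k)"
  assumes rep: "unitary_rep \<pi>"
begin

lemma rep_norm: "norm (\<pi> g v) = norm v"
  using rep by (simp add: unitary_rep_def unitary_op_norm)

lemma rep_add: "\<pi> (g + h) v = \<pi> g (\<pi> h v)"
  using rep by (simp add: unitary_rep_def)

lemma rep_0: "\<pi> 0 v = v"
  using rep by (simp add: unitary_rep_def)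

lemma rep_minus: "\<pi> (- g) (\<pi> g v) = v" "\<pi> g (\<pi> (- g) v) = v"
  using rep_add[of "- g" g v] rep_add[of g "- g" v] by (simp_all add: rep_0)

lemma cadj_rep: "cadj (\<pi> g) = \<pi> (- g)"
proof (rule blinfun_eqI)
  fix v
  have "cadj (\<pi> g) v = (cadj (\<pi> g) o\<^sub>L \<pi> g) (\<pi> (- g) v)" by (simp add: rep_minus)
  also have "cadj (\<pi> g) o\<^sub>L \<pi> g = id_blinfun" using rep by (simp add: unitary_rep_def unitary_op_def)
  finally show "cadj (\<pi> g) v = \<pi> (- g) v" by simp
qed

lemma rep_isCont: "isCont (\<lambda>g. \<pi> g v) g0"
  using rep by (simp add: unitary_rep_def continuous_on_eq_continuous_at)

text \<open>Strong continuity treats a fixed vector; since every \<open>\<pi> g\<close> is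
  isometric, moving the vector as well costs only \<open>norm (y g - y g0)\<close>.\<close>

lemma rep_apply_isCont:
  assumes "isCont y g0"
  shows "isCont (\<lambda>g. \<pi> g (y g)) g0"
  unfolding isCont_def
proof (rule Lim_transform)
  show "((\<lambda>g. \<pi> g (y g0)) \<longlongrightarrow> \<pi> g0 (y g0)) (at g0)"
    using rep_isCont[of g0 "y g0"] by (simp add: isCont_def)
  have "((\<lambda>g. y g - y g0) \<longlongrightarrow> y g0 - y g0) (at g0)"
    using assms by (intro tendsto_intros) (simp add: isCont_def)
  then have "((\<lambda>g. norm (\<pi> g (y g - y g0))) \<longlongrightarrow> 0) (at g0)"
    by (simp add: rep_norm tendsto_norm_zero)
  then show "((\<lambda>g. \<pi> g (y g) - \<pi> g (y g0)) \<longlongrightarrow> 0) (at g0)"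
    by (simp add: tendsto_norm_zero_iff flip: blinfun.diff_right)
qed

text \<open>\<open>orbit x v\<close> is \<Psi>, and \<open>orbit C v\<close> with the commutator
  \<open>C\<close> in direction X_j is its derivative c_j.\<close>

definition orbit :: "('k \<Rightarrow>\<^sub>L 'k) \<Rightarrow> 'k \<Rightarrow> 'g \<Rightarrow> 'k" where
  "orbit x v g = \<pi> g (x (\<pi> (- g) v))"

lemma orbit_isCont: "isCont (orbit x v) g0"
proof -
  have "isCont (\<lambda>g. \<pi> (- g) v) g0"
    by (rule isCont_o2[where f = uminus, OF _ rep_isCont]) (simp add: isCont_def tendsto_minus)
  then show ?thesis
    unfolding orbit_def[abs_def] by (intro rep_apply_isCont bounded_linear.isCont[OF blinfun.bounded_linear_right])
qed

lemma contraction_group: "contraction_group (\<lambda>s. \<pi> (flow X s))"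
proof
  show "\<pi> (flow X 0) = id_blinfun" using rep by (simp add: flow unitary_rep_def)
  show "\<pi> (flow X (s + t)) = \<pi> (flow X s) o\<^sub>L \<pi> (flow X t)" for s t
    using rep by (simp add: flow_add unitary_rep_def)
  show "norm (\<pi> (flow X t) v) \<le> norm v" for t v by (simp add: rep_norm)
  show "continuous_on UNIV (\<lambda>t. \<pi> (flow X t) v)" for v
    by (auto simp: continuous_on_eq_continuous_at intro: isCont_o2[OF flow_continuous rep_isCont])
qed

lemma dpi_eq:
  "dpi_dom \<A> c0 \<pi> X = contraction_group.dom (\<lambda>s. \<pi> (flow X s))"
  "dpi \<A> c0 \<pi> X = contraction_group.gen (\<lambda>s. \<pi> (flow X s))"
  using contraction_group[of X]
  by (auto simp: fun_eq_iff dpi_dom_def dpi_def lie_exp_scaleR contraction_group.dom_def contraction_group.gen_def)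

text \<open>Two bounded extensions agree on the dense domain of the generator. This justifies the
  definite description in \<open>commutator\<close>.\<close>

lemma commutator_unique:
  assumes C: "is_bounded_commutator \<A> c0 \<pi> X x C" and C': "is_bounded_commutator \<A> c0 \<pi> X x C'"
  shows "C = C'"
proof (rule blinfun_eqI)
  fix v
  interpret contraction_group "\<lambda>s. \<pi> (flow X s)" by (rule contraction_group)
  have eq: "(C - C') w = 0" if "w \<in> dom" for w
    using C C' that unfolding is_bounded_commutator_def dpi_eq by (simp add: blinfun.diff_left)
  have "norm ((C - C') v) \<le> 0 + e" if e: "e > 0" for e
  proof -
    have "e / (norm (C - C') + 1) > 0" using e by (simp add: add_nonneg_pos)
    from dom_dense[OF this] obtain w where w: "w \<in> dom" "norm (w - v) < e / (norm (C - C') + 1)" by blast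
    have "(C - C') v = (C - C') (v - w)" by (simp add: blinfun.diff_right eq[OF w(1)])
    then have "norm ((C - C') v) \<le> norm (C - C') * norm (v - w)" by (metis norm_blinfun)
    also have "\<dots> \<le> (norm (C - C') + 1) * norm (w - v)"
      by (simp add: norm_minus_commute mult_right_mono)
    also have "\<dots> \<le> e"
      using w(2) by (simp add: pos_less_divide_eq add_nonneg_pos less_imp_le mult.commute)
    finally show ?thesis by simp
  qed
  then have "norm ((C - C') v) \<le> 0" by (rule field_le_epsilon)
  then show "C v = C' v" by (simp add: blinfun.diff_left)
qed

lemma is_bounded_commutator_commutator:
  "is_bounded_commutator \<A> c0 \<pi> X x C \<Longrightarrow> is_bounded_commutator \<A> c0 \<pi> X x (commutator \<A> c0 \<pi> X x)"
  unfolding commutator_def by (rule theI) (auto intro: commutator_unique)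

text \<open>The isometry \<open>\<pi> g\<close> carries \<open>conjugation_increment\<close> from
  the identity to \<open>g\<close>. The comparison vector \<open>k\<close> is free, so that one
  vector, the value of \<open>orbit C v\<close> at the centre of a chart ball, can serve for all
  points of the ball.\<close>

lemma orbit_increment:
  assumes C: "is_bounded_commutator \<A> c0 \<pi> X x C"
    and bound: "\<And>r. r \<in> closed_segment 0 s \<Longrightarrow> norm (orbit C v (g + flow X r) - k) \<le> \<epsilon>"
  shows "norm (orbit x v (g + flow X s) - orbit x v g - s *\<^sub>R k) \<le> \<epsilon> * \<bar>s\<bar>"
proof -
  interpret contraction_group "\<lambda>s. \<pi> (flow X s)" by (rule contraction_group)
  have minus: "- flow X r = flow X (- r)" for r
    using flow_add[of X r "- r"] by (simp add: flow minus_unique)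
  have orb: "orbit y v (g + flow X r) = \<pi> g (\<pi> (flow X r) (y (\<pi> (flow X (- r)) (\<pi> (- g) v))))" for y r
    unfolding orbit_def minus_add minus rep_add ..
  have iso: "norm (\<pi> g a - \<pi> g b) = norm (a - b)" for a b
    by (simp add: rep_norm flip: blinfun.diff_right)
  have "norm (\<pi> (flow X s) (x (\<pi> (flow X (- s)) (\<pi> (- g) v))) - x (\<pi> (- g) v) - s *\<^sub>R \<pi> (- g) k) \<le> \<epsilon> * \<bar>s\<bar>"
  proof (rule conjugation_increment)
    show "x \<xi> \<in> dom \<and> C \<xi> = gen (x \<xi>) - x (gen \<xi>)" if "\<xi> \<in> dom" for \<xi>
      using C that unfolding is_bounded_commutator_def dpi_eq by simp
    show "norm (\<pi> (flow X r) (C (\<pi> (flow X (- r)) (\<pi> (- g) v))) - \<pi> (- g) k) \<le> \<epsilon>"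
      if "r \<in> closed_segment 0 s" for r
      using bound[OF that] unfolding orb by (subst iso[symmetric]) (simp add: rep_minus)
  qed
  then have "norm (\<pi> g (\<pi> (flow X s) (x (\<pi> (flow X (- s)) (\<pi> (- g) v))) - x (\<pi> (- g) v) - s *\<^sub>R \<pi> (- g) k)) \<le> \<epsilon> * \<bar>s\<bar>"
    by (simp add: rep_norm)
  then show ?thesis
    unfolding orb by (simp add: blinfun.diff_right blinfun.scaleR_right rep_minus orbit_def)
qed

text \<open>Factors are appended on the right, as suits left-invariant fields, and numbered from 1
  like the basis.\<close>

primrec exp_prod :: "(nat \<Rightarrow> 'e) \<Rightarrow> (nat \<Rightarrow> real) \<Rightarrow> nat \<Rightarrow> 'g \<Rightarrow> 'g" where
  "exp_prod X a 0 g = g"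
| "exp_prod X a (Suc n) g = exp_prod X a n g + flow (X (Suc n)) (a (Suc n))"

end

text \<open>A coordinate ball around \<open>g0\<close> on which the fields are bounded by \<open>M\<close> and \<open>\<Lambda>\<close>-Lipschitz, the
  orbits of the commutators vary by at most \<open>\<epsilon>\<close>, and from whose concentric ball of radius \<open>\<rho>\<close> the
  flows do not escape before time \<open>\<rho>\<close>.\<close>

locale adapted_chart = lie_group_rep \<A> c0 \<pi>
  for \<A> :: "('g::{topological_group_add, t2_space}, 'e::banach) chart set" and c0
    and \<pi> :: "'g \<Rightarrow> ('k::complex_hilbert_space \<Rightarrow>\<^sub>L 'k)" +
  fixes m :: nat and X :: "nat \<Rightarrow> 'e" and x :: "'k \<Rightarrow>\<^sub>L 'k" and C :: "nat \<Rightarrow> 'k \<Rightarrow>\<^sub>L 'k" and v :: 'k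
    and d :: "('g, 'e) chart" and g0 :: 'g and r \<rho> \<Lambda> M \<epsilon> :: real
  assumes comm: "j \<in> {1..m} \<Longrightarrow> is_bounded_commutator \<A> c0 \<pi> (X j) x (C j)"
    and d: "d \<in> \<A>" and pos: "r > 0" "\<rho> > 0" "\<Lambda> \<ge> 0" "M \<ge> 0" "\<epsilon> \<ge> 0" and \<rho>r: "\<rho> \<le> r"
    and in_im: "cball (snd d g0) r \<subseteq> im d"
    and Lip: "j \<in> {1..m} \<Longrightarrow> u \<in> cball (snd d g0) r \<Longrightarrow> u' \<in> cball (snd d g0) r \<Longrightarrow>
      norm (vf d (X j) u - vf d (X j) u') \<le> \<Lambda> * norm (u - u')"
    and bd: "j \<in> {1..m} \<Longrightarrow> u \<in> cball (snd d g0) r \<Longrightarrow> norm (vf d (X j) u) \<le> M"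
    and osc: "j \<in> {1..m} \<Longrightarrow> g \<in> fst d \<Longrightarrow> snd d g \<in> cball (snd d g0) r \<Longrightarrow>
      norm (orbit (C j) v g - orbit (C j) v g0) \<le> \<epsilon>"
    and stay: "j \<in> {1..m} \<Longrightarrow> g \<in> fst d \<Longrightarrow> snd d g \<in> cball (snd d g0) \<rho> \<Longrightarrow> \<bar>s\<bar> \<le> \<rho> \<Longrightarrow>
      g + flow (X j) s \<in> fst d \<and> snd d (g + flow (X j) s) \<in> cball (snd d g0) r"
begin

text \<open>One exponential as an Euler step. The point moves by at most
  \<open>M * \<bar>s\<bar>\<close>, so along the flow the field differs from its initial value by at
  most \<open>\<Lambda> * (M * \<bar>s\<bar>)\<close>; this gives the quadratic error. The last
  bound combines \<open>orbit_increment\<close> with \<open>osc\<close>.\<close>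

lemma single_step:
  assumes j: "j \<in> {1..m}" and g: "g \<in> fst d" "snd d g \<in> cball (snd d g0) \<rho>" and s: "\<bar>s\<bar> \<le> \<rho>"
  defines "g' \<equiv> g + flow (X j) s"
  shows "g' \<in> fst d" "norm (snd d g' - snd d g) \<le> M * \<bar>s\<bar>"
    "norm (snd d g' - snd d g - s *\<^sub>R vf d (X j) (snd d g)) \<le> \<Lambda> * M * s\<^sup>2"
    "norm (orbit x v g' - orbit x v g - s *\<^sub>R orbit (C j) v g0) \<le> \<epsilon> * \<bar>s\<bar>"
proof -
  let ?u = "\<lambda>s. snd d (g + flow (X j) s)"
  have seg: "\<bar>t\<bar> \<le> \<bar>s\<bar>" "\<bar>t\<bar> \<le> \<rho>" if "t \<in> closed_segment 0 s" for t
    using that s by (auto simp: closed_segment_eq_real_ivl split: if_splits)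
  have st: "g + flow (X j) t \<in> fst d" "?u t \<in> cball (snd d g0) r" if "\<bar>t\<bar> \<le> \<rho>" for t
    using stay[OF j g that] by auto
  have der: "(?u has_vector_derivative vf d (X j) (?u t)) (at t)" if "\<bar>t\<bar> \<le> \<rho>" for t
    by (rule left_velocity_chart[OF left_velocity_translate[OF flow(2)] d st(1)[OF that]]) simp
  show "g' \<in> fst d" unfolding g'_def by (rule st(1)[OF s])
  have near: "norm (?u t - snd d g) \<le> M * \<bar>t\<bar>" if "\<bar>t\<bar> \<le> \<rho>" for t
  proof -
    have seg': "\<bar>t'\<bar> \<le> \<rho>" if "t' \<in> closed_segment 0 t" for t'
      using that \<open>\<bar>t\<bar> \<le> \<rho>\<close> by (auto simp: closed_segment_eq_real_ivl split: if_splits)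
    have "norm (?u t - ?u 0 - t *\<^sub>R 0) \<le> M * \<bar>t\<bar>"
      by (rule norm_diff_linear_le[OF der]) (use seg' st bd[OF j] in auto)
    then show ?thesis by (simp add: flow)
  qed
  from near[OF s] show "norm (snd d g' - snd d g) \<le> M * \<bar>s\<bar>" by (simp add: g'_def)
  have "norm (?u s - ?u 0 - s *\<^sub>R vf d (X j) (snd d g)) \<le> (\<Lambda> * (M * \<bar>s\<bar>)) * \<bar>s\<bar>"
  proof (rule norm_diff_linear_le[OF der])
    show "\<bar>t\<bar> \<le> \<rho>" if "t \<in> closed_segment 0 s" for t by (rule seg[OF that])
    fix t assume t: "t \<in> closed_segment 0 s"
    have "norm (vf d (X j) (?u t) - vf d (X j) (snd d g)) \<le> \<Lambda> * norm (?u t - snd d g)"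
      by (rule Lip[OF j st(2)[OF seg(2)[OF t]]]) (use g \<rho>r in auto)
    also have "\<dots> \<le> \<Lambda> * (M * \<bar>t\<bar>)" by (intro mult_left_mono near seg pos t)
    also have "\<dots> \<le> \<Lambda> * (M * \<bar>s\<bar>)" by (intro mult_left_mono seg pos t)
    finally show "norm (vf d (X j) (?u t) - vf d (X j) (snd d g)) \<le> \<Lambda> * (M * \<bar>s\<bar>)" .
  qed
  then show "norm (snd d g' - snd d g - s *\<^sub>R vf d (X j) (snd d g)) \<le> \<Lambda> * M * s\<^sup>2"
    by (simp add: g'_def flow power2_eq_square mult.assoc)
  show "norm (orbit x v g' - orbit x v g - s *\<^sub>R orbit (C j) v g0) \<le> \<epsilon> * \<bar>s\<bar>"
    unfolding g'_def by (rule orbit_increment[OF comm[OF j]]) (use osc[OF j] st seg in auto)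
qed

text \<open>A new factor with exponent a, after factors of total size S, adds
  \<open>\<Lambda> * M\<close> times a^2 as its own Euler error and \<open>\<Lambda> * M\<close>
  times |a| S for evaluating its field at the starting point of the product. Both fit into the
  increase of 2 (S + |a|)^2 over 2 S^2. The bound by \<open>\<rho>\<close> keeps all partial
  products where \<open>single_step\<close> applies.\<close>

lemma multi_step:
  assumes "n \<le> m" and g: "g \<in> fst d" "norm (snd d g - snd d g0) + M * (\<Sum>j=1..n. \<bar>a j\<bar>) \<le> \<rho>"
    and a: "(\<Sum>j=1..n. \<bar>a j\<bar>) \<le> \<rho>"
  defines "A \<equiv> (\<Sum>j=1..n. \<bar>a j\<bar>)"
  shows "exp_prod X a n g \<in> fst d \<and> norm (snd d (exp_prod X a n g) - snd d g) \<le> M * A \<and>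
    norm (snd d (exp_prod X a n g) - snd d g - (\<Sum>j=1..n. a j *\<^sub>R vf d (X j) (snd d g))) \<le> 2 * \<Lambda> * M * A\<^sup>2 \<and>
    norm (orbit x v (exp_prod X a n g) - orbit x v g - (\<Sum>j=1..n. a j *\<^sub>R orbit (C j) v g0)) \<le> \<epsilon> * A"
  using assms(1,3,4) unfolding A_def
proof (induction n)
  case 0
  then show ?case using g by simp
next
  case (Suc n)
  let ?S = "\<Sum>j=1..n. \<bar>a j\<bar>" and ?j = "Suc n"
  let ?p = "exp_prod X a n g" and ?u = "snd d g" and ?a = "a (Suc n)"
  let ?w = "snd d (exp_prod X a n g)" and ?w' = "snd d (exp_prod X a (Suc n) g)"
  have S: "(\<Sum>j=1..Suc n. \<bar>a j\<bar>) = ?S + \<bar>?a\<bar>" by simp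
  have S0: "0 \<le> ?S" by (simp add: sum_nonneg)
  have MS: "M * (?S + \<bar>?a\<bar>) = M * ?S + M * \<bar>?a\<bar>" "0 \<le> M * \<bar>?a\<bar>" "0 \<le> M * ?S"
    using pos S0 by (simp_all add: distrib_left)
  have IH: "?p \<in> fst d" "norm (?w - ?u) \<le> M * ?S"
    "norm (?w - ?u - (\<Sum>j=1..n. a j *\<^sub>R vf d (X j) ?u)) \<le> 2 * \<Lambda> * M * ?S\<^sup>2"
    "norm (orbit x v ?p - orbit x v g - (\<Sum>j=1..n. a j *\<^sub>R orbit (C j) v g0)) \<le> \<epsilon> * ?S"
    using Suc.IH Suc.prems MS unfolding S by auto
  have j: "?j \<in> {1..m}" using Suc.prems by simp
  have "norm (?w - snd d g0) \<le> norm (?w - ?u) + norm (?u - snd d g0)"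
    using norm_triangle_ineq[of "?w - ?u" "?u - snd d g0"] by simp
  then have "norm (?w - snd d g0) \<le> \<rho>" using IH(2) Suc.prems(2) MS unfolding S by linarith
  then have w: "?w \<in> cball (snd d g0) \<rho>" by (simp add: dist_norm norm_minus_commute)
  have u: "?u \<in> cball (snd d g0) \<rho>"
    using Suc.prems(2) MS unfolding S by (simp add: dist_norm norm_minus_commute)
  have a: "\<bar>?a\<bar> \<le> \<rho>" using Suc.prems(3) S0 unfolding S by linarith
  note step = single_step[OF j IH(1) w a, folded exp_prod.simps(2)]
  have "norm (?w' - ?u) \<le> norm (?w' - ?w) + norm (?w - ?u)"
    using norm_triangle_ineq[of "?w' - ?w" "?w - ?u"] by simp
  then have 2: "norm (?w' - ?u) \<le> M * (?S + \<bar>?a\<bar>)" using step(2) IH(2) MS by linarith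
  have V: "norm (?a *\<^sub>R vf d (X ?j) ?w - ?a *\<^sub>R vf d (X ?j) ?u) \<le> \<bar>?a\<bar> * (\<Lambda> * (M * ?S))"
  proof -
    have "norm (vf d (X ?j) ?w - vf d (X ?j) ?u) \<le> \<Lambda> * norm (?w - ?u)"
      by (rule Lip[OF j]) (use w u \<rho>r in auto)
    also have "\<dots> \<le> \<Lambda> * (M * ?S)" by (intro mult_left_mono IH pos)
    finally have "\<bar>?a\<bar> * norm (vf d (X ?j) ?w - vf d (X ?j) ?u) \<le> \<bar>?a\<bar> * (\<Lambda> * (M * ?S))"
      by (intro mult_left_mono) auto
    then show ?thesis by (simp flip: scaleR_diff_right)
  qed
  have eq: "?w' - ?u - (\<Sum>j=1..Suc n. a j *\<^sub>R vf d (X j) ?u) =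
      (?w' - ?w - ?a *\<^sub>R vf d (X ?j) ?w) + (?w - ?u - (\<Sum>j=1..n. a j *\<^sub>R vf d (X j) ?u))
      + (?a *\<^sub>R vf d (X ?j) ?w - ?a *\<^sub>R vf d (X ?j) ?u)" by simp
  have "norm (?w' - ?u - (\<Sum>j=1..Suc n. a j *\<^sub>R vf d (X j) ?u)) \<le>
      \<Lambda> * M * ?a\<^sup>2 + 2 * \<Lambda> * M * ?S\<^sup>2 + \<bar>?a\<bar> * (\<Lambda> * (M * ?S))"
    unfolding eq by (intro norm_triangle_le add_mono step(3) IH(3) V)
  also have "\<dots> = \<Lambda> * M * (?a\<^sup>2 + 2 * ?S\<^sup>2 + \<bar>?a\<bar> * ?S)" by (simp add: algebra_simps)
  also have "\<dots> \<le> \<Lambda> * M * (2 * (?S + \<bar>?a\<bar>)\<^sup>2)"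
    using S0 pos by (intro mult_left_mono) (auto simp: power2_sum)
  finally have 3: "norm (?w' - ?u - (\<Sum>j=1..Suc n. a j *\<^sub>R vf d (X j) ?u)) \<le> 2 * \<Lambda> * M * (?S + \<bar>?a\<bar>)\<^sup>2"
    by (simp add: mult_ac)
  let ?o = "orbit x v"
  have eq: "?o (exp_prod X a (Suc n) g) - ?o g - (\<Sum>j=1..Suc n. a j *\<^sub>R orbit (C j) v g0) =
      (?o (exp_prod X a (Suc n) g) - ?o ?p - ?a *\<^sub>R orbit (C ?j) v g0)
      + (?o ?p - ?o g - (\<Sum>j=1..n. a j *\<^sub>R orbit (C j) v g0))" by simp
  have "norm (?o (exp_prod X a (Suc n) g) - ?o g - (\<Sum>j=1..Suc n. a j *\<^sub>R orbit (C j) v g0)) \<le> \<epsilon> * \<bar>?a\<bar> + \<epsilon> * ?S"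
    unfolding eq by (intro norm_triangle_le add_mono step(4) IH(4))
  then have 4: "norm (?o (exp_prod X a (Suc n) g) - ?o g - (\<Sum>j=1..Suc n. a j *\<^sub>R orbit (C j) v g0)) \<le> \<epsilon> * (?S + \<bar>?a\<bar>)"
    by (simp add: algebra_simps)
  show ?case unfolding S using step(1) 2 3 4 by blast
qed

text \<open>\<open>u\<close> is a curve in coordinates, \<open>K j\<close> are the antiderivatives of its controls, and \<open>H\<close> bounds
  their total variation.  The curve is followed by products of exponentials whose exponents are the
  increments of the \<open>K j\<close> over a fine partition; the error obeys a discrete Gronwall inequality.\<close>

lemma approximation:
  fixes u :: "real \<Rightarrow> 'e" and K :: "nat \<Rightarrow> real \<Rightarrow> real" and H :: "real \<Rightarrow> real"
  assumes ab: "a \<le> b" and H: "continuous_on {a..b} H"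
    and K: "\<And>s t. a \<le> s \<Longrightarrow> s \<le> t \<Longrightarrow> t \<le> b \<Longrightarrow> (\<Sum>j=1..m. \<bar>K j t - K j s\<bar>) \<le> H t - H s"
    and u1: "\<And>s t. a \<le> s \<Longrightarrow> s \<le> t \<Longrightarrow> t \<le> b \<Longrightarrow> norm (u t - u s) \<le> M * (H t - H s)"
    and u2: "\<And>s t. a \<le> s \<Longrightarrow> s \<le> t \<Longrightarrow> t \<le> b \<Longrightarrow>
      norm (u t - u s - (\<Sum>j=1..m. (K j t - K j s) *\<^sub>R vf d (X j) (u s))) \<le> \<Lambda> * M * (H t - H s)\<^sup>2"
    and small: "norm (u a - snd d g0) + M * (H b - H a) \<le> \<rho>" "H b - H a \<le> \<rho>"
    and ga: "ga \<in> fst d" "snd d ga = u a" and gb: "gb \<in> fst d" "snd d gb = u b"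
  shows "norm (orbit x v gb - orbit x v ga - (\<Sum>j=1..m. (K j b - K j a) *\<^sub>R orbit (C j) v g0)) \<le> \<epsilon> * (H b - H a)"
proof -
  have Hmono: "H s \<le> H t" if "a \<le> s" "s \<le> t" "t \<le> b" for s t
    using order_trans[OF sum_nonneg K[OF that]] by simp
  \<comment> \<open>Gronwall constant: on a cell of variation \<open>A k\<close> the product
    contributes \<open>2 * \<Lambda> * M\<close> and the curve \<open>\<Lambda> * M\<close> times
    the square of \<open>A k\<close>, while the error already present is multiplied by at most
    \<open>1 + \<Lambda> * A k \<le> exp (\<Lambda> * A k)\<close>.\<close>
  define E where "E = exp (\<Lambda> * (H b - H a)) * (3 * \<Lambda> * M * (H b - H a))"
  \<comment> \<open>The increment of the orbit obeys a bound free of \<open>\<eta>\<close>; only the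
    endpoint is approximate. Letting \<open>\<eta>\<close> tend to 0 thus calls only for continuity
    of the inverse chart and of the orbit.\<close>
  have main: "\<exists>g\<in>fst d. norm (snd d g - u b) \<le> E * \<eta> \<and>
    norm (orbit x v g - orbit x v ga - (\<Sum>j=1..m. (K j b - K j a) *\<^sub>R orbit (C j) v g0)) \<le> \<epsilon> * (H b - H a)"
    if \<eta>: "\<eta> > 0" for \<eta>
  proof -
    have "uniformly_continuous_on {a..b} H" by (intro compact_uniformly_continuous H) simp
    then obtain \<delta> where \<delta>: "\<delta> > 0" "\<And>s t. s \<in> {a..b} \<Longrightarrow> t \<in> {a..b} \<Longrightarrow> dist t s < \<delta> \<Longrightarrow> dist (H t) (H s) < \<eta>"
      unfolding uniformly_continuous_on_def using \<eta> by metis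
    obtain N :: nat where N: "(b - a) / \<delta> < real N" using reals_Archimedean2 by blast
    have N0: "N > 0" using N ab \<delta>(1) by (cases "N = 0") (auto simp: field_simps)
    define \<tau> where "\<tau> k = a + real k * ((b - a) / real N)" for k
    have \<tau>0: "\<tau> 0 = a" and \<tau>N: "\<tau> N = b" using N0 by (auto simp: \<tau>_def)
    have \<tau>S: "\<tau> (Suc k) = \<tau> k + (b - a) / real N" for k
      unfolding \<tau>_def of_nat_Suc distrib_right by simp
    have \<tau>: "a \<le> \<tau> k" "\<tau> k \<le> \<tau> (Suc k)" for k
    proof -
      have q: "0 \<le> (b - a) / real N" using ab by simp
      show "\<tau> k \<le> \<tau> (Suc k)" unfolding \<tau>S using q by linarith
      show "a \<le> \<tau> k" unfolding \<tau>_def using mult_nonneg_nonneg[OF of_nat_0_le_iff[of k] q] by linarith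
    qed
    have \<tau>b: "\<tau> k \<le> b" if "k \<le> N" for k
    proof -
      have "real k * ((b - a) / real N) \<le> real N * ((b - a) / real N)"
        using ab that by (intro mult_right_mono) auto
      then show ?thesis using N0 by (simp add: \<tau>_def)
    qed
    define A where "A k = H (\<tau> (Suc k)) - H (\<tau> k)" for k
    have A: "0 \<le> A k" "A k \<le> \<eta>" if "k < N" for k
    proof -
      show "0 \<le> A k" using Hmono[OF \<tau>(1,2) \<tau>b] that by (simp add: A_def)
      have "dist (\<tau> (Suc k)) (\<tau> k) < \<delta>"
        using N N0 \<delta>(1) ab by (simp add: \<tau>S dist_real_def field_simps)
      then have "dist (H (\<tau> (Suc k))) (H (\<tau> k)) < \<eta>"
        using \<tau>[of k] \<tau>b[of "Suc k"] that by (intro \<delta>(2)) (auto intro: order_trans)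
      then show "A k \<le> \<eta>" by (simp add: A_def dist_real_def)
    qed
    define c where "c k j = K j (\<tau> (Suc k)) - K j (\<tau> k)" for k j
    define g where "g = rec_nat ga (\<lambda>k h. exp_prod X (c k) m h)"
    have gS: "g 0 = ga" "g (Suc k) = exp_prod X (c k) m (g k)" for k by (simp_all add: g_def)
    let ?h = "\<lambda>k. H (\<tau> k) - H a"
    \<comment> \<open>The second conjunct keeps the points where \<open>multi_step\<close> applies;
      the last is the Gronwall bound.\<close>
    have inv: "g k \<in> fst d \<and> norm (snd d (g k) - u a) \<le> M * ?h k \<and>
      norm (orbit x v (g k) - orbit x v ga - (\<Sum>j=1..m. (K j (\<tau> k) - K j a) *\<^sub>R orbit (C j) v g0)) \<le> \<epsilon> * ?h k \<and>
      norm (snd d (g k) - u (\<tau> k)) \<le> exp (\<Lambda> * ?h k) * (3 * \<Lambda> * M * \<eta> * ?h k)"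
      if "k \<le> N" for k
      using that
    proof (induction k)
      case 0
      then show ?case using ga by (simp add: gS \<tau>0)
    next
      case (Suc k)
      let ?w = "snd d (g k)" and ?w' = "snd d (g (Suc k))" and ?e = "norm (snd d (g k) - u (\<tau> k))"
      have k: "k < N" "k \<le> N" "Suc k \<le> N" using Suc.prems by auto
      have IH: "g k \<in> fst d" "norm (?w - u a) \<le> M * ?h k"
        "norm (orbit x v (g k) - orbit x v ga - (\<Sum>j=1..m. (K j (\<tau> k) - K j a) *\<^sub>R orbit (C j) v g0)) \<le> \<epsilon> * ?h k"
        "?e \<le> exp (\<Lambda> * ?h k) * (3 * \<Lambda> * M * \<eta> * ?h k)"
        using Suc.IH k by auto
      have hS: "?h (Suc k) = ?h k + A k" by (simp add: A_def)
      have hb: "?h (Suc k) \<le> H b - H a" using Hmono[OF \<tau>(1) \<tau>b[OF k(3)]] by simp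
      have h0: "0 \<le> ?h k" using Hmono[OF order_refl \<tau>(1) \<tau>b[OF k(2)]] by simp
      have Ak: "0 \<le> A k" "A k \<le> \<eta>" by (rule A[OF k(1)])+
      let ?S = "\<Sum>j=1..m. \<bar>c k j\<bar>"
      have S: "?S \<le> A k" unfolding c_def A_def by (rule K[OF \<tau>(1,2) \<tau>b[OF k(3)]])
      have S0: "0 \<le> ?S" by (simp add: sum_nonneg)
      have MS: "M * ?S \<le> M * A k" by (intro mult_left_mono S pos)
      have Mh: "M * ?h k + M * A k \<le> M * (H b - H a)"
        using mult_left_mono[OF hb, of M] pos unfolding hS by (simp add: distrib_left)
      have wg: "norm (?w - snd d g0) \<le> norm (?w - u a) + norm (u a - snd d g0)"
        using norm_triangle_ineq[of "?w - u a" "u a - snd d g0"] by simp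
      have "norm (?w - snd d g0) + M * ?S \<le> \<rho>"
        using wg IH(2) MS Mh small(1) by linarith
      moreover have "?S \<le> \<rho>" using S hb h0 small(2) unfolding hS by linarith
      ultimately have step: "g (Suc k) \<in> fst d" "norm (?w' - ?w) \<le> M * ?S"
        "norm (?w' - ?w - (\<Sum>j=1..m. c k j *\<^sub>R vf d (X j) ?w)) \<le> 2 * \<Lambda> * M * ?S\<^sup>2"
        "norm (orbit x v (g (Suc k)) - orbit x v (g k) - (\<Sum>j=1..m. c k j *\<^sub>R orbit (C j) v g0)) \<le> \<epsilon> * ?S"
        using multi_step[OF order_refl IH(1), of "c k"] unfolding gS by auto
      have "norm (?w' - u a) \<le> norm (?w' - ?w) + norm (?w - u a)"
        using norm_triangle_ineq[of "?w' - ?w" "?w - u a"] by simp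
      then have 2: "norm (?w' - u a) \<le> M * ?h (Suc k)"
        unfolding hS using step(2) IH(2) MS by (simp add: distrib_left)
      let ?o = "orbit x v" and ?c = "\<lambda>j. orbit (C j) v g0"
      have eq: "?o (g (Suc k)) - ?o ga - (\<Sum>j=1..m. (K j (\<tau> (Suc k)) - K j a) *\<^sub>R ?c j) =
        (?o (g (Suc k)) - ?o (g k) - (\<Sum>j=1..m. c k j *\<^sub>R ?c j))
        + (?o (g k) - ?o ga - (\<Sum>j=1..m. (K j (\<tau> k) - K j a) *\<^sub>R ?c j))"
        by (simp add: c_def scaleR_diff_left sum_subtractf)
      have "\<epsilon> * ?S \<le> \<epsilon> * A k" by (intro mult_left_mono S pos)
      then have 3: "norm (?o (g (Suc k)) - ?o ga - (\<Sum>j=1..m. (K j (\<tau> (Suc k)) - K j a) *\<^sub>R ?c j)) \<le> \<epsilon> * ?h (Suc k)"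
        unfolding eq hS using norm_triangle_mono[OF step(4) IH(3)] by (simp add: distrib_left)
      have uin: "u (\<tau> k) \<in> cball (snd d g0) r"
      proof -
        have "norm (u (\<tau> k) - u a) \<le> M * ?h k" by (rule u1[OF order_refl \<tau>(1) \<tau>b[OF k(2)]])
        moreover have "norm (u (\<tau> k) - snd d g0) \<le> norm (u (\<tau> k) - u a) + norm (u a - snd d g0)"
          using norm_triangle_ineq[of "u (\<tau> k) - u a" "u a - snd d g0"] by simp
        moreover have "0 \<le> M * A k" using pos Ak by simp
        ultimately have "norm (u (\<tau> k) - snd d g0) \<le> r" using Mh small(1) \<rho>r by linarith
        then show ?thesis by (simp add: dist_norm norm_minus_commute)
      qed
      have win: "?w \<in> cball (snd d g0) r"
      proof -
        have "0 \<le> M * A k" using pos Ak by simp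
        then have "norm (?w - snd d g0) \<le> r" using wg IH(2) Mh small(1) \<rho>r by linarith
        then show ?thesis by (simp add: dist_norm norm_minus_commute)
      qed
      let ?V = "\<lambda>u. \<Sum>j=1..m. c k j *\<^sub>R vf d (X j) u"
      have V: "norm (?V ?w - ?V (u (\<tau> k))) \<le> \<Lambda> * A k * ?e"
      proof -
        have "norm (?V ?w - ?V (u (\<tau> k))) \<le> (\<Sum>j=1..m. norm (c k j *\<^sub>R (vf d (X j) ?w - vf d (X j) (u (\<tau> k)))))"
          unfolding sum_subtractf[symmetric] scaleR_diff_right[symmetric] by (rule norm_sum)
        also have "\<dots> \<le> (\<Sum>j=1..m. \<bar>c k j\<bar> * (\<Lambda> * ?e))"
          unfolding norm_scaleR by (intro sum_mono mult_left_mono Lip win uin) auto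
        also have "\<dots> = ?S * (\<Lambda> * ?e)" by (simp add: sum_distrib_right)
        also have "\<dots> \<le> A k * (\<Lambda> * ?e)" using pos by (intro mult_right_mono S) auto
        finally show ?thesis by (simp add: mult_ac)
      qed
      have U: "norm (u (\<tau> (Suc k)) - u (\<tau> k) - ?V (u (\<tau> k))) \<le> \<Lambda> * M * (A k)\<^sup>2"
        unfolding c_def A_def by (rule u2[OF \<tau>(1,2) \<tau>b[OF k(3)]])
      have S2: "2 * \<Lambda> * M * ?S\<^sup>2 \<le> 2 * \<Lambda> * M * (A k)\<^sup>2"
        using pos S S0 by (intro mult_left_mono power_mono) auto
      have eq: "?w' - u (\<tau> (Suc k)) = (?w' - ?w - ?V ?w) - (u (\<tau> (Suc k)) - u (\<tau> k) - ?V (u (\<tau> k)))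
        + (?w - u (\<tau> k)) + (?V ?w - ?V (u (\<tau> k)))" by simp
      have "norm (?w' - u (\<tau> (Suc k))) \<le> norm (?w' - ?w - ?V ?w) + norm (u (\<tau> (Suc k)) - u (\<tau> k) - ?V (u (\<tau> k)))
        + ?e + norm (?V ?w - ?V (u (\<tau> k)))"
        unfolding eq by (intro norm_triangle_le add_mono norm_triangle_ineq4 order_refl)
      also have "\<dots> \<le> 2 * \<Lambda> * M * (A k)\<^sup>2 + \<Lambda> * M * (A k)\<^sup>2 + ?e + \<Lambda> * A k * ?e"
        using step(3) S2 U V by linarith
      also have "\<dots> = (1 + \<Lambda> * A k) * ?e + 3 * \<Lambda> * M * A k * A k"
        by (simp add: power2_eq_square algebra_simps)
      also have "\<dots> \<le> exp (\<Lambda> * A k) * (exp (\<Lambda> * ?h k) * (3 * \<Lambda> * M * \<eta> * ?h k))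
          + exp (\<Lambda> * ?h (Suc k)) * (3 * \<Lambda> * M * \<eta> * A k)"
      proof (rule add_mono)
        show "(1 + \<Lambda> * A k) * ?e \<le> exp (\<Lambda> * A k) * (exp (\<Lambda> * ?h k) * (3 * \<Lambda> * M * \<eta> * ?h k))"
          using exp_ge_add_one_self IH(4) by (intro mult_mono) auto
        \<comment> \<open>One factor \<open>A k\<close> is replaced by the mesh bound
          \<open>\<eta>\<close>; the other sums to the total variation.\<close>
        have "3 * \<Lambda> * M * A k * A k \<le> 3 * \<Lambda> * M * \<eta> * A k"
          using Ak pos by (intro mult_right_mono mult_left_mono) auto
        also have "\<dots> \<le> exp (\<Lambda> * ?h (Suc k)) * (3 * \<Lambda> * M * \<eta> * A k)"
          using pos h0 Ak \<eta> mult_right_mono[of 1 "exp (\<Lambda> * ?h (Suc k))" "3 * \<Lambda> * M * \<eta> * A k"]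
          unfolding hS by simp
        finally show "3 * \<Lambda> * M * A k * A k \<le> exp (\<Lambda> * ?h (Suc k)) * (3 * \<Lambda> * M * \<eta> * A k)" .
      qed
      also have "\<dots> = exp (\<Lambda> * ?h (Suc k)) * (3 * \<Lambda> * M * \<eta> * ?h (Suc k))"
      proof -
        have "exp (\<Lambda> * (?h k + A k)) = exp (\<Lambda> * A k) * exp (\<Lambda> * ?h k)"
          by (simp only: distrib_left exp_add mult.commute)
        then show ?thesis unfolding hS by (simp add: algebra_simps)
      qed
      finally show ?case using step(1) 2 3 by blast
    qed
    from inv[OF order_refl] show ?thesis
      by (intro bexI[of _ "g N"]) (auto simp: \<tau>N E_def mult_ac)
  qed
  have "\<forall>n. \<exists>g. g \<in> fst d \<and> norm (snd d g - u b) \<le> E * (1 / real (Suc n)) \<and>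
    norm (orbit x v g - orbit x v ga - (\<Sum>j=1..m. (K j b - K j a) *\<^sub>R orbit (C j) v g0)) \<le> \<epsilon> * (H b - H a)"
  proof
    fix n
    have "0 < 1 / real (Suc n)" by simp
    from main[OF this] show "\<exists>g. g \<in> fst d \<and> norm (snd d g - u b) \<le> E * (1 / real (Suc n)) \<and>
      norm (orbit x v g - orbit x v ga - (\<Sum>j=1..m. (K j b - K j a) *\<^sub>R orbit (C j) v g0)) \<le> \<epsilon> * (H b - H a)"
      by blast
  qed
  from choice[OF this] obtain g where "\<forall>n. g n \<in> fst d \<and> norm (snd d (g n) - u b) \<le> E * (1 / real (Suc n)) \<and>
    norm (orbit x v (g n) - orbit x v ga - (\<Sum>j=1..m. (K j b - K j a) *\<^sub>R orbit (C j) v g0)) \<le> \<epsilon> * (H b - H a)" ..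
  then have g: "\<And>n. g n \<in> fst d" "\<And>n. norm (snd d (g n) - u b) \<le> E * (1 / real (Suc n))"
    "\<And>n. norm (orbit x v (g n) - orbit x v ga - (\<Sum>j=1..m. (K j b - K j a) *\<^sub>R orbit (C j) v g0)) \<le> \<epsilon> * (H b - H a)"
    by blast+
  have "(\<lambda>n. E * (1 / real (Suc n))) \<longlonglongrightarrow> E * 0"
    by (intro tendsto_mult tendsto_const) (rule LIMSEQ_Suc[OF lim_1_over_n])
  then have E: "(\<lambda>n. E * (1 / real (Suc n))) \<longlonglongrightarrow> 0" by (simp only: mult_zero_right)
  have "(\<lambda>n. snd d (g n) - u b) \<longlonglongrightarrow> 0"
    by (rule Lim_null_comparison[OF always_eventually E]) (use g(2) in blast)
  then have "(\<lambda>n. snd d (g n)) \<longlonglongrightarrow> snd d gb" by (simp add: LIM_zero_iff gb)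
  then have "(\<lambda>n. chart_inv d (snd d (g n))) \<longlonglongrightarrow> chart_inv d (snd d gb)"
    by (rule isCont_tendsto_compose[OF chart_inv_isCont[OF d imageI[OF gb(1)]]])
  then have "g \<longlonglongrightarrow> gb" by (simp add: chart_inv_snd[OF d] g(1) gb(1))
  then have "(\<lambda>n. orbit x v (g n)) \<longlonglongrightarrow> orbit x v gb" by (rule isCont_tendsto_compose[OF orbit_isCont])
  then have "(\<lambda>n. norm (orbit x v (g n) - orbit x v ga - (\<Sum>j=1..m. (K j b - K j a) *\<^sub>R orbit (C j) v g0)))
    \<longlonglongrightarrow> norm (orbit x v gb - orbit x v ga - (\<Sum>j=1..m. (K j b - K j a) *\<^sub>R orbit (C j) v g0))"
    by (intro tendsto_intros)
  then show ?thesis using g(3) by (intro LIMSEQ_le_const2) auto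
qed

end

section \<open>Horizontal curves\<close>

text \<open>Pair the vector \<open>c\<close> of integrals with itself: Cauchy-Schwarz under the
  integral bounds the square of its norm by its norm times the integral of \<open>n\<close>. This
  moves the Euclidean norm inside the integral, where the length of a curve has it.\<close>

lemma L2_set_integral_le:
  fixes f :: "nat \<Rightarrow> real \<Rightarrow> real"
  assumes f: "\<And>j. j \<in> J \<Longrightarrow> f j integrable_on S" and n: "n integrable_on S"
    and le: "\<And>t. t \<in> S \<Longrightarrow> L2_set (\<lambda>j. f j t) J \<le> n t"
  shows "L2_set (\<lambda>j. integral S (f j)) J \<le> integral S n"
\<comment> \<open>For infinite \<open>J\<close>, or if this norm vanishes, the left-hand side is 0;
  otherwise one may divide by it.\<close>
proof (cases "finite J \<and> L2_set (\<lambda>j. integral S (f j)) J \<noteq> 0")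
  case True
  define c where "c = (\<lambda>j. integral S (f j))"
  have L: "L2_set c J \<noteq> 0" using True by (simp add: c_def)
  have I: "((\<lambda>t. \<Sum>j\<in>J. c j * f j t) has_integral (\<Sum>j\<in>J. c j * c j)) S"
    using True f unfolding c_def
    by (intro has_integral_sum has_integral_mult_right integrable_integral) auto
  have "(\<Sum>j\<in>J. c j * c j) \<le> L2_set c J * integral S n"
  proof (rule has_integral_le[OF I])
    show "((\<lambda>t. L2_set c J * n t) has_integral L2_set c J * integral S n) S"
      by (intro has_integral_mult_right integrable_integral n)
    fix t assume t: "t \<in> S"
    have "(\<Sum>j\<in>J. c j * f j t) \<le> (\<Sum>j\<in>J. \<bar>c j\<bar> * \<bar>f j t\<bar>)"
      by (intro sum_mono) (simp flip: abs_mult)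
    also have "\<dots> \<le> L2_set c J * L2_set (\<lambda>j. f j t) J" by (rule L2_set_mult_ineq)
    also have "\<dots> \<le> L2_set c J * n t" by (intro mult_left_mono le t L2_set_nonneg)
    finally show "(\<Sum>j\<in>J. c j * f j t) \<le> L2_set c J * n t" .
  qed
  moreover have "(\<Sum>j\<in>J. c j * c j) = L2_set c J * L2_set c J"
    by (simp add: L2_set_def sum_nonneg power2_eq_square)
  moreover have "0 < L2_set c J" using L L2_set_nonneg[of c J] by linarith
  ultimately show ?thesis unfolding c_def using mult_left_le_imp_le by metis
next
  case False
  have "0 \<le> n t" if "t \<in> S" for t using le[OF that] L2_set_nonneg[of "\<lambda>j. f j t" J] by linarith
  then have "0 \<le> integral S n" by (rule Henstock_Kurzweil_Integration.integral_nonneg[OF n])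
  then show ?thesis using False by auto
qed

context lie_group_rep
begin

text \<open>The order of choices matters: \<open>r\<close> is set by the Lipschitz property and the
  oscillation of the orbits, then \<open>\<Lambda>\<close> and \<open>M\<close> on that ball, and
  last the escape radius, from joint continuity of (u, t) \<mapsto>
  \<open>chart_inv d u + flow (X j) t\<close> at the centre and time 0.\<close>

lemma adapted_chart_exists:
  assumes comm: "\<And>j. j \<in> {1..m} \<Longrightarrow> is_bounded_commutator \<A> c0 \<pi> (X j) x (C j)"
    and d: "d \<in> \<A>" and g0: "g0 \<in> fst d" and \<epsilon>: "\<epsilon> > 0"
  obtains r \<rho> \<Lambda> M where "adapted_chart \<A> c0 \<pi> m X x C v d g0 r \<rho> \<Lambda> M \<epsilon>"
proof -
  let ?u0 = "snd d g0"
  have u0: "?u0 \<in> im d" using g0 by simp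
  define Lp where "Lp j r \<Lambda> \<longleftrightarrow> (\<forall>u\<in>cball ?u0 r. \<forall>u'\<in>cball ?u0 r. norm (vf d (X j) u - vf d (X j) u') \<le> \<Lambda> * norm (u - u'))"
    for j r \<Lambda>
  define Q where "Q j r \<longleftrightarrow> (\<exists>\<Lambda>\<ge>0. Lp j r \<Lambda>) \<and>
      (\<forall>g\<in>fst d. snd d g \<in> cball ?u0 r \<longrightarrow> norm (orbit (C j) v g - orbit (C j) v g0) \<le> \<epsilon>)" for j r
  have "\<exists>r>0. \<forall>j\<in>{1..m}. Q j r"
  proof (rule finite_uniform_radius)
    show "Q j r'" if "Q j r" "0 < r'" "r' \<le> r" for j r r'
      using that(1) subset_cball[OF that(3), of ?u0] unfolding Q_def Lp_def by blast
    fix j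
    obtain r1 \<Lambda> where r1: "r1 > 0" "\<Lambda> \<ge> 0"
      "\<And>u v. u \<in> cball ?u0 r1 \<Longrightarrow> v \<in> cball ?u0 r1 \<Longrightarrow> norm (vf d (X j) u - vf d (X j) v) \<le> \<Lambda> * norm (u - v)"
      using vf_locally_Lipschitz[OF d u0, of "X j"] by metis
    have "isCont (\<lambda>u. orbit (C j) v (chart_inv d u)) ?u0"
      by (rule isCont_o2[OF chart_inv_isCont[OF d u0] orbit_isCont])
    then obtain e where e: "e > 0" "\<And>u. dist u ?u0 < e \<Longrightarrow>
        dist (orbit (C j) v (chart_inv d u)) (orbit (C j) v (chart_inv d ?u0)) < \<epsilon>"
      using \<epsilon> unfolding continuous_at_eps_delta by metis
    have osc: "norm (orbit (C j) v g - orbit (C j) v g0) \<le> \<epsilon>" if "g \<in> fst d" "snd d g \<in> cball ?u0 (e / 2)" for g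
      using e(1) e(2)[of "snd d g"] that g0 by (simp add: chart_inv_snd[OF d] dist_norm norm_minus_commute)
    have "Q j (min r1 (e / 2))"
      unfolding Q_def Lp_def using r1(2,3) osc by (intro conjI exI[of _ \<Lambda>]) auto
    then show "\<exists>r>0. Q j r" using r1(1) e(1) by (intro exI[of _ "min r1 (e / 2)"]) auto
  qed simp
  then obtain r1 where r1: "r1 > 0" "\<And>j. j \<in> {1..m} \<Longrightarrow> Q j r1" by blast
  obtain r2 where r2: "r2 > 0" "cball ?u0 r2 \<subseteq> im d"
    using open_contains_cball_eq[OF chart_open(2)[OF d]] u0 by blast
  define r where "r = min r1 r2"
  have r: "r > 0" "cball ?u0 r \<subseteq> im d" "cball ?u0 r \<subseteq> cball ?u0 r1"
    using r1(1) r2 unfolding r_def by auto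
  have "\<forall>j\<in>{1..m}. \<exists>\<Lambda>\<ge>0. Lp j r1 \<Lambda>" using r1(2) unfolding Q_def by blast
  from bchoice[OF this] obtain L where L: "\<And>j. j \<in> {1..m} \<Longrightarrow> 0 \<le> L j \<and> Lp j r1 (L j)" by blast
  \<comment> \<open>The sum of the nonnegative constants dominates each of them and also makes sense
    for \<open>m = 0\<close>.\<close>
  define \<Lambda> where "\<Lambda> = (\<Sum>j=1..m. L j)"
  have L\<Lambda>: "L j \<le> \<Lambda>" if "j \<in> {1..m}" for j
    unfolding \<Lambda>_def by (rule member_le_sum) (use that L in auto)
  have \<Lambda>0: "0 \<le> \<Lambda>" unfolding \<Lambda>_def using L by (intro sum_nonneg) auto
  have Lip: "norm (vf d (X j) u - vf d (X j) u') \<le> \<Lambda> * norm (u - u')"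
    if j: "j \<in> {1..m}" and u: "u \<in> cball ?u0 r" "u' \<in> cball ?u0 r" for j u u'
  proof -
    have "norm (vf d (X j) u - vf d (X j) u') \<le> L j * norm (u - u')"
      using L[OF j] u r(3) unfolding Lp_def by blast
    also have "\<dots> \<le> \<Lambda> * norm (u - u')" by (intro mult_right_mono L\<Lambda> j) auto
    finally show ?thesis .
  qed
  define M where "M = (\<Sum>j=1..m. norm (vf d (X j) ?u0)) + \<Lambda> * r"
  have bd: "norm (vf d (X j) u) \<le> M" if j: "j \<in> {1..m}" and u: "u \<in> cball ?u0 r" for j u
  proof -
    have "norm (vf d (X j) u) \<le> norm (vf d (X j) ?u0) + norm (vf d (X j) u - vf d (X j) ?u0)"
      using norm_triangle_ineq[of "vf d (X j) ?u0" "vf d (X j) u - vf d (X j) ?u0"] by simp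
    also have "norm (vf d (X j) u - vf d (X j) ?u0) \<le> \<Lambda> * norm (u - ?u0)"
      by (rule Lip[OF j u]) (use r in auto)
    also have "\<dots> \<le> \<Lambda> * r"
      using u \<Lambda>0 by (intro mult_left_mono) (auto simp: dist_norm norm_minus_commute)
    also have "norm (vf d (X j) ?u0) \<le> (\<Sum>j=1..m. norm (vf d (X j) ?u0))"
      by (rule member_le_sum) (use j in auto)
    finally show ?thesis by (simp add: M_def)
  qed
  have M0: "0 \<le> M" unfolding M_def using \<Lambda>0 r(1) by (intro add_nonneg_nonneg sum_nonneg mult_nonneg_nonneg) auto
  define P where "P j s \<longleftrightarrow> (\<forall>g\<in>fst d. snd d g \<in> cball ?u0 s \<longrightarrow> (\<forall>t. \<bar>t\<bar> \<le> s \<longrightarrow>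
      g + flow (X j) t \<in> fst d \<and> snd d (g + flow (X j) t) \<in> cball ?u0 r))" for j s
  have "\<exists>s>0. \<forall>j\<in>{1..m}. P j s"
  proof (rule finite_uniform_radius)
    show "P j s'" if "P j s" "0 < s'" "s' \<le> s" for j s s'
      using that(1) subset_cball[OF that(3), of ?u0] order_trans[OF _ that(3)] unfolding P_def by blast
    fix j
    let ?F = "\<lambda>p. chart_inv d (fst p) + flow (X j) (snd p)"
    have "isCont ?F (?u0, 0)"
      unfolding isCont_def
    proof (rule tendsto_add)
      have "(fst \<longlongrightarrow> ?u0) (at (?u0, 0::real))" using tendsto_fst[OF tendsto_ident_at, of "(?u0, 0::real)" UNIV] by simp
      from isCont_tendsto_compose[OF chart_inv_isCont[OF d u0] this]
      show "((\<lambda>p. chart_inv d (fst p)) \<longlongrightarrow> chart_inv d (fst (?u0, 0::real))) (at (?u0, 0::real))" by simp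
      have "(snd \<longlongrightarrow> (0::real)) (at (?u0, 0::real))" using tendsto_snd[OF tendsto_ident_at, of "(?u0, 0::real)" UNIV] by simp
      from isCont_tendsto_compose[OF flow_continuous this]
      show "((\<lambda>p. flow (X j) (snd p)) \<longlongrightarrow> flow (X j) (snd (?u0, 0))) (at (?u0, 0))" by simp
    qed
    moreover have "isCont (snd d) (?F (?u0, 0))"
      using chart_isCont[OF d g0] g0 by (simp add: chart_inv_snd[OF d] flow)
    ultimately have sF: "isCont (\<lambda>p. snd d (?F p)) (?u0, 0)" by (rule isCont_o2)
    have F0: "?F (?u0, 0) = g0" using g0 by (simp add: chart_inv_snd[OF d] flow)
    have tF: "(?F \<longlongrightarrow> g0) (nhds (?u0, 0))"
      using \<open>isCont ?F (?u0, 0)\<close> F0 tendsto_at_iff_tendsto_nhds[of ?F "(?u0, 0)"]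
      unfolding isCont_def by metis
    have tsF: "((\<lambda>p. snd d (?F p)) \<longlongrightarrow> ?u0) (nhds (?u0, 0))"
      using sF F0 tendsto_at_iff_tendsto_nhds[of "\<lambda>p. snd d (?F p)" "(?u0, 0)"]
      unfolding isCont_def by metis
    have "\<forall>\<^sub>F p in nhds (?u0, 0). ?F p \<in> fst d"
      by (rule topological_tendstoD[OF tF chart_open(1)[OF d] g0])
    moreover have "\<forall>\<^sub>F p in nhds (?u0, 0). snd d (?F p) \<in> ball ?u0 r"
      by (rule topological_tendstoD[OF tsF open_ball]) (simp add: r(1))
    ultimately have "\<forall>\<^sub>F p in nhds (?u0, 0). ?F p \<in> fst d \<and> snd d (?F p) \<in> ball ?u0 r"
      by (rule eventually_conj)
    then obtain \<delta> where \<delta>: "\<delta> > 0" "\<And>p. dist p (?u0, 0) < \<delta> \<Longrightarrow> ?F p \<in> fst d \<and> snd d (?F p) \<in> ball ?u0 r"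
      unfolding eventually_nhds_metric by metis
    \<comment> \<open>A third of \<open>\<delta>\<close> for the point and a third for the time keep
      the pair at distance less than \<open>\<delta>\<close>.\<close>
    have "P j (\<delta> / 3)"
      unfolding P_def
    proof (intro ballI impI allI)
      fix g t assume g: "g \<in> fst d" "snd d g \<in> cball ?u0 (\<delta> / 3)" and t: "\<bar>t\<bar> \<le> \<delta> / 3"
      have "dist (snd d g, t) (?u0, 0) \<le> dist (snd d g) ?u0 + dist t 0"
        unfolding dist_Pair_Pair by (rule sqrt_sum_squares_le_sum) auto
      also have "\<dots> < \<delta>" using g t \<delta>(1) by (simp add: dist_commute)
      finally have "dist (snd d g, t) (?u0, 0) < \<delta>" .
      from \<delta>(2)[OF this] show "g + flow (X j) t \<in> fst d \<and> snd d (g + flow (X j) t) \<in> cball ?u0 r"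
        using g by (simp add: chart_inv_snd[OF d])
    qed
    then show "\<exists>s>0. P j s" using \<delta>(1) by (intro exI[of _ "\<delta> / 3"]) auto
  qed simp
  then obtain s where s: "s > 0" "\<And>j. j \<in> {1..m} \<Longrightarrow> P j s" by blast
  have "adapted_chart \<A> c0 \<pi> m X x C v d g0 r (min s r) \<Lambda> M \<epsilon>"
  proof unfold_locales
    show "norm (orbit (C j) v g - orbit (C j) v g0) \<le> \<epsilon>"
      if "j \<in> {1..m}" "g \<in> fst d" "snd d g \<in> cball ?u0 r" for j g
      using r1(2)[OF that(1)] that r(3) unfolding Q_def by blast
    show "g + flow (X j) t \<in> fst d \<and> snd d (g + flow (X j) t) \<in> cball ?u0 r"
      if "j \<in> {1..m}" "g \<in> fst d" "snd d g \<in> cball ?u0 (min s r)" "\<bar>t\<bar> \<le> min s r" for j g t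
      using s(2)[OF that(1)] that unfolding P_def by simp
  qed (use comm d r s \<Lambda>0 M0 \<epsilon> Lip bd in auto)
  then show ?thesis by (rule that)
qed

text \<open>The estimate of \<open>approximation\<close> holds only on short intervals, with error
  \<open>\<epsilon>\<close> times the integral of \<open>h\<close>. Since this error is additive in
  the interval, bisection by \<open>Bolzano\<close> extends the estimate to \<open>{p..q}\<close>,
  and \<open>\<epsilon>\<close> is arbitrarily small.\<close>

lemma smooth_piece_bound:
  fixes \<alpha> :: "nat \<Rightarrow> real \<Rightarrow> real"
  assumes comm: "\<And>j. j \<in> {1..m} \<Longrightarrow> is_bounded_commutator \<A> c0 \<pi> (X j) x (C j)"
    and C: "\<And>a y. norm (\<Sum>j=1..m. a j *\<^sub>R C j y) \<le> L2_set a {1..m} * norm y"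
    and \<alpha>: "\<And>j. j \<in> {1..m} \<Longrightarrow> \<alpha> j absolutely_integrable_on {p..q}"
    and n: "n integrable_on {p..q}" "\<And>t. t \<in> {p..q} \<Longrightarrow> L2_set (\<lambda>j. \<alpha> j t) {1..m} \<le> n t"
    and smooth: "smooth_curve_on \<A> \<gamma> {p..q}"
    and N: "negligible N" "\<And>t. t \<in> {p<..<q} - N \<Longrightarrow> left_velocity \<A> c0 \<gamma> UNIV t (\<Sum>j=1..m. \<alpha> j t *\<^sub>R X j)"
    and pq: "p \<le> q"
  shows "norm (orbit x v (\<gamma> q) - orbit x v (\<gamma> p)) \<le> norm v * integral {p..q} n"
proof (rule field_le_epsilon)
  fix e :: real assume e: "e > 0"
  define h where "h t = (\<Sum>j=1..m. \<bar>\<alpha> j t\<bar>)" for t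
  have \<alpha>i: "\<alpha> j integrable_on {p..q}" "(\<lambda>t. \<bar>\<alpha> j t\<bar>) integrable_on {p..q}" if "j \<in> {1..m}" for j
    using \<alpha>[OF that] by (auto simp: absolutely_integrable_on_def)
  have hi: "h integrable_on {p..q}"
    unfolding h_def[abs_def] by (intro integrable_sum \<alpha>i) auto
  have h0: "0 \<le> h t" for t by (simp add: h_def sum_nonneg)
  define \<epsilon> where "\<epsilon> = e / (integral {p..q} h + 1)"
  have ih0: "0 \<le> integral {p..q} h" using h0 by (intro Henstock_Kurzweil_Integration.integral_nonneg hi)
  then have \<epsilon>: "\<epsilon> > 0" "\<epsilon> * integral {p..q} h \<le> e" using e by (auto simp: \<epsilon>_def field_simps)
  have sub: "f integrable_on {a..b}" if "f integrable_on {p..q}" "p \<le> a" "b \<le> q" for f :: "real \<Rightarrow> real" and a b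
    by (rule integrable_on_subinterval[OF that(1)]) (use that in auto)
  have comb: "integral {a..c} f = integral {a..b} f + integral {b..c} f"
    if "f integrable_on {p..q}" "p \<le> a" "a \<le> b" "b \<le> c" "c \<le> q" for f :: "real \<Rightarrow> real" and a b c
    using Henstock_Kurzweil_Integration.integral_combine[OF that(3,4) sub[OF that(1,2,5)]] by simp
  \<comment> \<open>\<open>Bolzano\<close> also asks about short intervals around \<open>z\<close>
    that leave \<open>{p..q}\<close>; the premise makes \<open>P\<close> vacuous for them.\<close>
  define P where "P a b \<longleftrightarrow> (p \<le> a \<and> b \<le> q \<longrightarrow>
    norm (orbit x v (\<gamma> b) - orbit x v (\<gamma> a)) \<le> norm v * integral {a..b} n + \<epsilon> * integral {a..b} h)" for a b
  have "P p q"
    using pq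
  proof (induct rule: Bolzano)
    case (trans a b c)
    show ?case
      unfolding P_def
    proof
      assume ac: "p \<le> a \<and> c \<le> q"
      have "norm (orbit x v (\<gamma> c) - orbit x v (\<gamma> a)) \<le>
          norm (orbit x v (\<gamma> c) - orbit x v (\<gamma> b)) + norm (orbit x v (\<gamma> b) - orbit x v (\<gamma> a))"
        using norm_triangle_ineq[of "orbit x v (\<gamma> c) - orbit x v (\<gamma> b)" "orbit x v (\<gamma> b) - orbit x v (\<gamma> a)"] by simp
      also have "\<dots> \<le> (norm v * integral {b..c} n + \<epsilon> * integral {b..c} h) + (norm v * integral {a..b} n + \<epsilon> * integral {a..b} h)"
        using trans ac unfolding P_def by (intro add_mono) auto
      also have "\<dots> = norm v * integral {a..c} n + \<epsilon> * integral {a..c} h"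
        using comb[OF n(1), of a b c] comb[OF hi, of a b c] trans(3,4) ac by (simp add: algebra_simps)
      finally show "norm (orbit x v (\<gamma> c) - orbit x v (\<gamma> a)) \<le> norm v * integral {a..c} n + \<epsilon> * integral {a..c} h" .
    qed
  next
    case (local z)
    obtain d where d: "d \<in> \<A>" "\<gamma> z \<in> fst d" by (rule chart_cover)
    have z: "z \<in> {p..q}" using local by simp
    obtain \<delta>1 f where \<delta>1: "\<delta>1 > 0" and fs: "smooth_on f {z - \<delta>1<..<z + \<delta>1}"
      and f: "\<And>s. s \<in> {p..q} \<inter> {z - \<delta>1<..<z + \<delta>1} \<Longrightarrow> \<gamma> s \<in> fst d \<and> snd d (\<gamma> s) = f s"
      using smooth z d unfolding smooth_curve_on_def by metis
    let ?I = "{z - \<delta>1<..<z + \<delta>1}"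
    have "Ck_on (Suc 0) f ?I" using fs unfolding smooth_on_def by blast
    then have fder: "(f has_vector_derivative vector_derivative f (at t)) (at t)" if "t \<in> ?I" for t
      using that by (simp add: vector_derivative_works)
    have fz: "snd d (\<gamma> z) = f z" using f[of z] z \<delta>1 by auto
    obtain r \<rho> \<Lambda> M where ac: "adapted_chart \<A> c0 \<pi> m X x C v d (\<gamma> z) r \<rho> \<Lambda> M \<epsilon>"
      using adapted_chart_exists[of m X x C d "\<gamma> z" \<epsilon> v] comm d \<epsilon>(1) by metis
    interpret ac: adapted_chart \<A> c0 \<pi> m X x C v d "\<gamma> z" r \<rho> \<Lambda> M \<epsilon> by (rule ac)
    define H where "H t = integral {p..t} h" for t
    have Hc: "continuous_on {p..q} H"
      unfolding H_def by (rule indefinite_integral_continuous_1[OF hi])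
    have Hd: "H t - H s = integral {s..t} h" if "p \<le> s" "s \<le> t" "t \<le> q" for s t
      using comb[OF hi order_refl that] by (simp add: H_def)
    \<comment> \<open>The budget \<open>\<rho>\<close> is split in two: one half for the distance of
      \<open>f a\<close> from the centre, the other for the motion \<open>M * (H b - H a)\<close>,
      where \<open>H\<close> increases by at most \<open>2 * \<eta>\<close>.\<close>
    define \<eta> where "\<eta> = \<rho> / (4 * (M + 1))"
    have \<eta>: "\<eta> > 0" "M * (2 * \<eta>) \<le> \<rho> / 2" "2 * \<eta> \<le> \<rho>"
      using ac.pos by (auto simp: \<eta>_def field_simps)
    have "isCont f z" using fder[of z] \<delta>1 by (auto intro: has_vector_derivative_continuous)
    then obtain \<delta>2 where \<delta>2: "\<delta>2 > 0" "\<And>t. dist t z < \<delta>2 \<Longrightarrow> dist (f t) (f z) < \<rho> / 2"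
      using ac.pos(2) unfolding continuous_at_eps_delta by (metis half_gt_zero)
    obtain \<delta>3 where \<delta>3: "\<delta>3 > 0" "\<And>t. t \<in> {p..q} \<Longrightarrow> dist t z < \<delta>3 \<Longrightarrow> dist (H t) (H z) < \<eta>"
      using Hc z \<eta>(1) unfolding continuous_on_iff by metis
    define \<delta> where "\<delta> = min \<delta>1 (min \<delta>2 \<delta>3)"
    have "P a b" if ab: "a \<le> z" "z \<le> b" "b - a < \<delta>" for a b
      unfolding P_def
    proof
      assume pqab: "p \<le> a \<and> b \<le> q"
      have near: "t \<in> {p..q} \<inter> ?I" "dist t z < \<delta>2" "dist t z < \<delta>3" if "t \<in> {a..b}" for t
        using that ab pqab by (auto simp: \<delta>_def dist_real_def)
      have ball: "norm (f t - f z) \<le> \<rho> / 2" if "t \<in> {a..b}" for t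
        using \<delta>2(2)[OF near(2)[OF that]] by (simp add: dist_norm)
      have cb: "f t \<in> cball (snd d (\<gamma> z)) r" if "t \<in> {a..b}" for t
        using ball[OF that] ac.\<rho>r ac.pos(2) by (simp add: fz dist_norm norm_minus_commute)
      have "dist (H a) (H z) < \<eta>" "dist (H b) (H z) < \<eta>"
        using near ab z pqab by (auto intro!: \<delta>3(2))
      then have Hab: "H b - H a \<le> 2 * \<eta>" by (auto simp: dist_real_def)
      define K where "K j t = integral {p..t} (\<alpha> j)" for j t
      have Kd: "K j t - K j s = integral {s..t} (\<alpha> j)" if "p \<le> s" "s \<le> t" "t \<le> q" "j \<in> {1..m}" for s t j
        using comb[OF \<alpha>i(1)[OF that(4)] order_refl that(1-3)] by (simp add: K_def)
      let ?V = "\<lambda>t. \<Sum>j=1..m. \<alpha> j t *\<^sub>R vf d (X j) (f t)"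
      \<comment> \<open>The local extension \<open>f\<close> is differentiable also at
        \<open>p\<close> and \<open>q\<close>, so the fundamental theorem applies up to the
        boundary, and off a null set its derivative is the controlled field. The endpoints are
        discarded because the velocity is known only at interior times.\<close>
      have fi: "(?V has_integral (f t - f s)) {s..t}" if st: "a \<le> s" "s \<le> t" "t \<le> b" for s t
      proof (rule has_integral_spike[of "N \<union> {s, t}"])
        show "negligible (N \<union> {s, t})" using N(1) by simp
        show "((\<lambda>\<tau>. vector_derivative f (at \<tau>)) has_integral (f t - f s)) {s..t}"
          using near st by (intro fundamental_theorem_of_calculus has_vector_derivative_at_within[OF fder]) auto
        fix \<tau> assume \<tau>: "\<tau> \<in> {s..t} - (N \<union> {s, t})"
        then have \<tau>2: "\<tau> \<in> {p<..<q} - N" "\<tau> \<in> {a..b}" using st pqab by auto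
        have \<gamma>\<tau>: "\<gamma> \<tau> \<in> fst d" "snd d (\<gamma> \<tau>) = f \<tau>" using f near(1)[OF \<tau>2(2)] by auto
        have "((\<lambda>s. snd d (\<gamma> s)) has_vector_derivative vf d (\<Sum>j=1..m. \<alpha> j \<tau> *\<^sub>R X j) (snd d (\<gamma> \<tau>))) (at \<tau>)"
          by (rule left_velocity_chart[OF N(2)[OF \<tau>2(1)] d(1) \<gamma>\<tau>(1)])
        then have "(f has_vector_derivative vf d (\<Sum>j=1..m. \<alpha> j \<tau> *\<^sub>R X j) (snd d (\<gamma> \<tau>))) (at \<tau>)"
          by (rule has_vector_derivative_transform_within_open[where S = "{p<..<q} \<inter> ?I"])
            (use \<tau>2 near f in auto)
        then have "vector_derivative f (at \<tau>) = vf d (\<Sum>j=1..m. \<alpha> j \<tau> *\<^sub>R X j) (f \<tau>)"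
          by (simp add: vector_derivative_at \<gamma>\<tau>)
        also have "\<dots> = ?V \<tau>" using \<gamma>\<tau> by (intro vf_add_scale d) force+
        finally show "?V \<tau> = vector_derivative f (at \<tau>)" by simp
      qed
      have "norm (orbit x v (\<gamma> b) - orbit x v (\<gamma> a) - (\<Sum>j=1..m. (K j b - K j a) *\<^sub>R orbit (C j) v (\<gamma> z))) \<le> \<epsilon> * (H b - H a)"
      proof (rule ac.approximation)
        show "a \<le> b" using ab by simp
        show "continuous_on {a..b} H" by (rule continuous_on_subset[OF Hc]) (use pqab in auto)
        show "\<gamma> a \<in> fst d" "snd d (\<gamma> a) = f a" "\<gamma> b \<in> fst d" "snd d (\<gamma> b) = f b"
          using f near(1)[of a] near(1)[of b] ab by auto
        have "M * (H b - H a) \<le> M * (2 * \<eta>)" by (intro mult_left_mono Hab ac.pos)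
        then show "norm (f a - snd d (\<gamma> z)) + M * (H b - H a) \<le> \<rho>"
          using ball[of a] \<eta>(2) ab unfolding fz by auto
        show "H b - H a \<le> \<rho>" using Hab \<eta>(3) by linarith
        fix s t assume st: "a \<le> s" "s \<le> t" "t \<le> b"
        then have st': "p \<le> s" "s \<le> t" "t \<le> q" and sub': "{s..t} \<subseteq> {a..b}" using pqab by auto
        have hst: "h integrable_on {s..t}" by (rule sub[OF hi st'(1,3)])
        have "(\<Sum>j=1..m. \<bar>K j t - K j s\<bar>) \<le> (\<Sum>j=1..m. integral {s..t} (\<lambda>t. \<bar>\<alpha> j t\<bar>))"
        proof (rule sum_mono)
          fix j assume j: "j \<in> {1..m}"
          have "norm (integral {s..t} (\<alpha> j)) \<le> integral {s..t} (\<lambda>t. \<bar>\<alpha> j t\<bar>)"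
            using st' by (intro integral_norm_bound_integral sub[OF \<alpha>i(1)[OF j]] sub[OF \<alpha>i(2)[OF j]]) auto
          then show "\<bar>K j t - K j s\<bar> \<le> integral {s..t} (\<lambda>t. \<bar>\<alpha> j t\<bar>)" using Kd[OF st' j] by simp
        qed
        also have "\<dots> = integral {s..t} h"
          unfolding h_def[abs_def] using st'
          by (intro Henstock_Kurzweil_Integration.integral_sum[symmetric] sub[OF \<alpha>i(2)]) auto
        finally show "(\<Sum>j=1..m. \<bar>K j t - K j s\<bar>) \<le> H t - H s" by (simp add: Hd[OF st'])
        have u1: "norm (f t - f s) \<le> M * (H t - H s)" if st: "a \<le> s" "s \<le> t" "t \<le> b" for s t
        proof -
          have st': "p \<le> s" "s \<le> t" "t \<le> q" using st pqab by auto
          have "norm (integral {s..t} ?V) \<le> integral {s..t} (\<lambda>t. M * h t)"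
          proof (rule integral_norm_bound_integral)
            show "?V integrable_on {s..t}" using fi[OF st] by blast
            show "(\<lambda>t. M * h t) integrable_on {s..t}" using sub[OF hi st'(1,3)] by (simp add: integrable_on_mult_right)
            fix \<tau> assume "\<tau> \<in> {s..t}"
            then have "f \<tau> \<in> cball (snd d (\<gamma> z)) r" using st by (intro cb) auto
            then have "norm (?V \<tau>) \<le> (\<Sum>j=1..m. \<bar>\<alpha> j \<tau>\<bar> * M)"
              by (intro order_trans[OF norm_sum] sum_mono) (auto intro!: mult_left_mono ac.bd)
            then show "norm (?V \<tau>) \<le> M * h \<tau>" by (simp add: h_def sum_distrib_left mult.commute)
          qed
          then show ?thesis using integral_unique[OF fi[OF st]] Hd[OF st'] by simp
        qed
        show "norm (f t - f s) \<le> M * (H t - H s)" by (rule u1[OF st])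
        \<comment> \<open>The fields frozen at \<open>f s\<close>. The integral of
          \<open>?V - ?W\<close> is the Euler error of the curve; the Lipschitz bound combined with
          \<open>u1\<close> makes it quadratic in the increment of \<open>H\<close>.\<close>
        let ?W = "\<lambda>\<tau>. \<Sum>j=1..m. \<alpha> j \<tau> *\<^sub>R vf d (X j) (f s)"
        have "(?W has_integral (\<Sum>j=1..m. (K j t - K j s) *\<^sub>R vf d (X j) (f s))) {s..t}"
          using st' by (intro has_integral_sum has_integral_scaleR_left)
            (auto simp: Kd intro!: integrable_integral sub[OF \<alpha>i(1)])
        from has_integral_diff[OF fi[OF st] this]
        have I: "((\<lambda>\<tau>. ?V \<tau> - ?W \<tau>) has_integral (f t - f s - (\<Sum>j=1..m. (K j t - K j s) *\<^sub>R vf d (X j) (f s)))) {s..t}" .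
        have "norm (integral {s..t} (\<lambda>\<tau>. ?V \<tau> - ?W \<tau>)) \<le> integral {s..t} (\<lambda>\<tau>. (\<Lambda> * (M * (H t - H s))) * h \<tau>)"
        proof (rule integral_norm_bound_integral)
          show "(\<lambda>\<tau>. ?V \<tau> - ?W \<tau>) integrable_on {s..t}" using I by blast
          show "(\<lambda>\<tau>. (\<Lambda> * (M * (H t - H s))) * h \<tau>) integrable_on {s..t}"
            using hst by (simp add: integrable_on_mult_right)
          fix \<tau> assume \<tau>: "\<tau> \<in> {s..t}"
          have c: "f \<tau> \<in> cball (snd d (\<gamma> z)) r" "f s \<in> cball (snd d (\<gamma> z)) r" 
            using cb[of \<tau>] cb[of s] st \<tau> by auto
          have "H \<tau> \<le> H t"
            using Hd[of \<tau> t] \<tau> st' h0 Henstock_Kurzweil_Integration.integral_nonneg[OF sub[OF hi, of \<tau> t]] by auto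
          then have le: "norm (f \<tau> - f s) \<le> M * (H t - H s)"
            using u1[of s \<tau>] \<tau> st mult_left_mono[of "H \<tau> - H s" "H t - H s" M] ac.pos by auto
          have "?V \<tau> - ?W \<tau> = (\<Sum>j=1..m. \<alpha> j \<tau> *\<^sub>R (vf d (X j) (f \<tau>) - vf d (X j) (f s)))"
            by (simp add: sum_subtractf scaleR_diff_right)
          also have "norm \<dots> \<le> (\<Sum>j=1..m. \<bar>\<alpha> j \<tau>\<bar> * (\<Lambda> * (M * (H t - H s))))"
          proof (rule order_trans[OF norm_sum sum_mono])
            fix j assume j: "j \<in> {1..m}"
            have "norm (vf d (X j) (f \<tau>) - vf d (X j) (f s)) \<le> \<Lambda> * norm (f \<tau> - f s)" by (rule ac.Lip[OF j c])
            also have "\<dots> \<le> \<Lambda> * (M * (H t - H s))" by (intro mult_left_mono le ac.pos)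
            finally show "norm (\<alpha> j \<tau> *\<^sub>R (vf d (X j) (f \<tau>) - vf d (X j) (f s))) \<le> \<bar>\<alpha> j \<tau>\<bar> * (\<Lambda> * (M * (H t - H s)))"
              unfolding norm_scaleR by (intro mult_left_mono) auto
          qed
          also have "\<dots> = (\<Lambda> * (M * (H t - H s))) * h \<tau>"
            by (simp add: h_def sum_distrib_right[symmetric] mult.commute)
          finally show "norm (?V \<tau> - ?W \<tau>) \<le> (\<Lambda> * (M * (H t - H s))) * h \<tau>" .
        qed
        then show "norm (f t - f s - (\<Sum>j=1..m. (K j t - K j s) *\<^sub>R vf d (X j) (f s))) \<le> \<Lambda> * M * (H t - H s)\<^sup>2"
          unfolding integral_unique[OF I] by (simp add: Hd[OF st', symmetric] power2_eq_square mult_ac)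
      qed
      moreover have "norm (\<Sum>j=1..m. (K j b - K j a) *\<^sub>R orbit (C j) v (\<gamma> z)) \<le> norm v * integral {a..b} n"
      proof -
        \<comment> \<open>Pulling out the isometry \<open>\<pi> (\<gamma> z)\<close> leaves a
          combination of the \<open>C j\<close> at a vector of the same norm as
          \<open>v\<close>.\<close>
        have "(\<Sum>j=1..m. (K j b - K j a) *\<^sub>R orbit (C j) v (\<gamma> z)) =
          \<pi> (\<gamma> z) (\<Sum>j=1..m. (K j b - K j a) *\<^sub>R C j (\<pi> (- \<gamma> z) v))"
          by (simp add: orbit_def blinfun.sum_right blinfun.scaleR_right)
        then have "norm (\<Sum>j=1..m. (K j b - K j a) *\<^sub>R orbit (C j) v (\<gamma> z)) \<le> L2_set (\<lambda>j. K j b - K j a) {1..m} * norm v"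
          using C[of "\<lambda>j. K j b - K j a" "\<pi> (- \<gamma> z) v"] by (simp add: rep_norm)
        also have "L2_set (\<lambda>j. K j b - K j a) {1..m} = L2_set (\<lambda>j. integral {a..b} (\<alpha> j)) {1..m}"
          by (rule L2_set_cong) (use Kd ab pqab in auto)
        also have "\<dots> \<le> integral {a..b} n"
          using pqab by (intro L2_set_integral_le sub[OF \<alpha>i(1)] sub[OF n(1)] n(2)) auto
        finally show ?thesis by (simp add: mult.commute mult_right_mono)
      qed
      ultimately have "norm (orbit x v (\<gamma> b) - orbit x v (\<gamma> a)) \<le> norm v * integral {a..b} n + \<epsilon> * (H b - H a)"
        using norm_triangle_sub[of "orbit x v (\<gamma> b) - orbit x v (\<gamma> a)" "\<Sum>j=1..m. (K j b - K j a) *\<^sub>R orbit (C j) v (\<gamma> z)"]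
        by linarith
      then show "norm (orbit x v (\<gamma> b) - orbit x v (\<gamma> a)) \<le> norm v * integral {a..b} n + \<epsilon> * integral {a..b} h"
        using Hd[of a b] ab pqab by simp
    qed
    moreover have "\<delta> > 0" using \<delta>1 \<delta>2(1) \<delta>3(1) by (simp add: \<delta>_def)
    ultimately show ?case by blast
  qed
  then show "norm (orbit x v (\<gamma> q) - orbit x v (\<gamma> p)) \<le> norm v * integral {p..q} n + e"
    using \<epsilon>(2) unfolding P_def by auto
qed

section \<open>From smooth pieces to horizontal curves and the cost\<close>

lemma linear_representation:
  assumes "independent E" "span E = UNIV"
  shows "linear (\<lambda>y. representation E y b)"
  by (rule linearI) (simp_all add: assms representation_add representation_scale)

text \<open>Finite length makes \<open>n\<close> integrable; the coefficients of \<open>Y\<close>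
  are measurable and dominated by \<open>n\<close>. The bounds on the smooth pieces then add up
  along the partition.\<close>

lemma horizontal_bound:
  assumes comm: "\<And>j. j \<in> {1..m} \<Longrightarrow> is_bounded_commutator \<A> c0 \<pi> (X j) x (C j)"
    and C: "\<And>a y. norm (\<Sum>j=1..m. a j *\<^sub>R C j y) \<le> L2_set a {1..m} * norm y"
    and X: "independent (X ` {1..m})" "inj_on X {1..m}"
    and hor: "horizontal \<A> c0 (span (X ` {1..m})) \<gamma> Y"
    and fin: "(\<integral>\<^sup>+ t. ennreal (hnorm m X (Y t)) \<partial>lebesgue_on {0..1}) < \<infinity>"
  shows "norm (orbit x v (\<gamma> 1) - orbit x v (\<gamma> 0)) \<le>
    norm v * enn2real (\<integral>\<^sup>+ t. ennreal (hnorm m X (Y t)) \<partial>lebesgue_on {0..1})"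
proof -
  let ?B = "X ` {1..m}" and ?M = "lebesgue_on {0..1::real}"
  define \<alpha> where "\<alpha> j t = representation ?B (Y t) (X j)" for j t
  define n where "n t = hnorm m X (Y t)" for t
  have n: "n t = L2_set (\<lambda>j. \<alpha> j t) {1..m}" for t
    by (simp add: n_def hnorm_def L2_set_def \<alpha>_def)
  have Y: "Y \<in> borel_measurable ?M" "\<And>t. t \<in> {0..1} \<Longrightarrow> Y t \<in> span ?B"
    using hor by (auto simp: horizontal_def)
  have Y\<alpha>: "Y t = (\<Sum>j=1..m. \<alpha> j t *\<^sub>R X j)" if "t \<in> {0..1}" for t
    using sum_representation_eq[OF X(1) Y(2)[OF that], of ?B] X(2) by (simp add: sum.reindex \<alpha>_def)
  \<comment> \<open>The coefficients with respect to \<open>?B\<close> form linear functionals on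
    its span only. Extending \<open>?B\<close> to a basis of the whole space gives linear, hence
    continuous, functionals that agree with them along \<open>Y\<close>.\<close>
  have \<alpha>m: "\<alpha> j \<in> borel_measurable ?M" for j
  proof -
    let ?E = "extend_basis ?B"
    let ?\<phi> = "\<lambda>y. representation ?E y (X j)"
    have E: "independent ?E" "span ?E = UNIV" "?B \<subseteq> ?E"
      using X(1) by (auto simp: independent_extend_basis span_extend_basis extend_basis_superset)
    have "linear ?\<phi>"
      by (rule linear_representation[OF E(1,2)])
    then have "continuous_on UNIV ?\<phi>"
      by (intro linear_continuous_on finite_dim_bounded_linear[OF finite_dim_model])
    then have "?\<phi> \<in> borel_measurable borel" by (rule borel_measurable_continuous_onI)
    then have "(\<lambda>t. ?\<phi> (Y t)) \<in> borel_measurable ?M" by (rule measurable_compose[OF Y(1)])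
    then show ?thesis
      by (subst measurable_cong[where g = "\<lambda>t. ?\<phi> (Y t)"])
        (use Y(2) representation_extend[OF E(1) _ E(3)] in \<open>auto simp: \<alpha>_def\<close>)
  qed
  have nm: "n \<in> borel_measurable ?M"
    unfolding n[abs_def] L2_set_def using \<alpha>m by measurable
  have n0: "0 \<le> n t" for t by (simp add: n)
  have "integrable ?M n"
    using nm n0 fin by (intro integrableI_nonneg) (auto simp: n_def)
  then have ni: "n integrable_on {0..1}"
    and nI: "enn2real (\<integral>\<^sup>+ t. ennreal (hnorm m X (Y t)) \<partial>?M) = integral {0..1} n"
    using nn_integral_eq_integral[OF \<open>integrable ?M n\<close>] n0 lebesgue_integral_eq_integral[OF \<open>integrable ?M n\<close>]
      Henstock_Kurzweil_Integration.integral_nonneg[of n "{0..1}"]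
    by (auto simp: n_def[symmetric] integrable_on_lebesgue_on)
  have \<alpha>i: "\<alpha> j absolutely_integrable_on {0..1}" if j: "j \<in> {1..m}" for j
  proof -
    have "integrable ?M (\<alpha> j)"
    proof (rule Bochner_Integration.integrable_bound[OF \<open>integrable ?M n\<close> \<alpha>m])
      have "\<bar>\<alpha> j t\<bar> \<le> \<bar>n t\<bar>" for t
        using member_le_L2_set[of "{1..m}" j "\<lambda>j. \<bar>\<alpha> j t\<bar>"] j by (simp add: n L2_set_def)
      then show "AE t in ?M. norm (\<alpha> j t) \<le> norm (n t)" by simp
    qed
    then show ?thesis by (simp add: integrable_restrict_space set_integrable_def)
  qed
  have "AE t in lebesgue. t \<in> {0..1} \<longrightarrow> left_velocity \<A> c0 \<gamma> {0..1} t (Y t)"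
    using hor by (subst AE_restrict_space_iff[symmetric]) (auto simp: horizontal_def)
  then obtain N where N: "{t. \<not> (t \<in> {0..1} \<longrightarrow> left_velocity \<A> c0 \<gamma> {0..1} t (Y t))} \<subseteq> N"
    "emeasure lebesgue N = 0" "N \<in> sets lebesgue"
    by (auto elim!: AE_E)
  have Nn: "negligible N" using N(2,3) by (auto simp: negligible_iff_null_sets)
  have lv: "left_velocity \<A> c0 \<gamma> UNIV t (\<Sum>j=1..m. \<alpha> j t *\<^sub>R X j)" if "t \<in> {0<..<1} - N" for t
  proof -
    have "left_velocity \<A> c0 \<gamma> {0..1} t (Y t)"
      using that N(1) greaterThanLessThan_subseteq_atLeastAtMost_iff[of 0 1 0 "1::real"] by blast
    \<comment> \<open>At interior times, derivatives within \<open>{0..1}\<close> are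
      two-sided.\<close>
    then show ?thesis using that Y\<alpha>[of t] unfolding left_velocity_def by (simp add: at_within_Icc_at)
  qed
  obtain k \<tau> where \<tau>: "\<tau> 0 = 0" "\<tau> k = (1::real)"
    "\<And>i. i < k \<Longrightarrow> \<tau> i < \<tau> (Suc i) \<and> smooth_curve_on \<A> \<gamma> {\<tau> i..\<tau> (Suc i)}"
    using hor unfolding horizontal_def piecewise_smooth_curve_def by blast
  have mono: "\<tau> i \<le> \<tau> j" if "i \<le> j" "j \<le> k" for i j
    using that
  proof (induction j rule: dec_induct)
    case (step j)
    then show ?case using \<tau>(3)[of j] by simp
  qed simp
  have "norm (orbit x v (\<gamma> (\<tau> i)) - orbit x v (\<gamma> 0)) \<le> norm v * integral {0..\<tau> i} n" if "i \<le> k" for i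
    using that
  proof (induction i)
    case 0
    then show ?case by (simp add: \<tau>)
  next
    case (Suc i)
    let ?p = "\<tau> i" and ?q = "\<tau> (Suc i)"
    have pq: "0 \<le> ?p" "?p \<le> ?q" "?q \<le> 1"
      using mono[of 0 i] mono[of i "Suc i"] mono[of "Suc i" k] Suc.prems \<tau>(1,2) by auto
    have sub: "{?p..?q} \<subseteq> {0..1}" using pq by auto
    have "norm (orbit x v (\<gamma> ?q) - orbit x v (\<gamma> ?p)) \<le> norm v * integral {?p..?q} n"
    proof (rule smooth_piece_bound[OF comm C])
      show "\<alpha> j absolutely_integrable_on {?p..?q}" if "j \<in> {1..m}" for j
        by (rule set_integrable_subset[OF \<alpha>i[OF that]]) (use sub in auto)
      show "n integrable_on {?p..?q}" by (rule integrable_on_subinterval[OF ni sub])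
      show "smooth_curve_on \<A> \<gamma> {?p..?q}" using \<tau>(3)[of i] Suc.prems by simp
      show "left_velocity \<A> c0 \<gamma> UNIV t (\<Sum>j=1..m. \<alpha> j t *\<^sub>R X j)" if "t \<in> {?p<..<?q} - N" for t
        using that pq by (intro lv) auto
    qed (use pq Nn n in auto)
    moreover have "norm (orbit x v (\<gamma> ?p) - orbit x v (\<gamma> 0)) \<le> norm v * integral {0..?p} n"
      using Suc by simp
    moreover have "norm (orbit x v (\<gamma> ?q) - orbit x v (\<gamma> 0)) \<le>
        norm (orbit x v (\<gamma> ?q) - orbit x v (\<gamma> ?p)) + norm (orbit x v (\<gamma> ?p) - orbit x v (\<gamma> 0))"
      using norm_triangle_ineq[of "orbit x v (\<gamma> ?q) - orbit x v (\<gamma> ?p)" "orbit x v (\<gamma> ?p) - orbit x v (\<gamma> 0)"] by simp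
    moreover have "integral {0..?q} n = integral {0..?p} n + integral {?p..?q} n"
      using pq by (intro Henstock_Kurzweil_Integration.integral_combine[symmetric] integrable_on_subinterval[OF ni]) auto
    ultimately show ?case by (simp add: distrib_left)
  qed
  from this[of k] show ?thesis by (simp add: \<tau> nI)
qed

text \<open>Conjugating back: the difference applied to \<open>w\<close> is
  \<open>\<pi> (- g)\<close> of the orbit difference for the vector \<open>\<pi> g w\<close>, and
  both operators are isometric.\<close>

lemma ad_channel_diff_le:
  assumes "\<And>v. norm (orbit x v 0 - orbit x v g) \<le> norm v * R" "0 \<le> R"
  shows "norm (ad_channel (\<pi> g) x - x) \<le> R"
proof (rule norm_blinfun_bound[OF assms(2)])
  fix w
  have "(ad_channel (\<pi> g) x - x) w = \<pi> (- g) (orbit x (\<pi> g w) 0 - orbit x (\<pi> g w) g)"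
    by (simp add: ad_channel_def cadj_rep orbit_def rep_minus rep_0 blinfun.diff_left blinfun.diff_right)
  then show "norm ((ad_channel (\<pi> g) x - x) w) \<le> R * norm w"
    using assms(1)[of "\<pi> g w"] by (simp add: rep_norm mult.commute)
qed

end

text \<open>\<open>hnorm\<close> reads coefficients through \<open>representation\<close>, which
  asks for an independent set, and indexing them by \<open>j\<close> asks for injectivity. The laws
  of \<open>ip\<close> hold on \<open>\<hh>\<close> only, hence the membership facts before each use
  of linearity.\<close>

lemma orthonormal_basis_independent:
  assumes "subspace \<hh>" "inner_product_on \<hh> ip" "orthonormal_basis \<hh> ip m X"
  shows "independent (X ` {1..m})" "inj_on X {1..m}"
proof -
  have X: "X i \<in> \<hh>" if "i \<in> {1..m}" for i using assms(3) that by (simp add: orthonormal_basis_def)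
  have on: "ip (X i) (X j) = (if i = j then 1 else 0)" if "i \<in> {1..m}" "j \<in> {1..m}" for i j
    using assms(3) that by (simp add: orthonormal_basis_def)
  show inj: "inj_on X {1..m}"
  proof (rule inj_onI)
    fix i j assume ij: "i \<in> {1..m}" "j \<in> {1..m}" "X i = X j"
    then have "ip (X i) (X j) = ip (X i) (X i)" by simp
    then show "i = j" using on[OF ij(1,2)] on[OF ij(1,1)] by (simp split: if_splits)
  qed
  have ip_add: "\<forall>x\<in>\<hh>. \<forall>y\<in>\<hh>. \<forall>z\<in>\<hh>. ip (x + y) z = ip x z + ip y z"
    and ip_scale: "\<forall>r. \<forall>x\<in>\<hh>. \<forall>y\<in>\<hh>. ip (r *\<^sub>R x) y = r * ip x y"
    using assms(2) unfolding inner_product_on_def by simp_all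
  have zero: "ip 0 y = 0" if "y \<in> \<hh>" for y
  proof -
    have "ip (0 *\<^sub>R y) y = 0 * ip y y" using ip_scale[THEN spec, THEN bspec, OF that, THEN bspec, OF that] .
    then show ?thesis by simp
  qed
  have sum: "ip (\<Sum>j\<in>S. a j *\<^sub>R X j) (X i) = (\<Sum>j\<in>S. a j * ip (X j) (X i))"
    if "finite S" "S \<subseteq> {1..m}" "i \<in> {1..m}" for S a i
    using that(1,2)
  proof (induction S rule: finite_induct)
    case empty
    then show ?case by (simp add: zero[OF X[OF that(3)]])
  next
    case (insert k S)
    have h: "a k *\<^sub>R X k \<in> \<hh>" "(\<Sum>j\<in>S. a j *\<^sub>R X j) \<in> \<hh>" "X i \<in> \<hh>" "X k \<in> \<hh>"
      using insert.prems X that(3) by (auto intro!: subspace_scale[OF assms(1)] subspace_sum[OF assms(1)])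
    have "ip (a k *\<^sub>R X k + (\<Sum>j\<in>S. a j *\<^sub>R X j)) (X i) = ip (a k *\<^sub>R X k) (X i) + ip (\<Sum>j\<in>S. a j *\<^sub>R X j) (X i)"
      using ip_add[THEN bspec, OF h(1), THEN bspec, OF h(2), THEN bspec, OF h(3)] .
    moreover have "ip (a k *\<^sub>R X k) (X i) = a k * ip (X k) (X i)"
      using ip_scale[THEN spec, THEN bspec, OF h(4), THEN bspec, OF h(3)] .
    ultimately show ?case using insert by simp
  qed
  show "independent (X ` {1..m})"
  proof (rule independent_if_scalars_zero)
    fix f b assume f: "(\<Sum>b\<in>X ` {1..m}. f b *\<^sub>R b) = 0" and "b \<in> X ` {1..m}"
    then obtain i where i: "b = X i" "i \<in> {1..m}" by blast
    have "(\<Sum>j=1..m. f (X j) *\<^sub>R X j) = 0" using f inj by (simp add: sum.reindex)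
    then have "(\<Sum>j=1..m. f (X j) * ip (X j) (X i)) = 0"
      using sum[OF _ order_refl i(2), of "\<lambda>j. f (X j)"] zero[OF X[OF i(2)]] by simp
    moreover have "(\<Sum>j=1..m. f (X j) * ip (X j) (X i)) = (\<Sum>j=1..m. if j = i then f (X i) else 0)"
    proof (rule sum.cong[OF refl])
      fix j assume "j \<in> {1..m}"
      from on[OF this i(2)] show "f (X j) * ip (X j) (X i) = (if j = i then f (X i) else 0)" by simp
    qed
    ultimately show "f b = 0" using i by (simp add: sum.delta)
  qed simp
qed

theorem theorem1p3:
  fixes \<A> :: "('g::{topological_group_add, t2_space}, 'e::banach) chart set"
    and c0 :: "('g, 'e) chart"
    and \<hh> :: "'e set" and ip :: "'e \<Rightarrow> 'e \<Rightarrow> real"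
    and m :: nat and X :: "nat \<Rightarrow> 'e"
    and \<pi> :: "'g \<Rightarrow> ('k::complex_hilbert_space \<Rightarrow>\<^sub>L 'k)"
    and g :: 'g
  assumes "lie_group \<A>" and "locally compact (UNIV :: 'g set)"
    and "c0 \<in> \<A>" and "0 \<in> fst c0"
    and "subspace \<hh>" and "hoermander_system c0 \<hh>"
    and "inner_product_on \<hh> ip" and "orthonormal_basis \<hh> ip m X"
    and "unitary_rep \<pi>"
  shows "Cost (lip_domain \<A> c0 \<pi> m X) (lip_seminorm \<A> c0 \<pi> m X) (ad_channel (\<pi> g))
           \<le> cc_dist \<A> c0 \<hh> m X g 0"
proof -
  interpret lie_group_rep \<A> c0 \<pi> using assms by unfold_locales
  have span: "span (X ` {1..m}) = \<hh>" using assms(8) by (simp add: orthonormal_basis_def)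
  note X = orthonormal_basis_independent[OF assms(5,7,8)]
  show ?thesis
    unfolding Cost_def cc_dist_def
  proof (intro SUP_least Inf_greatest)
    fix x I
    assume "x \<in> {x \<in> lip_domain \<A> c0 \<pi> m X. x = cadj x \<and> lip_seminorm \<A> c0 \<pi> m X x \<le> 1}"
    then have x: "x \<in> lip_domain \<A> c0 \<pi> m X" "lip_seminorm \<A> c0 \<pi> m X x \<le> 1" by auto
    assume "I \<in> {\<integral>\<^sup>+ t. ennreal (hnorm m X (Y t)) \<partial>lebesgue_on {0..1} | \<gamma> Y.
      horizontal \<A> c0 \<hh> \<gamma> Y \<and> \<gamma> 0 = g \<and> \<gamma> 1 = 0}"
    then obtain \<gamma> Y where I: "I = (\<integral>\<^sup>+ t. ennreal (hnorm m X (Y t)) \<partial>lebesgue_on {0..1})"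
      and \<gamma>: "horizontal \<A> c0 \<hh> \<gamma> Y" "\<gamma> 0 = g" "\<gamma> 1 = 0" by blast
    define C where "C j = commutator \<A> c0 \<pi> (X j) x" for j
    have comm: "is_bounded_commutator \<A> c0 \<pi> (X j) x (C j)" if "j \<in> {1..m}" for j
      using x(1) that is_bounded_commutator_commutator unfolding lip_domain_def C_def by blast
    have C: "norm (\<Sum>j=1..m. a j *\<^sub>R C j y) \<le> L2_set a {1..m} * norm y" for a y
    proof -
      have "norm (\<Sum>j=1..m. a j *\<^sub>R C j y) \<le>
          L2_set a {1..m} * (sqrt (norm (\<Sum>j=1..m. cadj (C j) o\<^sub>L C j)) * norm y)"
        by (rule norm_combination_le) (use comm in \<open>auto simp: is_bounded_commutator_def\<close>)
      \<comment> \<open>The square root is the semi-norm of \<open>x\<close>, which is at most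
        1.\<close>
      also have "\<dots> \<le> L2_set a {1..m} * (1 * norm y)"
        using x(2) unfolding lip_seminorm_def C_def by (intro mult_left_mono mult_right_mono) auto
      finally show ?thesis by simp
    qed
    show "ennreal (norm (ad_channel (\<pi> g) x - x)) \<le> I"
    \<comment> \<open>A curve of infinite length gives a trivial bound; finite length allows passing
      to real numbers.\<close>
    proof (cases "I < \<infinity>")
      case True
      have "norm (orbit x v 0 - orbit x v g) \<le> norm v * enn2real I" for v
        unfolding I \<gamma>(2,3)[symmetric]
      proof (rule horizontal_bound[where C = C])
        show "horizontal \<A> c0 (span (X ` {1..m})) \<gamma> Y" unfolding span by (rule \<gamma>(1))
        show "(\<integral>\<^sup>+ t. ennreal (hnorm m X (Y t)) \<partial>lebesgue_on {0..1}) < \<infinity>" using True unfolding I .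
      qed (rule comm C X, assumption?)+
      then have "norm (ad_channel (\<pi> g) x - x) \<le> enn2real I"
        by (rule ad_channel_diff_le) simp
      then have "ennreal (norm (ad_channel (\<pi> g) x - x)) \<le> ennreal (enn2real I)" by (rule ennreal_leI)
      also have "\<dots> = I" using True by simp
      finally show ?thesis .
    qed (simp add: not_less top_unique)
  qed
qed

end
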